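(* Let $M$ be a $\sigma$-compact smooth manifold of dimension $k\ge 1$ with a locally Lebesgue measure $\mu$, let $G\subseteq \mathrm{U}_n(\mathbb{C})$ be a closed subgroup, let $E\to M$ be a complex vector bundle with typical fibre $\mathbb{C}^n$ which is a $G$-bundle, and let $L^2(E)$ be its Hilbert space of $L^2$-sections. Let $S\subset M$ be a relatively compact Borel set, with complement $S^c=M\setminus S$. Then there is a conditional expectation $\nu_S:\mathrm{CAR}(L^2(E))\to\mathcal{A}(S)\subset\mathrm{CAR}(L^2(E))$ which satisfies $\nu_S(\alpha_h(A))=\nu_S(A)$ for all $h\in\mathrm{U}(L^\infty_{\mathbb{C}}(S^c))$ and all $A\in\mathrm{CAR}(L^2(E))$, and $$\nu_S\big(a(f_1)^*\cdots a(f_n)^*a(g_1)\cdots a(g_m)\big)=a(p_Sf_1)^*\cdots a(p_Sf_n)^*a(p_Sg_1)\cdots a(p_Sg_m)$$ for all $n,m\in\mathbb{N}_0$ and all $f_i,g_j\in L^2(E)$, where $p_S$ is the orthogonal projection of $L^2(E)$ onto the subspace $L^2(E|_S)$.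
   Context: For a complex Hilbert space $\mathcal{H}$ (inner product antilinear in the first variable), $\mathrm{CAR}(\mathcal{H})$ is the unital $C^*$-algebra, unique up to natural isomorphism, generated by the image of a continuous antilinear map $a:\mathcal{H}\to\mathrm{CAR}(\mathcal{H})$ with $a(f)a(g)^*+a(g)^*a(f)=\langle f,g\rangle\mathbf{1}$ and $a(f)a(g)+a(g)a(f)=0$ for all $f,g\in\mathcal{H}$ (with $\mathrm{CAR}(\{0\})=\mathbb{C}\mathbf{1}$). The unitary group $\mathrm{U}(\mathcal{H})$ acts on it by automorphisms $\alpha_U$ determined by $\alpha_U(a(f))=a(Uf)$. A conditional expectation on a unital $C^*$-algebra $\mathcal{B}$ is a positive linear map $\nu:\mathcal{B}\to\mathcal{B}$ with $\nu(\mathbf{1})=\mathbf{1}$ and $\nu(A\nu(B))=\nu(\nu(A)B)=\nu(A)\nu(B)$ for all $A,B\in\mathcal{B}$. A $G$-bundle is a vector bundle with typical fibre $\mathbb{C}^n$ having an atlas of local trivializations whose transition functions take values in $G$; since $G$ is unitary, the Euclidean norm on $\mathbb{C}^n$ induces a well-defined fibrewise norm $|\cdot|$ on $E$. A locally Lebesgue measure $\mu$ on $M$ is a Borel measure, finite on compact sets, which in each local chart is equivalent (mutually absolutely continuous) to Lebesgue measure on $\mathbb{R}^k$ (e.g. one given by a nowhere vanishing smooth $k$-form). $L^2(E)$ is the Hilbert space completion of the space of smooth sections $c$ of $E$ with $\|c\|^2=\int_M|c(x)|^2\,d\mu(x)<\infty$. $L^\infty_{\mathbb{C}}(M)=L^\infty(M,\mu;\mathbb{C})$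 acts on $L^2(E)$ by pointwise multiplication, and its unitary group $\mathrm{U}(L^\infty_{\mathbb{C}}(M))$ is viewed as a subgroup of $\mathrm{U}(L^2(E))$. For a Borel set $S\subseteq M$, $L^2(E|_S):=\chi_S L^2(E)$, $\mathcal{A}(S)$ is the unital $C^*$-subalgebra of $\mathrm{CAR}(L^2(E))$ generated by $\{a(c):c\in L^2(E|_S)\}$, and $\mathrm{U}(L^\infty_{\mathbb{C}}(S^c))$ is identified with the group of those $u\in\mathrm{U}(L^\infty_{\mathbb{C}}(M))$ equal to $1$ ($\mu$-a.e.) on $S$. The empty product ($n=m=0$) is $\mathbf{1}$. *)

theory Defs
  imports "HOL-Analysis.Analysis" "HOL-Algebra.Group"
begin

section \<open>Smooth manifolds and locally Lebesgue measures\<close>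

text \<open>Real \<open>C\<^sup>k\<close> and \<open>C\<^sup>\<infinity>\<close> maps; only meaningful on open sets.\<close>

fun Ck_on :: "nat \<Rightarrow> 'a::real_normed_vector set \<Rightarrow> ('a \<Rightarrow> 'b::real_normed_vector) \<Rightarrow> bool" where
  "Ck_on 0 X f \<longleftrightarrow> continuous_on X f"
| "Ck_on (Suc k) X f \<longleftrightarrow> (\<forall>x\<in>X. f differentiable (at x)) \<and>
     (\<forall>v. Ck_on k X (\<lambda>x. frechet_derivative f (at x) v))"

definition smooth_on :: "'a::real_normed_vector set \<Rightarrow> ('a \<Rightarrow> 'b::real_normed_vector) \<Rightarrow> bool" where
  "smooth_on X f \<longleftrightarrow> (\<forall>k. Ck_on k X f)"

text \<open>The manifold is the Hausdorff space \<open>UNIV :: 'm set\<close>. A chart is a pair of an open domain and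
  a map which is only meaningful on that domain.\<close>

type_synonym ('m, 'k) chart = "'m set \<times> ('m \<Rightarrow> real ^ 'k)"

definition is_chart :: "'m::t2_space set \<Rightarrow> ('m \<Rightarrow> real ^ 'k::finite) \<Rightarrow> bool" where
  "is_chart U \<phi> \<longleftrightarrow> open U \<and> open (\<phi> ` U) \<and> homeomorphism U (\<phi> ` U) \<phi> (inv_into U \<phi>)"

definition smooth_atlas :: "('m::t2_space, 'k::finite) chart set \<Rightarrow> bool" where
  "smooth_atlas \<A> \<longleftrightarrow>
     (\<forall>(U, \<phi>)\<in>\<A>. is_chart U \<phi>) \<and> (\<Union>(U, \<phi>)\<in>\<A>. U) = UNIV \<and>
     (\<forall>(U, \<phi>)\<in>\<A>. \<forall>(V, \<eta>)\<in>\<A>. smooth_on (\<phi> ` (U \<inter> V)) (\<eta> \<circ> inv_into U \<phi>))"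

definition smooth_charts :: "('m::t2_space, 'k::finite) chart set \<Rightarrow> ('m, 'k) chart set" where
  \<comment> \<open>the maximal atlas containing \<open>\<A>\<close>\<close>
  "smooth_charts \<A> = {(U, \<phi>). is_chart U \<phi> \<and>
     (\<forall>(V, \<eta>)\<in>\<A>. smooth_on (\<phi> ` (U \<inter> V)) (\<eta> \<circ> inv_into U \<phi>) \<and>
                   smooth_on (\<eta> ` (U \<inter> V)) (\<phi> \<circ> inv_into V \<eta>))}"

definition smooth_map_on ::
  "('m::t2_space, 'k::finite) chart set \<Rightarrow> 'm set \<Rightarrow> ('m \<Rightarrow> 'b::real_normed_vector) \<Rightarrow> bool" where
  "smooth_map_on \<A> W f \<longleftrightarrow> (\<forall>(U, \<phi>)\<in>\<A>. smooth_on (\<phi> ` (U \<inter> W)) (f \<circ> inv_into U \<phi>))"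

definition sigma_compact_space :: "'m::topological_space itself \<Rightarrow> bool" where
  "sigma_compact_space _ \<longleftrightarrow>
     (\<exists>K :: nat \<Rightarrow> 'm set. (\<forall>i. compact (K i)) \<and> (\<Union>i. K i) = UNIV)"

definition locally_Lebesgue :: "('m::t2_space, 'k::finite) chart set \<Rightarrow> 'm measure \<Rightarrow> bool" where
  "locally_Lebesgue \<A> \<mu> \<longleftrightarrow>
     sets \<mu> = sets borel \<and> (\<forall>K. compact K \<longrightarrow> emeasure \<mu> K < \<infinity>) \<and>
     (\<forall>(U, \<phi>)\<in>smooth_charts \<A>.
        let \<mu>U = distr (restrict_space \<mu> U) (restrict_space borel (\<phi> ` U)) \<phi>;
            leb = restrict_space lborel (\<phi> ` U)
        in absolutely_continuous \<mu>U leb \<and> absolutely_continuous leb \<mu>U)"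


section \<open>\<open>G\<close>-bundles\<close>

definition cadjoint :: "complex ^ 'n ^ 'n \<Rightarrow> complex ^ 'n ^ 'n" where
  "cadjoint A = (\<chi> i j. cnj (A $ j $ i))"

definition unitary_group :: "(complex ^ 'n::finite ^ 'n) monoid" where
  "unitary_group = \<lparr>carrier = {A. cadjoint A ** A = mat 1}, mult = (**), one = mat 1\<rparr>"

text \<open>A vector bundle with total space \<open>UNIV :: 'e set\<close>. The fibrewise operations \<open>fadd\<close>,
  \<open>fscale\<close> are total functions; \<open>fadd\<close> is only meaningful for two points of the same fibre.
  A local trivialization over \<open>V\<close> is given by its second component \<open>\<psi>\<close>, i.e. it is the map
  \<open>e \<mapsto> (proj e, \<psi> e)\<close> on the part of the total space over \<open>V\<close>.\<close>

record ('m, 'e, 'n::finite) vbundle =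
  proj :: "'e \<Rightarrow> 'm"
  fadd :: "'e \<Rightarrow> 'e \<Rightarrow> 'e"
  fscale :: "complex \<Rightarrow> 'e \<Rightarrow> 'e"
  trivs :: "('m set \<times> ('e \<Rightarrow> complex ^ 'n)) set"

text \<open>The last two conditions say that the fibre operations correspond to those of \<open>\<complex>\<^sup>n\<close>; together
  with the bijectivity of \<open>\<psi>\<close> on fibres they imply the vector space axioms on each fibre.\<close>

definition is_local_triv ::
  "('m::t2_space, 'e::topological_space, 'n::finite) vbundle \<Rightarrow> 'm set \<Rightarrow> ('e \<Rightarrow> complex ^ 'n) \<Rightarrow> bool"
  where
  "is_local_triv E V \<psi> \<longleftrightarrow>
     open V \<and>
     (\<exists>\<theta>. homeomorphism (proj E -` V) (V \<times> UNIV) (\<lambda>e. (proj E e, \<psi> e)) \<theta>) \<and>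
     (\<forall>e e'. proj E e \<in> V \<and> proj E e' = proj E e \<longrightarrow>
        proj E (fadd E e e') = proj E e \<and> \<psi> (fadd E e e') = \<psi> e + \<psi> e') \<and>
     (\<forall>z e. proj E e \<in> V \<longrightarrow>
        proj E (fscale E z e) = proj E e \<and> \<psi> (fscale E z e) = z *s \<psi> e)"

definition G_bundle ::
  "('m::t2_space, 'k::finite) chart set \<Rightarrow> (complex ^ 'n::finite ^ 'n) set \<Rightarrow>
   ('m, 'e::topological_space, 'n) vbundle \<Rightarrow> bool" where
  "G_bundle \<A> G E \<longleftrightarrow>
     continuous_on UNIV (proj E) \<and>
     (\<forall>(V, \<psi>)\<in>trivs E. is_local_triv E V \<psi>) \<and> (\<Union>(V, \<psi>)\<in>trivs E. V) = UNIV \<and>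
     (\<forall>(V, \<psi>)\<in>trivs E. \<forall>(W, \<eta>)\<in>trivs E. \<exists>g.
        smooth_map_on \<A> (V \<inter> W) g \<and> g ` (V \<inter> W) \<subseteq> G \<and>
        (\<forall>e. proj E e \<in> V \<inter> W \<longrightarrow> \<eta> e = g (proj E e) *v \<psi> e))"

text \<open>Independent of the trivialization because the transition functions are unitary.\<close>

definition fibre_norm :: "('m, 'e, 'n::finite) vbundle \<Rightarrow> 'e \<Rightarrow> real" where
  "fibre_norm E e = (THE r. \<forall>(V, \<psi>)\<in>trivs E. proj E e \<in> V \<longrightarrow> r = norm (\<psi> e))"

definition fibre_inner :: "('m, 'e, 'n::finite) vbundle \<Rightarrow> 'e \<Rightarrow> 'e \<Rightarrow> complex" where
  "fibre_inner E e e' =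
     (THE z. \<forall>(V, \<psi>)\<in>trivs E. proj E e \<in> V \<longrightarrow> z = (\<Sum>i\<in>UNIV. cnj (\<psi> e $ i) * \<psi> e' $ i))"


section \<open>The Hilbert space of square integrable sections\<close>

definition smooth_sections ::
  "('m::t2_space, 'k::finite) chart set \<Rightarrow> ('m, 'e, 'n::finite) vbundle \<Rightarrow> ('m \<Rightarrow> 'e) set" where
  "smooth_sections \<A> E =
     {c. (\<forall>x. proj E (c x) = x) \<and> (\<forall>(V, \<psi>)\<in>trivs E. smooth_map_on \<A> V (\<psi> \<circ> c))}"

definition borel_sections ::
  "('m::t2_space, 'e::topological_space, 'n::finite) vbundle \<Rightarrow> ('m \<Rightarrow> 'e) set" where
  "borel_sections E = {c \<in> borel_measurable borel. \<forall>x. proj E (c x) = x}"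

definition norm_sq_integral ::
  "('m, 'e, 'n::finite) vbundle \<Rightarrow> 'm measure \<Rightarrow> ('m \<Rightarrow> 'e) \<Rightarrow> ennreal" where
  "norm_sq_integral E \<mu> c = (\<integral>\<^sup>+ x. ennreal ((fibre_norm E (c x))\<^sup>2) \<partial>\<mu>)"

definition section_diff :: "('m, 'e, 'n::finite) vbundle \<Rightarrow> ('m \<Rightarrow> 'e) \<Rightarrow> ('m \<Rightarrow> 'e) \<Rightarrow> 'm \<Rightarrow> 'e" where
  "section_diff E c d = (\<lambda>x. fadd E (c x) (fscale E (- 1) (d x)))"

definition ae_class ::
  "('m::t2_space, 'e::topological_space, 'n::finite) vbundle \<Rightarrow> 'm measure \<Rightarrow> ('m \<Rightarrow> 'e) \<Rightarrow> ('m \<Rightarrow> 'e) set"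
  where
  "ae_class E \<mu> c = {d \<in> borel_sections E. AE x in \<mu>. d x = c x}"

definition pointwise_mult ::
  "('m::t2_space, 'e::topological_space, 'n::finite) vbundle \<Rightarrow> 'm measure \<Rightarrow> ('m \<Rightarrow> complex) \<Rightarrow>
   ('m \<Rightarrow> 'e) set \<Rightarrow> ('m \<Rightarrow> 'e) set" where
  "pointwise_mult E \<mu> u F = (\<Union>c\<in>F. ae_class E \<mu> (\<lambda>x. fscale E (u x) (c x)))"

record 'v cinner_space = "'v partial_object" +
  hadd :: "'v \<Rightarrow> 'v \<Rightarrow> 'v"
  hscale :: "complex \<Rightarrow> 'v \<Rightarrow> 'v"
  hinner :: "'v \<Rightarrow> 'v \<Rightarrow> complex"

text \<open>The completion of the square integrable smooth sections is realized as their closure among the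
  almost-everywhere classes of square integrable Borel sections, so that \<open>L\<^sup>\<infinity>\<close> functions can act
  by pointwise multiplication. All operations are defined on classes through representatives.\<close>

definition L2 ::
  "('m::t2_space, 'k::finite) chart set \<Rightarrow> 'm measure \<Rightarrow>
   ('m, 'e::topological_space, 'n::finite) vbundle \<Rightarrow> ('m \<Rightarrow> 'e) set cinner_space" where
  "L2 \<A> \<mu> E = \<lparr>
     carrier = {ae_class E \<mu> c | c. c \<in> borel_sections E \<and> norm_sq_integral E \<mu> c < \<infinity> \<and>
       (\<forall>\<epsilon>>0. \<exists>s\<in>smooth_sections \<A> E. norm_sq_integral E \<mu> s < \<infinity> \<and>
           norm_sq_integral E \<mu> (section_diff E c s) < ennreal (\<epsilon>\<^sup>2))},
     hadd = (\<lambda>F K. \<Union>c\<in>F. \<Union>d\<in>K. ae_class E \<mu> (\<lambda>x. fadd E (c x) (d x))),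
     hscale = (\<lambda>z. pointwise_mult E \<mu> (\<lambda>_. z)),
     hinner = (\<lambda>F K. THE z. \<exists>c\<in>F. \<exists>d\<in>K. z = (LINT x|\<mu>. fibre_inner E (c x) (d x)))\<rparr>"

definition L2_restrict ::
  "('m::t2_space, 'k::finite) chart set \<Rightarrow> 'm measure \<Rightarrow>
   ('m, 'e::topological_space, 'n::finite) vbundle \<Rightarrow> 'm set \<Rightarrow> ('m \<Rightarrow> 'e) set set" where
  "L2_restrict \<A> \<mu> E S = pointwise_mult E \<mu> (indicator S) ` carrier (L2 \<A> \<mu> E)"

definition unitary_Linf :: "'m measure \<Rightarrow> ('m \<Rightarrow> complex) set" where
  "unitary_Linf \<mu> = {u \<in> borel_measurable \<mu>. AE x in \<mu>. cnj (u x) * u x = 1}"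

definition unitary_Linf_on :: "'m measure \<Rightarrow> 'm set \<Rightarrow> ('m \<Rightarrow> complex) set" where
  "unitary_Linf_on \<mu> T = {u \<in> unitary_Linf \<mu>. AE x in \<mu>. x \<notin> T \<longrightarrow> u x = 1}"

definition hdiff :: "('v, 'x) cinner_space_scheme \<Rightarrow> 'v \<Rightarrow> 'v \<Rightarrow> 'v" where
  "hdiff H f g = hadd H f (hscale H (- 1) g)"

definition hnorm :: "('v, 'x) cinner_space_scheme \<Rightarrow> 'v \<Rightarrow> real" where
  "hnorm H f = sqrt (Re (hinner H f f))"

definition orth_projection :: "('v, 'x) cinner_space_scheme \<Rightarrow> 'v set \<Rightarrow> 'v \<Rightarrow> 'v" where
  "orth_projection H W f = (THE g. g \<in> W \<and> (\<forall>w\<in>W. hinner H w (hdiff H f g) = 0))"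


section \<open>Unital \<open>C\<^sup>*\<close>-algebras and the CAR algebra\<close>

text \<open>The superclass \<open>real_normed_algebra_1\<close> requires \<open>norm 1 = 1\<close>, so the zero algebra is excluded.
  This matters below: the zero algebra would satisfy the canonical anticommutation relations.\<close>

class cstar_algebra = banach + real_normed_algebra_1 +
  fixes scaleC :: "complex \<Rightarrow> 'a \<Rightarrow> 'a" (infixr "*\<^sub>C" 75)
    and star :: "'a \<Rightarrow> 'a"
  assumes scaleC_add_right: "z *\<^sub>C (x + y) = z *\<^sub>C x + z *\<^sub>C y"
    and scaleC_add_left: "(z + w) *\<^sub>C x = z *\<^sub>C x + w *\<^sub>C x"
    and scaleC_scaleC: "z *\<^sub>C (w *\<^sub>C x) = (z * w) *\<^sub>C x"
    and scaleC_of_real: "complex_of_real r *\<^sub>C x = r *\<^sub>R x"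
    and mult_scaleC_left: "(z *\<^sub>C x) * y = z *\<^sub>C (x * y)"
    and mult_scaleC_right: "x * (z *\<^sub>C y) = z *\<^sub>C (x * y)"
    and norm_scaleC: "norm (z *\<^sub>C x) = cmod z * norm x"
    and star_add: "star (x + y) = star x + star y"
    and star_scaleC: "star (z *\<^sub>C x) = cnj z *\<^sub>C star x"
    and star_mult: "star (x * y) = star y * star x"
    and star_star: "star (star x) = x"
    and norm_star_mult: "norm (star x * x) = (norm x)\<^sup>2"

definition unital_cstar_subalgebra :: "'b::cstar_algebra set \<Rightarrow> bool" where
  "unital_cstar_subalgebra B \<longleftrightarrow> closed B \<and> 1 \<in> B \<and>
     (\<forall>x\<in>B. \<forall>y\<in>B. x + y \<in> B \<and> x * y \<in> B) \<and> (\<forall>z. \<forall>x\<in>B. z *\<^sub>C x \<in> B) \<and> (\<forall>x\<in>B. star x \<in> B)"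

definition cstar_generated :: "'b::cstar_algebra set \<Rightarrow> 'b set" where
  "cstar_generated X = \<Inter>{B. unital_cstar_subalgebra B \<and> X \<subseteq> B}"

definition clinear_map :: "('b::cstar_algebra \<Rightarrow> 'c::cstar_algebra) \<Rightarrow> bool" where
  "clinear_map T \<longleftrightarrow> (\<forall>x y. T (x + y) = T x + T y) \<and> (\<forall>z x. T (z *\<^sub>C x) = z *\<^sub>C T x)"

definition star_automorphism :: "('b::cstar_algebra \<Rightarrow> 'b) \<Rightarrow> bool" where
  "star_automorphism \<alpha> \<longleftrightarrow> bij \<alpha> \<and> clinear_map \<alpha> \<and>
     (\<forall>x y. \<alpha> (x * y) = \<alpha> x * \<alpha> y) \<and> (\<forall>x. \<alpha> (star x) = star (\<alpha> x))"

definition positive_element :: "'b::cstar_algebra \<Rightarrow> bool" where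
  "positive_element x \<longleftrightarrow> (\<exists>y. x = star y * y)"

definition conditional_expectation :: "('b::cstar_algebra \<Rightarrow> 'b) \<Rightarrow> bool" where
  "conditional_expectation \<nu> \<longleftrightarrow> clinear_map \<nu> \<and>
     (\<forall>x. positive_element x \<longrightarrow> positive_element (\<nu> x)) \<and> \<nu> 1 = 1 \<and>
     (\<forall>x y. \<nu> (x * \<nu> y) = \<nu> x * \<nu> y \<and> \<nu> (\<nu> x * y) = \<nu> x * \<nu> y)"

text \<open>\<open>is_CAR H a\<close>: the type \<open>'b\<close> together with \<open>a\<close> is (a copy of) the CAR algebra over \<open>H\<close>.\<close>

definition is_CAR :: "('v, 'x) cinner_space_scheme \<Rightarrow> ('v \<Rightarrow> 'b::cstar_algebra) \<Rightarrow> bool" where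
  "is_CAR H a \<longleftrightarrow>
     (\<forall>f\<in>carrier H. \<forall>g\<in>carrier H. a (hadd H f g) = a f + a g) \<and>
     (\<forall>z. \<forall>f\<in>carrier H. a (hscale H z f) = cnj z *\<^sub>C a f) \<and>
     (\<forall>f\<in>carrier H. \<forall>\<epsilon>>0. \<exists>\<delta>>0. \<forall>g\<in>carrier H.
        hnorm H (hdiff H g f) < \<delta> \<longrightarrow> norm (a g - a f) < \<epsilon>) \<and>
     (\<forall>f\<in>carrier H. \<forall>g\<in>carrier H.
        a f * star (a g) + star (a g) * a f = hinner H f g *\<^sub>C 1 \<and> a f * a g + a g * a f = 0) \<and>
     cstar_generated (a ` carrier H) = UNIV"

definition CAR_automorphism ::
  "('v, 'x) cinner_space_scheme \<Rightarrow> ('v \<Rightarrow> 'b::cstar_algebra) \<Rightarrow> ('v \<Rightarrow> 'v) \<Rightarrow> 'b \<Rightarrow> 'b" where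
  "CAR_automorphism H a U =
     (THE \<alpha>. star_automorphism \<alpha> \<and> (\<forall>f\<in>carrier H. \<alpha> (a f) = a (U f)))"

end

theory Submission
  imports Defs "HOL-Computational_Algebra.Polynomial"
begin

text \<open>
  Write \<open>q = 1 - p\<^sub>S\<close>. Tracing out the vacuum state of a single mode \<open>e\<close> in the range of \<open>q\<close> is the
  positive unital map \<open>x \<mapsto> e e\<^sup>* x e e\<^sup>* + e\<^sup>* \<gamma>(x) e\<close> with the parity automorphism \<open>\<gamma>\<close>; if it maps
  \<open>x\<close> to \<open>y\<close>, then it maps \<open>x a(f)\<close> to \<open>y a(f')\<close>, where \<open>f'\<close> is \<open>f\<close> without its \<open>e\<close>-component. Composing over the modes
  of a finite-dimensional subspace and passing to the limit along the net of finite subsets of the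
  range of \<open>q\<close> gives \<open>\<nu>\<^sub>S\<close>, because on normally ordered polynomials the net is eventually constant.

  Automorphisms such as \<open>\<gamma>\<close> and \<open>\<alpha>\<^sub>h\<close> are obtained by the same limit: on finitely many vectors a
  unitary of the one-particle space is a product of complex reflections, each of which is implemented
  by a unitary \<open>e e\<^sup>* + z e\<^sup>* e\<close> of the algebra.

  That the limit is positive rests on the fact that the elements \<open>y\<^sup>* y\<close> form a closed convex cone,
  which is derived from the power series of the square root only.
\<close>

text \<open>\<open>is_CAR\<close> provides the relations and generation, but no universal property
  and no representation. Automorphisms therefore have to be built inside the algebra, and
  \<open>CAR_automorphism\<close>, a definite description, requires existence as well as uniqueness.
  The maps attached to different finite subsets are chosen independently of each other: their values
  on a normally ordered polynomial are forced once the subset contains the finitely many components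
  that have to disappear, and a norm bound common to all positive unital maps extends convergence to
  the whole algebra.

  A separate obstacle is the one-particle space. \<open>L2\<close> is a closure of smooth sections,
  so its invariance under a discontinuous multiplier, such as the indicator of \<open>S\<close> or
  an element of \<open>unitary_Linf\<close>, is not evident. Indicators of Borel sets are reached
  from smooth bump functions by Dynkin's argument, general bounded multipliers by simple functions.
  To do this with ordinary vector valued functions, the bundle is trivialized globally by a Borel
  map, which is isometric on fibres because the transition functions are unitary.\<close>

lemma star_zero [simp]: "star (0::'b::cstar_algebra) = 0"
  using star_add[of "0::'b" 0] by simp

lemma star_minus [simp]: "star (- x :: 'b::cstar_algebra) = - star x"
  using star_add[of x "- x"] by (simp add: eq_neg_iff_add_eq_0 add.commute)

lemma star_diff: "star (x - y :: 'b::cstar_algebra) = star x - star y"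
  using star_add[of x "- y"] by simp

lemma star_one [simp]: "star (1::'b::cstar_algebra) = 1"
  by (metis mult.left_neutral mult.right_neutral star_mult star_star)

lemma star_scaleR: "star (r *\<^sub>R x :: 'b::cstar_algebra) = r *\<^sub>R star x"
  by (metis complex_cnj_complex_of_real scaleC_of_real star_scaleC)

declare star_star [simp]

lemma norm_star [simp]: "norm (star x :: 'b::cstar_algebra) = norm x"
proof -
  have *: "norm y \<le> norm (star y)" for y :: 'b
  proof (cases "y = 0")
    case False
    have "norm y * norm y \<le> norm (star y) * norm y"
      using norm_star_mult[of y] norm_mult_ineq[of "star y" y] by (simp add: power2_eq_square)
    then show ?thesis using False by simp
  qed simp
  show ?thesis using *[of x] *[of "star x"] by simp
qed

lemma bounded_linear_star: "bounded_linear (star :: 'b::cstar_algebra \<Rightarrow> 'b)"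
  by (rule bounded_linear_intro[where K = 1]) (auto simp: star_add star_scaleR)

lemmas tendsto_star [tendsto_intros] = bounded_linear.tendsto[OF bounded_linear_star]

lemma scaleC_zero_left [simp]: "0 *\<^sub>C (x::'b::cstar_algebra) = 0"
  using scaleC_of_real[of 0 x] by simp

lemma scaleC_one [simp]: "1 *\<^sub>C (x::'b::cstar_algebra) = x"
  using scaleC_of_real[of 1 x] by simp

lemma scaleC_zero_right [simp]: "z *\<^sub>C (0::'b::cstar_algebra) = 0"
  using scaleC_add_right[of z "0::'b" 0] by simp

lemma scaleC_minus_left [simp]: "(- z) *\<^sub>C (x::'b::cstar_algebra) = - (z *\<^sub>C x)"
  using scaleC_add_left[of "- z" z x] by (simp add: eq_neg_iff_add_eq_0)

lemma scaleC_minus_right [simp]: "z *\<^sub>C (- x::'b::cstar_algebra) = - (z *\<^sub>C x)"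
  using scaleC_add_right[of z "- x" x] by (simp add: eq_neg_iff_add_eq_0)

lemma scaleC_diff_right: "z *\<^sub>C (x - y::'b::cstar_algebra) = z *\<^sub>C x - z *\<^sub>C y"
  using scaleC_add_right[of z x "- y"] by simp

lemma scaleC_diff_left: "(z - w) *\<^sub>C (x::'b::cstar_algebra) = z *\<^sub>C x - w *\<^sub>C x"
  using scaleC_add_left[of z "- w" x] by simp

lemma scaleR_scaleC: "r *\<^sub>R (z *\<^sub>C (x::'b::cstar_algebra)) = z *\<^sub>C (r *\<^sub>R x)"
  by (metis mult.commute scaleC_of_real scaleC_scaleC)

lemma bounded_linear_scaleC: "bounded_linear ((*\<^sub>C) z :: 'b::cstar_algebra \<Rightarrow> 'b)"
  by (rule bounded_linear_intro[where K = "cmod z"])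
     (auto simp: scaleC_add_right scaleR_scaleC norm_scaleC)

lemmas tendsto_scaleC [tendsto_intros] = bounded_linear.tendsto[OF bounded_linear_scaleC]

lemma scaleC_one_eq_iff: "z *\<^sub>C (1::'b::cstar_algebra) = w *\<^sub>C 1 \<longleftrightarrow> z = w"
proof
  assume "z *\<^sub>C (1::'b) = w *\<^sub>C 1"
  then have "norm ((z - w) *\<^sub>C (1::'b)) = 0" by (simp add: scaleC_diff_left)
  then show "z = w" by (simp add: norm_scaleC)
qed simp

section \<open>Square roots and positive elements\<close>

text \<open>Taylor coefficients of \<open>sqrt (1 - x)\<close> at 0.\<close>

definition sqrt_coeff :: "nat \<Rightarrow> real" where
  "sqrt_coeff n = (- 1) ^ n * ((1/2) gchoose n)"

text \<open>The ratio of successive coefficients is \<open>(k - 1/2) / (k + 1)\<close> with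
  \<open>k = Suc n\<close>, hence nonnegative, so the sign of the coefficient \<open>- 1/2\<close>
  at index 1 persists.\<close>

lemma sqrt_coeff_nonpos: "sqrt_coeff (Suc n) \<le> 0"
proof (induction n)
  case 0
  show ?case by (simp add: sqrt_coeff_def)
next
  case (Suc n)
  have "((1/2::real) gchoose Suc (Suc n)) =
      ((1/2) gchoose Suc n) * ((1/2) - real (Suc n)) / real (Suc (Suc n))"
    using gbinomial_factors[of "-1/2::real" "Suc n"] gbinomial_mult_1[of "1/2::real" "Suc n"]
    by (simp add: field_simps)
  moreover have "(- 1) ^ Suc (Suc n) * (c * (1/2 - k) / m) = (- 1) ^ Suc n * c * ((k - 1/2) / m)"
    for c k m :: real by (simp add: algebra_simps diff_divide_distrib)
  ultimately have "sqrt_coeff (Suc (Suc n)) =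
      sqrt_coeff (Suc n) * ((real (Suc n) - 1/2) / real (Suc (Suc n)))"
    unfolding sqrt_coeff_def by presburger
  then show ?case using Suc by (simp only:) (intro mult_nonpos_nonneg, auto)
qed

text \<open>All coefficients after the constant one have the same sign, so the sums of their
  absolute values are 1 minus the partial sums of the series at \<open>x = 1\<close>, and these
  equal \<open>pochhammer (1/2) n / fact n\<close>. Absolute convergence on the boundary allows
  \<open>norm z = 1\<close> in the square root series.\<close>

lemma summable_sqrt_coeff: "summable (\<lambda>n. \<bar>sqrt_coeff n\<bar>)"
  and suminf_sqrt_coeff: "(\<Sum>n. \<bar>sqrt_coeff (Suc n)\<bar>) \<le> 1"
proof -
  have part: "(\<Sum>k\<le>n. sqrt_coeff k) = (- 1) ^ n * ((- 1/2) gchoose n)" for n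
    using gbinomial_sum_lower_neg[of "1/2::real" n]
    unfolding sqrt_coeff_def by (simp add: mult.commute)
  have nonneg: "(- 1) ^ n * ((- 1/2 :: real) gchoose n) \<ge> 0" for n
  proof -
    have "(- 1) ^ n * ((- 1/2 :: real) gchoose n) = pochhammer (1/2) n / fact n"
      by (simp add: gbinomial_pochhammer flip: power_mult_distrib mult.assoc)
    then show ?thesis by (simp add: pochhammer_nonneg)
  qed
  have eq: "(\<Sum>k\<le>n. \<bar>sqrt_coeff (Suc k)\<bar>) = 1 - (\<Sum>k\<le>Suc n. sqrt_coeff k)" for n
  proof -
    have "(\<Sum>k\<le>Suc n. sqrt_coeff k) = sqrt_coeff 0 + (\<Sum>k\<le>n. sqrt_coeff (Suc k))"
      by (rule sum.atMost_Suc_shift)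
    then show ?thesis
      using sqrt_coeff_nonpos by (simp add: sqrt_coeff_def[of 0] sum_negf abs_of_nonpos)
  qed
  have le: "(\<Sum>k\<le>n. \<bar>sqrt_coeff (Suc k)\<bar>) \<le> 1" for n
    unfolding eq part using nonneg[of "Suc n"] by simp
  then have sm: "summable (\<lambda>n. \<bar>sqrt_coeff (Suc n)\<bar>)"
    by (intro bounded_imp_summable[where B = 1]) auto
  then show "summable (\<lambda>n. \<bar>sqrt_coeff n\<bar>)" by (subst (asm) summable_Suc_iff)
  show "(\<Sum>n. \<bar>sqrt_coeff (Suc n)\<bar>) \<le> 1"
    using le by (intro suminf_le_const[OF sm]) (metis lessThan_Suc_atMost sum_nonneg abs_ge_zero le_SucI
       not0_implies_Suc lessThan_0 sum.empty zero_le_one)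
qed

text \<open>Vandermonde's identity collapses the Cauchy square to \<open>(- 1) ^ n\<close> times
  \<open>1 choose n\<close>, the coefficients of \<open>1 - x\<close>.\<close>

lemma sqrt_coeff_conv:
  "(\<Sum>i\<le>n. sqrt_coeff i * sqrt_coeff (n - i)) = (if n = 0 then 1 else if n = 1 then - 1 else 0)"
proof -
  have "(\<Sum>i\<le>n. sqrt_coeff i * sqrt_coeff (n - i)) =
     (\<Sum>i\<le>n. (- 1) ^ n * (((1/2) gchoose i) * ((1/2) gchoose (n - i))))"
    by (rule sum.cong) (auto simp: sqrt_coeff_def power_add[symmetric] algebra_simps)
  also have "\<dots> = (- 1) ^ n * ((1::real) gchoose n)"
    using gbinomial_Vandermonde[of "1/2::real" "1/2" n]
    by (simp add: sum_distrib_left[symmetric] atMost_atLeast0)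
  also have "(1::real) gchoose n = of_nat (1 choose n)"
    using binomial_gbinomial[of 1 n, where 'a = real] by simp
  finally show ?thesis by (auto simp: binomial_eq_0)
qed

text \<open>This series replaces the functional calculus. The bound on \<open>1 - r\<close> is the
  bound on the coefficient sum, and the commutation clause, inherited from the powers of
  \<open>z\<close>, makes roots of commuting elements commute.\<close>

lemma sqrt_exists:
  fixes z :: "'b::cstar_algebra"
  assumes "norm z \<le> 1"
  obtains r where "r * r = 1 - z" "norm (1 - r) \<le> 1" "star z = z \<Longrightarrow> star r = r"
    "\<And>x. x * z = z * x \<Longrightarrow> x * r = r * x"
proof -
  define t where "t = (\<lambda>n. sqrt_coeff n *\<^sub>R z ^ n)"
  have nt: "norm (t n) \<le> \<bar>sqrt_coeff n\<bar>" for n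
  proof -
    have "norm (z ^ n) \<le> 1"
      using norm_power_ineq[of z n] assms power_le_one[of "norm z" n] by simp
    then show ?thesis unfolding t_def by (simp add: mult_left_le)
  qed
  have sn: "summable (\<lambda>n. norm (t n))"
  proof (rule summable_comparison_test'[OF summable_sqrt_coeff, of 0])
    show "norm (norm (t n)) \<le> \<bar>sqrt_coeff n\<bar>" for n using nt by simp
  qed
  define r where "r = (\<Sum>n. t n)"
  have s: "t sums r"
    unfolding r_def using sn summable_norm_cancel summable_sums by blast
  have "(\<lambda>k. \<Sum>i\<le>k. t i * t (k - i)) sums (r * r)"
    unfolding r_def by (rule Cauchy_product_sums[OF sn sn])
  moreover have "(\<Sum>i\<le>k. t i * t (k - i)) = (if k = 0 then 1 else if k = 1 then - z else 0)" for k
  proof -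
    have "(\<Sum>i\<le>k. t i * t (k - i)) = (\<Sum>i\<le>k. (sqrt_coeff i * sqrt_coeff (k - i)) *\<^sub>R z ^ k)"
      by (rule sum.cong) (auto simp: t_def power_add[symmetric])
    also have "\<dots> = (\<Sum>i\<le>k. sqrt_coeff i * sqrt_coeff (k - i)) *\<^sub>R z ^ k"
      by (simp add: scaleR_sum_left)
    finally show ?thesis unfolding sqrt_coeff_conv by auto
  qed
  ultimately have A: "(\<lambda>k. if k = 0 then 1 else if k = 1 then - z else 0) sums (r * r)" by simp
  have "(\<lambda>k. if k = 0 then 1 else if k = 1 then - z else 0) sums
      (\<Sum>k\<in>{0, 1::nat}. if k = 0 then 1 else if k = 1 then - z else 0)"
    by (rule sums_finite) auto
  with A have "r * r = 1 - z" using sums_unique2 by fastforce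
  moreover have "norm (1 - r) \<le> 1"
  proof -
    have "r = t 0 + (\<Sum>n. t (Suc n))"
      unfolding r_def using suminf_split_head[of t] summable_norm_cancel[OF sn] by simp
    moreover have "t 0 = 1" by (simp add: t_def sqrt_coeff_def)
    ultimately have "norm (1 - r) = norm (\<Sum>n. t (Suc n))" by simp
    also have "\<dots> \<le> (\<Sum>n. \<bar>sqrt_coeff (Suc n)\<bar>)"
      using summable_sqrt_coeff nt by (intro norm_suminf_le) (auto simp: summable_Suc_iff[of "\<lambda>n. \<bar>sqrt_coeff n\<bar>"])
    also have "\<dots> \<le> 1" by (rule suminf_sqrt_coeff)
    finally show ?thesis .
  qed
  moreover have "star r = r" if "star z = z"
  proof -
    have "star (z ^ n) = z ^ n" for n
      by (induction n) (simp_all add: star_mult that power_commutes)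
    then have "star (t n) = t n" for n by (simp add: t_def star_scaleR)
    then have "t sums star r" using bounded_linear.sums[OF bounded_linear_star s] by simp
    with s show ?thesis using sums_unique2 by metis
  qed
  moreover have "x * r = r * x" if "x * z = z * x" for x
  proof -
    have "x * z ^ n = z ^ n * x" for n
      by (induction n) (simp_all, metis mult.assoc that)
    then have "x * t n = t n * x" for n by (simp add: t_def)
    then have "(\<lambda>n. x * t n) sums (r * x)" using sums_mult2[OF s, of x] by simp
    moreover have "(\<lambda>n. x * t n) sums (x * r)" by (rule sums_mult[OF s])
    ultimately show ?thesis using sums_unique2 by metis
  qed
  ultimately show ?thesis using that by blast
qed

text \<open>A provisional notion of positivity with a self-adjoint root. That it agrees with
  \<open>positive_element\<close> is \<open>positive_element_iff_pos\<close>, which already rests on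
  the properties of the cone.\<close>

definition pos :: "'b::cstar_algebra \<Rightarrow> bool" where
  "pos y \<longleftrightarrow> (\<exists>r. star r = r \<and> y = r * r)"

section \<open>The positive cone, described by a norm inequality\<close>

lemma pos_selfadjoint: "pos y \<Longrightarrow> star y = y"
  by (auto simp: pos_def star_mult)

lemma norm_selfadjoint_square: "star r = r \<Longrightarrow> norm (r * r :: 'b::cstar_algebra) = (norm r)\<^sup>2"
  using norm_star_mult[of r] by simp

lemma selfadjoint_square_zero: "star r = r \<Longrightarrow> r * r = 0 \<Longrightarrow> (r :: 'b::cstar_algebra) = 0"
  using norm_selfadjoint_square[of r] by simp

lemma norm_unitary: "star u * u = 1 \<Longrightarrow> norm (u :: 'b::cstar_algebra) = 1"
  using norm_star_mult[of u] by (simp add: power2_eq_1_iff) (smt (verit) norm_ge_zero)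

text \<open>For self-adjoint \<open>y\<close> the inequality says that the spectrum lies in
  \<open>[0, 2 t]\<close>. Division by \<open>t\<close> reduces to \<open>sqrt_exists\<close>; the
  root satisfies an inequality of the same shape with \<open>s = sqrt t\<close>, so that it is
  \<open>pos\<close> itself by \<open>posI\<close>.\<close>

lemma sqrt_exists_scaled:
  fixes y :: "'b::cstar_algebra"
  assumes "norm (t *\<^sub>R 1 - y) \<le> t" "star y = y"
  obtains r s where "r * r = y" "star r = r" "norm (s *\<^sub>R 1 - r) \<le> s"
    "\<And>x. x * y = y * x \<Longrightarrow> x * r = r * x"
proof (cases "t = 0")
  case True
  then have "y = 0" using assms by simp
  then show ?thesis using that[of 0 0] by simp
next
  case False
  then have t: "t > 0" using assms norm_ge_zero[of "t *\<^sub>R 1 - y"] by linarith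
  define z where "z = (1/t) *\<^sub>R (t *\<^sub>R 1 - y)"
  have "norm z \<le> 1" using assms t by (simp add: z_def)
  moreover have sz: "star z = z" by (simp add: z_def star_scaleR star_diff assms)
  ultimately obtain r where r: "r * r = 1 - z" "star r = r"
    "\<And>x. x * z = z * x \<Longrightarrow> x * r = r * x" and nr: "norm (1 - r) \<le> 1" using sqrt_exists by metis
  have y: "y = t *\<^sub>R (1 - z)" using t by (simp add: z_def algebra_simps)
  show ?thesis
  proof (rule that[of "sqrt t *\<^sub>R r" "sqrt t"])
    have "norm (sqrt t *\<^sub>R (1 - r)) \<le> sqrt t" using nr t by (simp add: mult_left_le)
    then show "norm (sqrt t *\<^sub>R 1 - sqrt t *\<^sub>R r) \<le> sqrt t" by (simp add: scaleR_diff_right)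
    show "sqrt t *\<^sub>R r * sqrt t *\<^sub>R r = y" using r(1) t y by simp
    show "star (sqrt t *\<^sub>R r) = sqrt t *\<^sub>R r" by (simp add: star_scaleR r(2))
    fix x assume "x * y = y * x"
    then have "x * z = z * x" unfolding z_def by (simp add: algebra_simps)
    then have "x * r = r * x" by (rule r(3))
    then show "x * sqrt t *\<^sub>R r = sqrt t *\<^sub>R r * x" by simp
  qed
qed

text \<open>Two commuting self-adjoint elements become the real and imaginary part of one element,
  whose norm the C*-identity then computes. This device stands in for spectral theory in several
  places below.\<close>

lemma star_mult_Re_Im:
  fixes y :: "'b::cstar_algebra"
  assumes "star y = y" "star q = q" "y * q = q * y"
  shows "star (y + \<i> *\<^sub>C q) = y - \<i> *\<^sub>C q"
    and "star (y + \<i> *\<^sub>C q) * (y + \<i> *\<^sub>C q) = y * y + q * q"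
proof -
  show *: "star (y + \<i> *\<^sub>C q) = y - \<i> *\<^sub>C q" by (simp add: star_add star_scaleC assms)
  show "star (y + \<i> *\<^sub>C q) * (y + \<i> *\<^sub>C q) = y * y + q * q"
    unfolding * by (simp add: algebra_simps mult_scaleC_left mult_scaleC_right scaleC_scaleC
      scaleC_add_right scaleC_diff_right assms)
qed

text \<open>Trigonometry in the algebra: with \<open>s\<close> a root of \<open>1 - b * b\<close>
  the element \<open>u = b + i s\<close> is unitary and \<open>b\<close> is its cosine. In
  \<open>sin^2 t = (1 - cos 2t) / 2\<close> the term \<open>2 cos 2t\<close> is
  \<open>u * u + star u * star u\<close>, of norm at most 2.\<close>

lemma norm_one_minus_square:
  fixes b :: "'b::cstar_algebra"
  assumes sb: "star b = b" and "norm b \<le> 1"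
  shows "norm (1 - b * b) \<le> 1"
proof -
  have "norm (b * b) \<le> 1"
    using assms by (simp add: norm_selfadjoint_square power_le_one)
  moreover have "star (b * b) = b * b" by (simp add: star_mult sb)
  ultimately obtain s where s: "s * s = 1 - b * b" "star s = s" "b * s = s * b"
    using sqrt_exists[of "b * b"] by (metis mult.assoc)
  define u where "u = b + \<i> *\<^sub>C s"
  have su: "star u = b - \<i> *\<^sub>C s" unfolding u_def by (rule star_mult_Re_Im[OF sb s(2,3)])
  have "star u * u = 1" unfolding u_def star_mult_Re_Im(2)[OF sb s(2,3)] by (simp add: s)
  then have nu: "norm u = 1" using norm_unitary by blast
  have "u * u + star u * star u = 2 *\<^sub>R (b * b) - 2 *\<^sub>R (s * s)"
    unfolding su unfolding u_def
    by (simp add: algebra_simps mult_scaleC_left mult_scaleC_right scaleC_scaleC scaleR_2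
        scaleC_add_right scaleC_diff_right)
  also have "\<dots> = 2 *\<^sub>R 1 - 4 *\<^sub>R (1 - b * b)"
  proof -
    have "2 *\<^sub>R x - 2 *\<^sub>R (1 - x) = 2 *\<^sub>R 1 - 4 *\<^sub>R (1 - x)" for x :: 'b
      using scaleR_add_left[of 2 2 x] scaleR_add_left[of 2 2 "1::'b"] by (simp add: scaleR_diff_right)
    then show ?thesis by (simp add: s)
  qed
  finally have "4 *\<^sub>R (1 - b * b) = 2 *\<^sub>R 1 - (u * u + star u * star u)" by simp
  then have "norm (4 *\<^sub>R (1 - b * b)) = norm (2 *\<^sub>R 1 - (u * u + star u * star u))" by (rule arg_cong)
  then have "4 * norm (1 - b * b) = norm (2 *\<^sub>R 1 - (u * u + star u * star u))"
    unfolding norm_scaleR by simp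
  moreover have "norm (u * u) \<le> 1" "norm (star u * star u) \<le> 1"
    using norm_mult_ineq[of u u] norm_mult_ineq[of "star u" "star u"] nu by auto
  moreover have "norm (2 *\<^sub>R 1 - (x + y)) \<le> 2 + (norm x + norm y)" for x y :: 'b
    using norm_triangle_ineq4[of "2 *\<^sub>R 1" "x + y"] norm_triangle_ineq[of x y] by simp
  ultimately show ?thesis by (smt (verit))
qed

text \<open>A rescaled \<open>norm_one_minus_square\<close>. Together with \<open>posI\<close> it
  characterizes the cone by a norm inequality, from which convexity and closedness follow.\<close>

lemma pos_norm_bound:
  fixes y :: "'b::cstar_algebra"
  assumes "pos y" "norm y \<le> t"
  shows "norm (t *\<^sub>R 1 - y) \<le> t"
proof (cases "t = 0")
  case True
  then show ?thesis using assms by simp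
next
  case False
  then have t: "t > 0" using assms norm_ge_zero[of y] by linarith
  obtain r where r: "star r = r" "y = r * r" using assms by (auto simp: pos_def)
  define b where "b = (1 / sqrt t) *\<^sub>R r"
  have "(norm r)\<^sup>2 \<le> t" using assms r norm_selfadjoint_square by metis
  then have "norm b \<le> 1" using t by (simp add: b_def real_le_rsqrt)
  then have "norm (1 - b * b) \<le> 1" by (intro norm_one_minus_square) (simp_all add: b_def star_scaleR r)
  moreover have "t *\<^sub>R 1 - y = t *\<^sub>R (1 - b * b)"
    using t by (simp add: b_def r algebra_simps)
  ultimately show ?thesis using t by (simp add: mult_left_le)
qed

lemma posI: "norm (t *\<^sub>R 1 - y) \<le> t \<Longrightarrow> star y = y \<Longrightarrow> pos (y::'b::cstar_algebra)"
  using sqrt_exists_scaled[of t y] unfolding pos_def by metis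

lemma pos_sqrt:
  fixes y :: "'b::cstar_algebra"
  assumes "pos y"
  obtains r where "r * r = y" "star r = r" "pos r" "\<And>x. x * y = y * x \<Longrightarrow> x * r = r * x"
  using sqrt_exists_scaled[OF pos_norm_bound[OF assms order_refl] pos_selfadjoint[OF assms]] posI
  by metis

text \<open>The norm inequalities with parameters \<open>norm x\<close> and \<open>norm y\<close>
  add up.\<close>

lemma pos_add:
  fixes x y :: "'b::cstar_algebra"
  assumes "pos x" "pos y"
  shows "pos (x + y)"
proof (rule posI[of "norm x + norm y"])
  have "(norm x + norm y) *\<^sub>R 1 - (x + y) = (norm x *\<^sub>R 1 - x) + (norm y *\<^sub>R 1 - y)"
    by (simp add: algebra_simps)
  then show "norm ((norm x + norm y) *\<^sub>R 1 - (x + y)) \<le> norm x + norm y"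
    using norm_triangle_mono[OF pos_norm_bound[OF assms(1) order_refl] pos_norm_bound[OF assms(2) order_refl]]
    by metis
qed (simp add: star_add pos_selfadjoint assms)

lemma pos_square: "star r = r \<Longrightarrow> pos (r * r)"
  by (auto simp: pos_def)

lemma pos_scaleR:
  assumes "pos x" "0 \<le> t"
  shows "pos (t *\<^sub>R x)"
proof -
  obtain r where "star r = r" "x = r * r" using assms by (auto simp: pos_def)
  then have "star (sqrt t *\<^sub>R r) = sqrt t *\<^sub>R r" "t *\<^sub>R x = sqrt t *\<^sub>R r * sqrt t *\<^sub>R r"
    using assms by (simp_all add: star_scaleR)
  then show ?thesis unfolding pos_def by blast
qed

text \<open>The two roots commute by repeated use of the commutation clause of
  \<open>pos_sqrt\<close>, so the product is the square of \<open>r * s\<close>.\<close>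

lemma pos_mult_commute:
  fixes x y :: "'b::cstar_algebra"
  assumes "pos x" "pos y" "x * y = y * x"
  shows "pos (x * y)"
proof -
  obtain r where r: "r * r = x" "star r = r" "\<And>z. z * x = x * z \<Longrightarrow> z * r = r * z"
    using pos_sqrt[OF assms(1)] by metis
  obtain s where s: "s * s = y" "star s = s" "\<And>z. z * y = y * z \<Longrightarrow> z * s = s * z"
    using pos_sqrt[OF assms(2)] by metis
  have "y * r = r * y" using r(3) assms by metis
  then have rs: "r * s = s * r" using s(3) by metis
  have "x * y = (r * s) * (r * s)" unfolding r(1)[symmetric] s(1)[symmetric]
    by (metis rs mult.assoc)
  then show ?thesis using rs by (metis pos_square r(2) s(2) star_mult)
qed

text \<open>The commuting elements \<open>y\<close> and \<open>- y\<close> have a positive product,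
  so \<open>- (y * y)\<close> has a self-adjoint root \<open>q\<close>. Then
  \<open>u = y + i q\<close> satisfies \<open>star u * u = 0\<close>, and
  \<open>u = 0 = star u\<close> forces \<open>y = - y\<close>.\<close>

lemma pos_antisym:
  fixes y :: "'b::cstar_algebra"
  assumes "pos y" "pos (- y)"
  shows "y = 0"
proof -
  have "pos (- (y * y))" using pos_mult_commute[OF assms] by simp
  then obtain q where q: "q * q = - (y * y)" "star q = q"
      "\<And>x. x * - (y * y) = - (y * y) * x \<Longrightarrow> x * q = q * x"
    using pos_sqrt by metis
  have yq: "y * q = q * y" by (rule q(3)) (simp add: mult.assoc)
  have sy: "star y = y" using assms pos_selfadjoint by blast
  define u where "u = y + \<i> *\<^sub>C q"
  have su: "star u = y - \<i> *\<^sub>C q" unfolding u_def by (rule star_mult_Re_Im[OF sy q(2) yq])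
  have "star u * u = 0" unfolding u_def star_mult_Re_Im(2)[OF sy q(2) yq] by (simp add: q(1))
  then have "norm u = 0" using norm_star_mult[of u] by simp
  then have "u = 0" "star u = 0" by auto
  then have "y = - (\<i> *\<^sub>C q)" "y = \<i> *\<^sub>C q"
    using su u_def by (simp_all add: eq_neg_iff_add_eq_0)
  then have "y = - y" by simp
  then show ?thesis by (metis equation_minus_iff neg_equal_zero scaleR_half_double add.right_inverse scaleR_zero_right)
qed

text \<open>It is half of \<open>p * p + q * q\<close>, where \<open>p\<close> and \<open>q\<close>
  are twice the real and imaginary part of \<open>c\<close>.\<close>

lemma commutator_sum_pos: "pos (star c * c + c * star (c::'b::cstar_algebra))"
proof -
  define p where "p = c + star c"
  define q where "q = \<i> *\<^sub>C (star c - c)"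
  have s: "star p = p" "star q = q"
    unfolding p_def q_def
    by (simp_all add: star_add star_scaleC star_diff add.commute scaleC_diff_right)
  have qq: "q * q = - ((star c - c) * (star c - c))"
    unfolding q_def by (simp only: mult_scaleC_left mult_scaleC_right scaleC_scaleC) simp
  have "p * p + q * q = (star c * c + c * star c) + (star c * c + c * star c)"
    unfolding qq p_def by (simp add: algebra_simps)
  then have "star c * c + c * star c = (1/2) *\<^sub>R (p * p + q * q)"
    by (simp only: scaleR_half_double)
  then show ?thesis by (simp only: pos_add pos_scaleR pos_square s)
qed

text \<open>The usual argument compares the spectra of \<open>star c * c\<close> and
  \<open>c * star c\<close>. Here, with a root \<open>s\<close> of \<open>- (star c * c)\<close>,
  both \<open>star d * d\<close> and \<open>d * star d\<close> for \<open>d = s * star c\<close> are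
  negatives of squares, whereas their sum is positive by \<open>commutator_sum_pos\<close>;
  antisymmetry of the cone kills both squares.\<close>

lemma star_mult_neg_imp_zero:
  fixes c :: "'b::cstar_algebra"
  assumes "pos (- (star c * c))"
  shows "c = 0"
proof -
  obtain s where s: "s * s = - (star c * c)" "star s = s"
    using pos_sqrt[OF assms] by metis
  define d where "d = star (c * s)"
  have 1: "star d * d = - ((c * star c) * (c * star c))"
  proof -
    have "star d * d = c * (s * s) * star c" unfolding d_def by (simp add: star_mult s(2) mult.assoc)
    then show ?thesis by (simp only: s(1)) (simp add: mult.assoc)
  qed
  have 2: "d * star d = - ((s * s) * (s * s))"
  proof -
    have "d * star d = s * (star c * c) * s" by (simp add: d_def star_mult s mult.assoc)
    also have "star c * c = - (s * s)" unfolding s by simp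
    finally show ?thesis by (simp add: mult.assoc)
  qed
  have sc: "star (c * star c) = c * star c" and ss: "star (s * s) = s * s"
    by (simp_all add: star_mult s)
  have "pos ((c * star c) * (c * star c) + (s * s) * (s * s))"
    by (intro pos_add pos_square sc ss)
  moreover have "pos (- ((c * star c) * (c * star c) + (s * s) * (s * s)))"
    using commutator_sum_pos[of d] 1 2 by simp
  ultimately have "(c * star c) * (c * star c) + (s * s) * (s * s) = 0"
    by (rule pos_antisym)
  then have "(c * star c) * (c * star c) = - ((s * s) * (s * s))"
    by (simp add: eq_neg_iff_add_eq_0)
  then have "(s * s) * (s * s) = 0"
    using pos_antisym[OF pos_square[OF ss]] pos_square[OF sc] by metis
  then have "s * s = 0" using selfadjoint_square_zero[OF ss] by simp
  then have "norm (star c * c) = 0" using s by simp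
  then show ?thesis using norm_star_mult[of c] by simp
qed

text \<open>With \<open>e = |b|\<close> and \<open>w\<close> a multiple of the negative part of \<open>b = x\<^sup>* x\<close>, the element \<open>c = x w\<close>
  has \<open>c\<^sup>* c \<le> 0\<close>, hence vanishes, and so does \<open>w\<close>.\<close>

lemma star_mult_pos: "pos (star x * (x::'b::cstar_algebra))"
proof -
  define b where "b = star x * x"
  have sb: "star b = b" by (simp add: b_def star_mult)
  obtain e where e: "e * e = b * b" "star e = e" "pos e" "b * e = e * b"
    using pos_sqrt[OF pos_square[OF sb]] by (metis mult.assoc)
  obtain r where r: "r * r = e" "star r = r" "b * r = r * b" "e * r = r * e"
    using pos_sqrt[OF e(3)] e(4) by metis
  \<comment> \<open>The factor makes \<open>w * w = e * (e - b)\<close>, since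
    \<open>(e - b) * (e - b)\<close> is twice that.\<close>
  define w where "w = (1 / sqrt 2) *\<^sub>R (e - b)"
  have sw: "star w = w" by (simp add: w_def star_scaleR star_diff e sb)
  have wr: "w * r = r * w" by (simp add: w_def algebra_simps r)
  have bw: "b * w = w * b" by (simp add: w_def algebra_simps e)
  have eb: "(e - b) * e = e * (e - b)" by (simp add: algebra_simps e(4))
  have "(e - b) * (e - b) = e * (e - b) + e * (e - b)"
    by (simp add: algebra_simps e)
  then have ww: "w * w = e * (e - b)" by (simp add: w_def)
  have "star (x * w) * (x * w) = w * b * w" by (simp add: star_mult sw b_def mult.assoc)
  also have "\<dots> = b * (w * w)" by (metis bw mult.assoc)
  also have "\<dots> = (b * e) * (e - b)" unfolding ww by (simp add: mult.assoc)
  \<comment> \<open>\<open>b * (e - b) = - (e * (e - b))\<close>, because \<open>e\<close> commutes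
    with \<open>b\<close> and has the same square.\<close>
  also have "\<dots> = - (e * (e * (e - b)))"
    by (simp add: algebra_simps e)
  also have "\<dots> = - ((r * r) * (w * w))" unfolding ww r ..
  also have "\<dots> = - ((r * w) * (r * w))" by (metis wr mult.assoc)
  finally have eq: "star (x * w) * (x * w) = - ((r * w) * (r * w))" .
  have srw: "star (r * w) = r * w" by (simp add: star_mult sw r wr)
  have "x * w = 0"
    by (rule star_mult_neg_imp_zero) (simp add: eq pos_square srw)
  then have "(r * w) * (r * w) = 0" using eq by simp
  then have "r * w = 0" by (rule selfadjoint_square_zero[OF srw])
  then have "r * (r * w) * w = 0" by simp
  then have 0: "e * (w * w) = 0" by (simp flip: r(1) add: mult.assoc)
  have sww: "star (w * w) = w * w" by (simp add: star_mult sw)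
  have "(w * w) * (w * w) = (e - b) * (e * (w * w))"
    unfolding ww by (metis eb mult.assoc)
  then have "w * w = 0" using selfadjoint_square_zero[OF sww] 0 by simp
  then have "w = 0" using selfadjoint_square_zero[OF sw] by simp
  then have "e = b" by (simp add: w_def)
  then show ?thesis using e by (simp add: b_def)
qed

lemma positive_element_iff_pos: "positive_element x \<longleftrightarrow> pos (x::'b::cstar_algebra)"
  unfolding positive_element_def using star_mult_pos pos_def by metis

lemma pos_one [simp]: "pos 1"
  using pos_square[of 1] by simp

lemma pos_conj:
  fixes x :: "'b::cstar_algebra"
  assumes "pos y" shows "pos (star x * y * x)"
proof -
  obtain r where "star r = r" "y = r * r" using assms by (auto simp: pos_def)
  then have "star x * y * x = star (r * x) * (r * x)" by (simp add: star_mult mult.assoc)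
  then show ?thesis by (simp add: star_mult_pos)
qed

lemma pos_shift:
  fixes y :: "'b::cstar_algebra"
  assumes "star y = y"
  shows "pos (norm y *\<^sub>R 1 - y)" "pos (norm y *\<^sub>R 1 + y)"
  by (rule posI[of "norm y"]; simp add: star_diff star_add star_scaleR assms)+

text \<open>\<open>t^2 - y * y\<close> is positive as a product of commuting positive elements. With
  its root \<open>m\<close> the element \<open>u = y + i m\<close> satisfies
  \<open>star u * u = t^2\<close>, and \<open>y\<close> is the average of \<open>u\<close> and
  \<open>star u\<close>.\<close>

lemma norm_le_if_pos_shift:
  fixes y :: "'b::cstar_algebra"
  assumes "pos (t *\<^sub>R 1 - y)" "pos (t *\<^sub>R 1 + y)" "0 \<le> t"
  shows "norm y \<le> t"
proof -
  have "star ((t *\<^sub>R 1 + y) - (t *\<^sub>R 1 - y)) = (t *\<^sub>R 1 + y) - (t *\<^sub>R 1 - y)"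
    using assms(1,2)[THEN pos_selfadjoint] by (simp only: star_diff)
  then have "star (y + y) = y + y" by simp
  then have "(1/2) *\<^sub>R (star y + star y) = (1/2) *\<^sub>R (y + y)" by (simp add: star_add)
  then have sy: "star y = y" by (simp only: scaleR_half_double)
  have "(t *\<^sub>R 1 - y) * (t *\<^sub>R 1 + y) = t\<^sup>2 *\<^sub>R 1 - y * y"
    by (simp add: distrib_left left_diff_distrib power2_eq_square scaleR_diff_right)
  moreover have "(t *\<^sub>R 1 - y) * (t *\<^sub>R 1 + y) = (t *\<^sub>R 1 + y) * (t *\<^sub>R 1 - y)"
    by (simp add: distrib_left left_diff_distrib distrib_right right_diff_distrib scaleR_diff_right scaleR_add_right)
  ultimately have "pos (t\<^sup>2 *\<^sub>R 1 - y * y)" using pos_mult_commute[OF assms(1,2)] by metis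
  then obtain m where m: "m * m = t\<^sup>2 *\<^sub>R 1 - y * y" "star m = m"
    "\<And>x. x * (t\<^sup>2 *\<^sub>R 1 - y * y) = (t\<^sup>2 *\<^sub>R 1 - y * y) * x \<Longrightarrow> x * m = m * x"
    using pos_sqrt by metis
  have ym: "y * m = m * y" by (rule m(3)) (simp add: algebra_simps)
  define u where "u = y + \<i> *\<^sub>C m"
  have su: "star u = y - \<i> *\<^sub>C m" unfolding u_def by (rule star_mult_Re_Im[OF sy m(2) ym])
  have "star u * u = t\<^sup>2 *\<^sub>R 1" unfolding u_def star_mult_Re_Im(2)[OF sy m(2) ym] by (simp add: m(1))
  then have "(norm u)\<^sup>2 = t\<^sup>2" using norm_star_mult[of u] by simp
  then have nu: "norm u = t" using assms(3) by simp
  have "u + star u = y + y" unfolding su by (simp add: u_def)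
  then have "y = (1/2) *\<^sub>R (u + star u)" by (simp only: scaleR_half_double)
  then have "norm y = norm ((1/2) *\<^sub>R (u + star u))" by simp
  then have "norm y = norm (u + star u) / 2" by simp
  also have "\<dots> \<le> t" using norm_triangle_ineq[of u "star u"] nu by simp
  finally show ?thesis .
qed

text \<open>With \<open>t = norm y\<close>, the criteria \<open>pos_norm_bound\<close> and
  \<open>posI\<close> turn positivity into an equation and an inequality between continuous
  functions of \<open>y\<close>.\<close>

lemma closed_pos: "closed {y::'b::cstar_algebra. pos y}"
proof -
  have "{y::'b. pos y} = {y. star y = y \<and> norm (norm y *\<^sub>R 1 - y) \<le> norm y}"
    using pos_norm_bound posI pos_selfadjoint by blast
  moreover have "closed {y::'b. star y = y \<and> norm (norm y *\<^sub>R 1 - y) \<le> norm y}"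
    by (intro closed_Collect_conj closed_Collect_eq closed_Collect_le continuous_intros
        linear_continuous_on bounded_linear_star)
  ultimately show ?thesis by simp
qed

section \<open>Positive unital maps\<close>

definition positive_unital :: "('b::cstar_algebra \<Rightarrow> 'c::cstar_algebra) \<Rightarrow> bool" where
  "positive_unital T \<longleftrightarrow> clinear_map T \<and> (\<forall>x. pos x \<longrightarrow> pos (T x)) \<and> T 1 = 1"

lemma clinear_map_add: "clinear_map T \<Longrightarrow> T (x + y) = T x + T y"
  and clinear_map_scaleC: "clinear_map T \<Longrightarrow> T (z *\<^sub>C x) = z *\<^sub>C T x"
  by (simp_all add: clinear_map_def)

lemma clinear_map_scaleR: "clinear_map T \<Longrightarrow> T (r *\<^sub>R x) = r *\<^sub>R T x"
  by (metis clinear_map_scaleC scaleC_of_real)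

lemma clinear_map_linear: "clinear_map T \<Longrightarrow> linear T"
  by (intro linearI) (simp_all add: clinear_map_add clinear_map_scaleR)

lemmas clinear_map_diff = linear_diff[OF clinear_map_linear]

lemma real_imaginary_parts:
  fixes x :: "'b::cstar_algebra"
  obtains p q where "star p = p" "star q = q" "x = p + \<i> *\<^sub>C q" "norm p \<le> norm x" "norm q \<le> norm x"
proof -
  define p where "p = (1/2) *\<^sub>R (x + star x)"
  define q where "q = (1/2) *\<^sub>R (\<i> *\<^sub>C (star x - x))"
  have "star p = p" "star q = q" unfolding p_def q_def
    by (simp_all add: star_scaleR star_add star_scaleC star_diff add.commute scaleC_diff_right)
  moreover have "x = p + \<i> *\<^sub>C q"
  proof -
    have "\<i> *\<^sub>C q = (1/2) *\<^sub>R (x - star x)"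
      unfolding q_def scaleR_scaleC[symmetric] scaleC_scaleC by (simp flip: scaleR_minus_right)
    then have "p + \<i> *\<^sub>C q = (1/2) *\<^sub>R (x + x)" unfolding p_def by (simp flip: scaleR_add_right)
    then show ?thesis by simp
  qed
  moreover have "norm p \<le> norm x" "norm q \<le> norm x"
    unfolding p_def q_def
    using norm_triangle_ineq[of x "star x"] norm_triangle_ineq4[of "star x" x]
    by (simp_all add: norm_scaleC)
  ultimately show ?thesis using that by blast
qed

text \<open>Positivity of \<open>T\<close> is applied to \<open>norm y + y\<close> and
  \<open>norm y - y\<close>.\<close>

lemma positive_unital_selfadjoint:
  assumes T: "positive_unital T" and sy: "star y = y"
  shows "star (T y) = T y" "norm (T y) \<le> norm y"
proof -
  have c: "clinear_map T" using T by (simp add: positive_unital_def)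
  have 1: "pos (norm y *\<^sub>R 1 - T y)" and 2: "pos (norm y *\<^sub>R 1 + T y)"
    using T pos_shift[OF sy] clinear_map_add[OF c] clinear_map_diff[OF c] clinear_map_scaleR[OF c]
    unfolding positive_unital_def by metis+
  then show "norm (T y) \<le> norm y" by (simp add: norm_le_if_pos_shift)
  have "star (norm y *\<^sub>R 1 + T y) = norm y *\<^sub>R 1 + T y" using 2 by (rule pos_selfadjoint)
  then show "star (T y) = T y" by (simp add: star_add star_scaleR)
qed

lemma positive_unital_star:
  assumes T: "positive_unital T"
  shows "T (star x) = star (T x)"
proof -
  obtain p q where pq: "star p = p" "star q = q" "x = p + \<i> *\<^sub>C q"
    using real_imaginary_parts by metis
  have c: "clinear_map T" using T by (simp add: positive_unital_def)
  have "star x = p + (- \<i>) *\<^sub>C q" by (simp add: pq star_add star_scaleC)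
  then show ?thesis using c pq positive_unital_selfadjoint(1)[OF T]
    by (simp add: clinear_map_add clinear_map_scaleC star_add star_scaleC clinear_map_diff)
qed

text \<open>Each of the two self-adjoint parts contributes at most \<open>norm x\<close>. What
  matters is that the constant is the same for all positive unital maps, which makes limits along
  nets of them manageable.\<close>

lemma positive_unital_norm:
  assumes T: "positive_unital T"
  shows "norm (T x) \<le> 2 * norm x"
proof -
  obtain p q where pq: "star p = p" "star q = q" "x = p + \<i> *\<^sub>C q" "norm p \<le> norm x" "norm q \<le> norm x"
    using real_imaginary_parts by metis
  have c: "clinear_map T" using T by (simp add: positive_unital_def)
  have "norm (T x) \<le> norm (T p) + norm (T q)"
    using norm_triangle_ineq[of "T p" "\<i> *\<^sub>C T q"] pq(3) c
    by (simp add: clinear_map_add clinear_map_scaleC norm_scaleC)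
  then show ?thesis using positive_unital_selfadjoint(2)[OF T pq(1)] positive_unital_selfadjoint(2)[OF T pq(2)] pq
    by linarith
qed

lemma positive_unital_bounded_linear:
  assumes T: "positive_unital T"
  shows "bounded_linear T"
  using T positive_unital_norm[OF T]
  by (intro bounded_linear_intro[where K = 2])
     (auto simp: positive_unital_def clinear_map_add clinear_map_scaleR mult.commute)

lemma star_automorphism_positive_unital:
  assumes "star_automorphism \<alpha>"
  shows "positive_unital \<alpha>"
proof -
  have \<alpha>: "bij \<alpha>" "clinear_map \<alpha>" "\<alpha> (x * y) = \<alpha> x * \<alpha> y" "\<alpha> (star x) = star (\<alpha> x)" for x y
    using assms by (auto simp: star_automorphism_def)
  obtain x where "\<alpha> x = 1" using \<alpha>(1) by (metis bij_pointE)
  then have "\<alpha> 1 = 1" by (metis \<alpha>(3) mult.right_neutral mult.left_neutral)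
  moreover have "pos (\<alpha> y)" if "pos y" for y
    using that \<alpha> unfolding pos_def by metis
  ultimately show ?thesis using \<alpha> by (simp add: positive_unital_def)
qed

lemma positive_unital_compose:
  "positive_unital T \<Longrightarrow> positive_unital R \<Longrightarrow> positive_unital (\<lambda>x. T (R x))"
  by (auto simp: positive_unital_def clinear_map_def)

text \<open>A three-epsilon argument along an arbitrary filter; the uniform bound makes the limits
  \<open>k n\<close> at the points \<open>x n\<close> a Cauchy sequence. Convergence of a net then
  has to be checked only on a dense or generating set.\<close>

lemma pointwise_limit_closed:
  fixes T :: "'i \<Rightarrow> 'b::banach \<Rightarrow> 'c::banach"
  assumes lin: "\<And>i. linear (T i)" and bd: "\<And>i x. norm (T i x) \<le> 2 * norm x"
    and F: "F \<noteq> bot"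
  shows "closed {x. \<exists>l. ((\<lambda>i. T i x) \<longlongrightarrow> l) F}"
  unfolding closed_sequential_limits
proof (intro allI impI, elim conjE)
  fix x l assume x: "\<forall>n. x n \<in> {x. \<exists>l. ((\<lambda>i. T i x) \<longlongrightarrow> l) F}" and xl: "x \<longlonglongrightarrow> l"
  obtain k where k: "((\<lambda>i. T i (x n)) \<longlongrightarrow> k n) F" for n using x by simp metis
  have d: "norm (T i y - T i z) \<le> 2 * norm (y - z)" for i y z
    using bd[of i "y - z"] by (simp add: linear_diff[OF lin])
  have kd: "norm (k n - k m) \<le> 2 * norm (x n - x m)" for n m
    by (rule tendsto_upperbound[OF tendsto_norm[OF tendsto_diff[OF k k]] _ F]) (simp add: d)
  have "Cauchy k"
  proof (rule CauchyI)
    fix e :: real assume "e > 0"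
    then obtain M where "\<forall>m\<ge>M. \<forall>n\<ge>M. norm (x m - x n) < e/2"
      using CauchyD[OF LIMSEQ_imp_Cauchy[OF xl], of "e/2"] by auto
    then show "\<exists>M. \<forall>m\<ge>M. \<forall>n\<ge>M. norm (k m - k n) < e"
      using kd by (intro exI[of _ M]) (smt (verit) field_sum_of_halves)
  qed
  then obtain K where K: "k \<longlonglongrightarrow> K" using Cauchy_convergent convergent_def by blast
  have "((\<lambda>i. T i l) \<longlongrightarrow> K) F"
  proof (rule tendstoI)
    fix e :: real assume e: "e > 0"
    \<comment> \<open>The maps are 2-Lipschitz, so a distance \<open>e/6\<close> of the arguments
      becomes at most \<open>e/3\<close> in the values.\<close>
    have "\<forall>\<^sub>F n in sequentially. dist (x n) l < e/6 \<and> dist (k n) K < e/3"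
      using tendstoD[OF xl, of "e/6"] tendstoD[OF K, of "e/3"] e by (auto intro: eventually_conj)
    then obtain n where n: "dist (x n) l < e/6" "dist (k n) K < e/3"
      using eventually_happens trivial_limit_sequentially by blast
    have "\<forall>\<^sub>F i in F. dist (T i (x n)) (k n) < e/3" using tendstoD[OF k, of "e/3"] e by auto
    then show "\<forall>\<^sub>F i in F. dist (T i l) K < e"
    proof eventually_elim
      fix i assume "dist (T i (x n)) (k n) < e/3"
      moreover have "dist (T i l) (T i (x n)) < e/3"
        using d[of i l "x n"] n(1) by (simp add: dist_norm norm_minus_commute)
      ultimately show "dist (T i l) K < e" using n(2)
        dist_triangle[of "T i l" K "T i (x n)"] dist_triangle[of "T i (x n)" K "k n"] by linarith
    qed
  qed
  then show "l \<in> {x. \<exists>l. ((\<lambda>i. T i x) \<longlongrightarrow> l) F}" by blast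
qed

lemma positive_unital_limit:
  assumes T: "\<And>i. positive_unital (T i)" and F: "F \<noteq> bot"
    and lim: "\<And>x. ((\<lambda>i. T i x) \<longlongrightarrow> L x) F"
  shows "positive_unital L"
  unfolding positive_unital_def clinear_map_def
proof (intro conjI allI impI)
  have c: "clinear_map (T i)" and o: "T i 1 = 1" for i using T[of i] by (auto simp: positive_unital_def)
  note u = tendsto_unique[OF F lim]
  show "L (x + y) = L x + L y" for x y
    by (rule u) (simp add: clinear_map_add[OF c] tendsto_add lim)
  show "L (z *\<^sub>C x) = z *\<^sub>C L x" for z x
    by (rule u) (simp add: clinear_map_scaleC[OF c] tendsto_scaleC lim)
  show "L 1 = 1" by (rule u) (simp add: o)
  show "pos (L x)" if "pos x" for x
    using Lim_in_closed_set[OF closed_pos _ F lim] T that by (auto simp: positive_unital_def)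
qed

section \<open>Generation and automorphisms\<close>

lemma unital_cstar_subalgebra_generated: "unital_cstar_subalgebra (cstar_generated X)"
  unfolding cstar_generated_def unital_cstar_subalgebra_def by (auto intro!: closed_Inter)

lemma cstar_generated_superset: "X \<subseteq> cstar_generated X"
  unfolding cstar_generated_def by auto

lemma cstar_generated_least: "unital_cstar_subalgebra B \<Longrightarrow> X \<subseteq> B \<Longrightarrow> cstar_generated X \<subseteq> B"
  unfolding cstar_generated_def by auto

lemma cstar_generated_UNIV_D:
  "cstar_generated X = UNIV \<Longrightarrow> unital_cstar_subalgebra B \<Longrightarrow> X \<subseteq> B \<Longrightarrow> B = UNIV"
  using cstar_generated_least by blast

text \<open>Positivity is demanded in place of compatibility with \<open>star\<close>: it yields the
  latter by \<open>positive_unital_star\<close> and at the same time the uniform norm bound.\<close>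

definition star_hom :: "('b::cstar_algebra \<Rightarrow> 'b) \<Rightarrow> bool" where
  "star_hom \<alpha> \<longleftrightarrow> positive_unital \<alpha> \<and> (\<forall>x y. \<alpha> (x * y) = \<alpha> x * \<alpha> y)"

lemma star_automorphism_star_hom: "star_automorphism \<alpha> \<Longrightarrow> star_hom \<alpha>"
  by (simp add: star_hom_def star_automorphism_positive_unital star_automorphism_def)

lemma positive_unital_clinear: "positive_unital T \<Longrightarrow> clinear_map T"
  and positive_unital_one: "positive_unital T \<Longrightarrow> T 1 = 1"
  by (simp_all add: positive_unital_def)

lemma positive_unital_continuous: "positive_unital T \<Longrightarrow> continuous_on UNIV T"
  by (intro linear_continuous_on positive_unital_bounded_linear)

text \<open>The equalizer is a unital C*-subalgebra containing \<open>X\<close>. This is the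
  uniqueness behind \<open>CAR_automorphism\<close>.\<close>

lemma star_hom_eq:
  assumes "star_hom \<alpha>" "star_hom \<beta>" and gen: "cstar_generated X = UNIV"
    and eq: "\<And>x. x \<in> X \<Longrightarrow> \<alpha> x = \<beta> x"
  shows "\<alpha> = \<beta>"
proof -
  have p: "positive_unital \<alpha>" "positive_unital \<beta>"
    and m: "\<alpha> (x * y) = \<alpha> x * \<alpha> y" "\<beta> (x * y) = \<beta> x * \<beta> y" for x y
    using assms by (auto simp: star_hom_def)
  note c = p[THEN positive_unital_clinear]
  have "unital_cstar_subalgebra {x. \<alpha> x = \<beta> x}"
    unfolding unital_cstar_subalgebra_def
    by (auto simp: m positive_unital_one[OF p(1)] positive_unital_one[OF p(2)]
        positive_unital_star[OF p(1)] positive_unital_star[OF p(2)]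
        clinear_map_add[OF c(1)] clinear_map_add[OF c(2)]
        clinear_map_scaleC[OF c(1)] clinear_map_scaleC[OF c(2)]
        intro!: closed_Collect_eq positive_unital_continuous p)
  then have "{x. \<alpha> x = \<beta> x} = UNIV"
    by (rule cstar_generated_UNIV_D[OF gen]) (auto simp: eq)
  then show ?thesis by auto
qed

text \<open>Multiplicativity makes the set of points of convergence a unital C*-subalgebra, so
  generators suffice. For the net that defines the expectation, which is not multiplicative, the
  normally ordered elements take over this role.\<close>

lemma star_hom_limit:
  fixes T :: "'i \<Rightarrow> 'b::cstar_algebra \<Rightarrow> 'b"
  assumes T: "\<And>i. star_hom (T i)" and F: "F \<noteq> bot" and gen: "cstar_generated X = UNIV"
    and conv: "\<And>x. x \<in> X \<Longrightarrow> \<exists>l. ((\<lambda>i. T i x) \<longlongrightarrow> l) F"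
  obtains L where "star_hom L" "\<And>x. ((\<lambda>i. T i x) \<longlongrightarrow> L x) F"
proof -
  have p: "positive_unital (T i)" and m: "T i (x * y) = T i x * T i y" for i x y
    using T by (auto simp: star_hom_def)
  note c = positive_unital_clinear[OF p]
  let ?Z = "{x. \<exists>l. ((\<lambda>i. T i x) \<longlongrightarrow> l) F}"
  have "unital_cstar_subalgebra ?Z"
    unfolding unital_cstar_subalgebra_def
  proof (intro conjI ballI allI)
    show "closed ?Z"
      by (intro pointwise_limit_closed clinear_map_linear c positive_unital_norm p F)
    show "1 \<in> ?Z" by (auto simp: positive_unital_one[OF p])
    show "x + y \<in> ?Z" "x * y \<in> ?Z" if "x \<in> ?Z" "y \<in> ?Z" for x y
      using that by (auto simp: clinear_map_add[OF c] m intro: tendsto_add tendsto_mult)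
    show "z *\<^sub>C x \<in> ?Z" if "x \<in> ?Z" for z x
      using that by (auto simp: clinear_map_scaleC[OF c] intro: tendsto_scaleC)
    show "star x \<in> ?Z" if "x \<in> ?Z" for x
      using that by (auto simp: positive_unital_star[OF p] intro: tendsto_star)
  qed
  then have "?Z = UNIV" by (rule cstar_generated_UNIV_D[OF gen]) (auto simp: conv)
  then have "\<forall>x. \<exists>l. ((\<lambda>i. T i x) \<longlongrightarrow> l) F" by blast
  then obtain L where L: "((\<lambda>i. T i x) \<longlongrightarrow> L x) F" for x by metis
  have "positive_unital L" by (rule positive_unital_limit[OF p F L])
  moreover have "L (x * y) = L x * L y" for x y
    by (rule tendsto_unique[OF F L]) (simp add: m tendsto_mult L)
  ultimately show ?thesis using that L unfolding star_hom_def by blast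
qed

lemma unitary_conj_star_hom:
  assumes "star u * u = 1" "u * star u = 1"
  shows "star_hom (\<lambda>x. u * x * star u)"
proof -
  have "u * (x * y) * star u = u * x * star u * (u * y * star u)" for x y
    using assms by (metis mult.assoc mult.left_neutral)
  then show ?thesis
    unfolding star_hom_def positive_unital_def clinear_map_def
    using pos_conj[of _ "star u"] assms(2)
    by (simp add: algebra_simps mult_scaleC_left mult_scaleC_right)
qed

lemma star_hom_star_automorphism:
  assumes "star_hom \<alpha>" "star_hom \<beta>" "\<And>x. \<alpha> (\<beta> x) = x" "\<And>x. \<beta> (\<alpha> x) = x"
  shows "star_automorphism \<alpha>"
proof -
  have "bij \<alpha>" by (rule o_bij[of \<beta>]) (simp_all add: fun_eq_iff assms)
  then show ?thesis using assms(1) unfolding star_automorphism_def star_hom_def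
    by (auto simp: positive_unital_clinear positive_unital_star)
qed

section \<open>The canonical anticommutation relations\<close>

text \<open>The one-particle space is represented by its antilinear image \<open>V\<close> in the algebra.\<close>

locale car_space =
  fixes V :: "'b::cstar_algebra set" and ip :: "'b \<Rightarrow> 'b \<Rightarrow> complex"
  assumes V_zero: "0 \<in> V"
    and V_add: "\<And>x y. x \<in> V \<Longrightarrow> y \<in> V \<Longrightarrow> x + y \<in> V"
    and V_scale: "\<And>z x. x \<in> V \<Longrightarrow> z *\<^sub>C x \<in> V"
    and car: "\<And>x y. x \<in> V \<Longrightarrow> y \<in> V \<Longrightarrow> x * star y + star y * x = ip x y *\<^sub>C 1"
    and anti: "\<And>x y. x \<in> V \<Longrightarrow> y \<in> V \<Longrightarrow> x * y + y * x = 0"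
    and gen: "cstar_generated V = UNIV"
begin

section \<open>The sesquilinear form, read off from the anticommutators\<close>

lemma V_diff: "x \<in> V \<Longrightarrow> y \<in> V \<Longrightarrow> x - y \<in> V"
  using V_add[of x "(- 1) *\<^sub>C y"] V_scale[of y "- 1"] by simp

lemma V_minus: "x \<in> V \<Longrightarrow> - x \<in> V"
  using V_scale[of x "- 1"] by simp

text \<open>Since \<open>1\<close> is nonzero, the anticommutator determines its scalar, and every
  property of \<open>ip\<close> is derived from this. The form comes out linear in the first
  variable, because \<open>V\<close> is an antilinear image of the one-particle space.\<close>

lemma ip_eqI: "x \<in> V \<Longrightarrow> y \<in> V \<Longrightarrow> x * star y + star y * x = c *\<^sub>C 1 \<Longrightarrow> ip x y = c"
  using car[of x y] scaleC_one_eq_iff by metis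

lemma ip_add_left: "x \<in> V \<Longrightarrow> x' \<in> V \<Longrightarrow> y \<in> V \<Longrightarrow> ip (x + x') y = ip x y + ip x' y"
  by (rule ip_eqI) (simp_all add: V_add scaleC_add_left car[symmetric] algebra_simps)

lemma ip_scale_left: "x \<in> V \<Longrightarrow> y \<in> V \<Longrightarrow> ip (z *\<^sub>C x) y = z * ip x y"
  by (rule ip_eqI) (simp_all add: V_scale mult_scaleC_left mult_scaleC_right car[symmetric]
      flip: scaleC_scaleC scaleC_add_right)

lemma ip_commute: "x \<in> V \<Longrightarrow> y \<in> V \<Longrightarrow> ip y x = cnj (ip x y)"
proof (rule ip_eqI)
  assume "x \<in> V" "y \<in> V"
  then have "star (x * star y + star y * x) = star (ip x y *\<^sub>C 1)" by (simp only: car)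
  then show "y * star x + star x * y = cnj (ip x y) *\<^sub>C 1"
    by (simp add: star_add star_mult star_scaleC)
qed

lemma ip_minus_left: "x \<in> V \<Longrightarrow> y \<in> V \<Longrightarrow> ip (- x) y = - ip x y"
  using ip_scale_left[of x y "- 1"] by simp

lemma ip_diff_left: "x \<in> V \<Longrightarrow> x' \<in> V \<Longrightarrow> y \<in> V \<Longrightarrow> ip (x - x') y = ip x y - ip x' y"
  using ip_add_left[of x "- x'" y] by (simp add: V_minus ip_minus_left)

lemma ip_diff_right: "x \<in> V \<Longrightarrow> y \<in> V \<Longrightarrow> y' \<in> V \<Longrightarrow> ip x (y - y') = ip x y - ip x y'"
  by (metis V_diff complex_cnj_diff ip_commute ip_diff_left)

lemma ip_scale_right: "x \<in> V \<Longrightarrow> y \<in> V \<Longrightarrow> ip x (z *\<^sub>C y) = cnj z * ip x y"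
  by (metis V_scale complex_cnj_mult ip_commute ip_scale_left)

text \<open>A null vector satisfies \<open>x * star x = - (star x * x)\<close>, and the left side is
  positive.\<close>

lemma ip_self_eq_zero: "x \<in> V \<Longrightarrow> ip x x = 0 \<Longrightarrow> x = 0"
proof -
  assume "x \<in> V" "ip x x = 0"
  have "x * star x = - (star x * x)"
    using car[OF \<open>x \<in> V\<close> \<open>x \<in> V\<close>] \<open>ip x x = 0\<close> by (simp add: eq_neg_iff_add_eq_0)
  then have "pos (- (star x * x))" using star_mult_pos[of "star x"] by simp
  then show "x = 0" by (rule star_mult_neg_imp_zero)
qed

lemma ip_self: "x \<in> V \<Longrightarrow> ip x x = complex_of_real (Re (ip x x))"
  and ip_self_nonneg: "x \<in> V \<Longrightarrow> 0 \<le> Re (ip x x)"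
proof -
  assume x: "x \<in> V"
  have "cnj (ip x x) = ip x x" using ip_commute[OF x x] by simp
  then show *: "ip x x = complex_of_real (Re (ip x x))" by (simp add: complex_eq_iff)
  have "pos (x * star x + star x * x)" using commutator_sum_pos[of x] by (simp add: add.commute)
  then have p: "pos (Re (ip x x) *\<^sub>R (1::'b))" unfolding car[OF x x] by (metis * scaleC_of_real)
  show "0 \<le> Re (ip x x)"
  proof (rule ccontr)
    assume n: "\<not> 0 \<le> Re (ip x x)"
    have "pos ((- Re (ip x x)) *\<^sub>R (1::'b))" using n by (intro pos_scaleR) auto
    then have "Re (ip x x) *\<^sub>R (1::'b) = 0" using pos_antisym[OF p] by simp
    then show False using n by simp
  qed
qed

definition unit :: "'b \<Rightarrow> bool" where
  "unit e \<longleftrightarrow> e \<in> V \<and> ip e e = 1"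

lemma normalize:
  assumes "x \<in> V" "x \<noteq> 0"
  obtains s where "s > 0" "Re (ip x x) = s\<^sup>2" "ip x x = complex_of_real (s\<^sup>2)" "unit (complex_of_real (1/s) *\<^sub>C x)"
proof -
  define s where "s = sqrt (Re (ip x x))"
  have "Re (ip x x) \<noteq> 0" using assms ip_self_eq_zero ip_self by force
  then have s: "s > 0" and s2: "Re (ip x x) = s\<^sup>2" using ip_self_nonneg[OF assms(1)] by (auto simp: s_def)
  have i: "ip x x = complex_of_real (s\<^sup>2)" using ip_self[OF assms(1)] s2 by simp
  show ?thesis
    by (rule that[OF s s2 i])
      (use s in \<open>simp add: unit_def V_scale assms ip_scale_left ip_scale_right i power2_eq_square
         flip: of_real_mult\<close>)
qed

lemma square_zero: "x \<in> V \<Longrightarrow> x * x = 0"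
  using anti[of x x] by (metis scaleR_half_double scaleR_zero_right)

text \<open>\<open>e * star e\<close> and \<open>star e * e\<close> are complementary projections,
  onto the mode being empty and occupied, respectively.\<close>

lemma unit_projections:
  assumes "unit e"
  shows "e * e = 0" "star e * star e = 0" "e * star e + star e * e = 1"
    "e * star e * e = e" "star e * e * star e = star e"
proof -
  have e: "e \<in> V" "ip e e = 1" using assms by (auto simp: unit_def)
  show 1: "e * e = 0" using square_zero e by blast
  show "star e * star e = 0" using 1 by (metis star_mult star_zero)
  show 2: "e * star e + star e * e = 1" using car[OF e(1) e(1)] e by simp
  have "(e * star e + star e * e) * e = e" unfolding 2 by simp
  then show 3: "e * star e * e = e" by (simp add: distrib_right mult.assoc 1)
  have "star (e * star e * e) = star e" unfolding 3 ..
  then show "star e * e * star e = star e" by (simp add: star_mult mult.assoc)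
qed

lemma orthogonal_anticommute:
  assumes "v \<in> V" "e \<in> V" "ip v e = 0"
  shows "v * e = - (e * v)" "v * star e = - (star e * v)" "star v * e = - (e * star v)"
    "star v * star e = - (star e * star v)"
proof -
  show 1: "v * e = - (e * v)" using anti[OF assms(1,2)] by (simp add: eq_neg_iff_add_eq_0)
  show "v * star e = - (star e * v)"
    using car[OF assms(1,2)] assms(3) by (simp add: eq_neg_iff_add_eq_0)
  show "star v * e = - (e * star v)"
    using car[OF assms(2,1)] ip_commute[OF assms(1,2)] assms(3)
    by (simp add: eq_neg_iff_add_eq_0 add.commute)
  have "e * v = - (v * e)" using 1 by simp
  then have "star (e * v) = star (- (v * e))" by (rule arg_cong)
  then show "star v * star e = - (star e * star v)" by (simp add: star_mult)
qed

text \<open>Moving past \<open>e\<close> and past \<open>star e\<close> costs one sign each, and the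
  two cancel.\<close>

lemma orthogonal_commute:
  assumes "v \<in> V" "e \<in> V" "ip v e = 0"
  shows "v * (e * star e) = e * star e * v" "v * (star e * e) = star e * e * v"
    "star v * (e * star e) = e * star e * star v"
proof -
  note a = orthogonal_anticommute[OF assms]
  have *: "x * (y * z) = y * z * x" if "x * y = - (y * x)" "x * z = - (z * x)" for x y z :: 'b
  proof -
    have "x * (y * z) = (x * y) * z" by (simp only: mult.assoc)
    also have "\<dots> = - (y * (x * z))" unfolding that(1) by (simp add: mult.assoc)
    also have "\<dots> = y * z * x" unfolding that(2) by (simp add: mult.assoc)
    finally show ?thesis .
  qed
  show "v * (e * star e) = e * star e * v" "v * (star e * e) = star e * e * v"
    "star v * (e * star e) = e * star e * star v"
    by (intro * a)+
qed

definition comp_along :: "'b \<Rightarrow> 'b \<Rightarrow> 'b" where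
  "comp_along e v = ip v e *\<^sub>C e"

lemma orthogonal_part:
  assumes "unit e" "v \<in> V"
  shows "v - comp_along e v \<in> V" "ip (v - comp_along e v) e = 0"
  using assms by (simp_all add: comp_along_def unit_def V_diff V_scale ip_diff_left ip_scale_left)

section \<open>Unitaries of the algebra that implement one-particle unitaries\<close>

definition reflection :: "'b \<Rightarrow> complex \<Rightarrow> 'b" where
  "reflection e z = e * star e + z *\<^sub>C (star e * e)"

lemma star_reflection: "star (reflection e z) = reflection e (cnj z)"
  by (simp add: reflection_def star_add star_mult star_scaleC)

lemma reflection_unitary:
  assumes e: "unit e" and z: "cmod z = 1"
  shows "reflection e z * reflection e (cnj z) = 1"
proof -
  note p = unit_projections[OF e]
  have PP: "e * star e * (e * star e) = e * star e" "star e * e * (star e * e) = star e * e"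
    using p by (metis mult.assoc)+
  have PQ: "e * star e * (star e * e) = 0" "star e * e * (e * star e) = 0"
    using p by (metis mult.assoc mult_zero_left mult_zero_right)+
  have "z * cnj z = 1" using z complex_norm_square[of z] by simp
  then show ?thesis
    unfolding reflection_def
    by (simp add: distrib_left distrib_right mult_scaleC_left mult_scaleC_right PP PQ scaleC_scaleC p(3)
       mult.commute)
qed

text \<open>The part of \<open>v\<close> orthogonal to \<open>e\<close> commutes with the unitary,
  while \<open>e\<close> acquires the factor \<open>cnj z\<close> from the right:
  \<open>reflection e z * e = e\<close> and
  \<open>e * reflection e (cnj z) = cnj z *\<^sub>C e\<close>.\<close>

lemma reflection_conj:
  assumes e: "unit e" and z: "cmod z = 1" and v: "v \<in> V"
  shows "reflection e z * v * reflection e (cnj z) = v + (cnj z - 1) *\<^sub>C comp_along e v"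
proof -
  note p = unit_projections[OF e]
  define w where "w = v - comp_along e v"
  have eV: "e \<in> V" using e by (simp add: unit_def)
  have w: "w \<in> V" "ip w e = 0" unfolding w_def using orthogonal_part[OF e v] by auto
  have "reflection e z * w = w * reflection e z"
    using orthogonal_commute[OF w(1) eV w(2)]
    by (simp add: reflection_def distrib_left distrib_right mult_scaleC_left mult_scaleC_right)
  then have 1: "reflection e z * w * reflection e (cnj z) = w"
    using reflection_unitary[OF e z] by (simp add: mult.assoc)
  have "reflection e z * e = e"
    by (simp add: reflection_def distrib_right mult_scaleC_left p mult.assoc[of "star e"])
  moreover have "e * reflection e (cnj z) = cnj z *\<^sub>C e"
    by (simp add: reflection_def distrib_left mult_scaleC_right p mult.assoc[symmetric])
  ultimately have 2: "reflection e z * e * reflection e (cnj z) = cnj z *\<^sub>C e" by simp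
  have "reflection e z * (w + c *\<^sub>C e) * reflection e (cnj z) =
      reflection e z * w * reflection e (cnj z) + c *\<^sub>C (reflection e z * e * reflection e (cnj z))" for c
    by (simp add: distrib_left distrib_right mult_scaleC_left mult_scaleC_right)
  from this[of "ip v e"] have "reflection e z * v * reflection e (cnj z) =
      reflection e z * w * reflection e (cnj z) + ip v e *\<^sub>C (reflection e z * e * reflection e (cnj z))"
    by (simp add: w_def comp_along_def)
  also have "\<dots> = w + ip v e *\<^sub>C (cnj z *\<^sub>C e)" unfolding 1 2 ..
  also have "\<dots> = v + (cnj z - 1) *\<^sub>C comp_along e v"
    using scaleC_diff_left[of "cnj z * ip v e" "ip v e" e]
    by (simp add: w_def comp_along_def scaleC_scaleC algebra_simps)
  finally show ?thesis .
qed

text \<open>Invariance of \<open>V\<close> is demanded in both directions, since the inverse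
  conjugation pulls target vectors back.\<close>

definition V_unitary :: "'b \<Rightarrow> bool" where
  "V_unitary u \<longleftrightarrow> star u * u = 1 \<and> u * star u = 1 \<and>
     (\<forall>v\<in>V. u * v * star u \<in> V \<and> star u * v * u \<in> V)"

lemma V_unitary_one: "V_unitary 1"
  by (simp add: V_unitary_def)

lemma V_unitary_mult:
  assumes "V_unitary u" "V_unitary w" shows "V_unitary (u * w)"
proof -
  have "star (u * w) * (u * w) = star w * (star u * u) * w"
    "(u * w) * star (u * w) = u * (w * star w) * star u"
    "u * w * v * star (u * w) = u * (w * v * star w) * star u"
    "star (u * w) * v * (u * w) = star w * (star u * v * u) * w" for v
    by (simp_all add: star_mult mult.assoc)
  then show ?thesis using assms unfolding V_unitary_def by auto
qed

lemma V_unitary_reflection: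
  assumes e: "unit e" and z: "cmod z = 1"
  shows "V_unitary (reflection e z)"
proof -
  have z': "cmod (cnj z) = 1" using z by simp
  have "e \<in> V" using e by (simp add: unit_def)
  then show ?thesis
    unfolding V_unitary_def star_reflection
    using reflection_unitary[OF e z] reflection_unitary[OF e z'] reflection_conj[OF e z]
      reflection_conj[OF e z'] by (auto simp: V_add V_scale comp_along_def)
qed

text \<open>The form is determined by anticommutators, and conjugation by a unitary carries these
  along.\<close>

lemma V_unitary_ip:
  assumes u: "V_unitary u" and v: "v \<in> V" "w \<in> V"
  shows "ip (star u * v * u) (star u * w * u) = ip v w"
proof (rule ip_eqI)
  have uu: "u * star u = 1" "star u * u = 1" using u by (auto simp: V_unitary_def)
  have m: "star u * x * u * (star u * y * u) = star u * (x * y) * u" for x y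
    by (metis uu(1) mult.assoc mult.left_neutral)
  have "star u * v * u * star (star u * w * u) + star (star u * w * u) * (star u * v * u) =
     star u * (v * star w + star w * v) * u"
    unfolding star_mult star_star by (simp only: m[unfolded mult.assoc] mult.assoc distrib_left distrib_right)
  also have "\<dots> = ip v w *\<^sub>C 1" unfolding car[OF v] by (simp add: mult_scaleC_left mult_scaleC_right uu)
  finally show "star u * v * u * star (star u * w * u) + star (star u * w * u) * (star u * v * u) = ip v w *\<^sub>C 1" .
qed (use u v in \<open>auto simp: V_unitary_def\<close>)

text \<open>A complex Householder reflection along \<open>d = x - v\<close>. The factor
  \<open>- 1\<close> on \<open>d\<close> would do only for real \<open>ip x v\<close>, so a general
  phase is used.\<close>

lemma reflection_exchange:
  assumes x: "x \<in> V" and v: "v \<in> V" and eq: "ip x x = ip v v" and ne: "x \<noteq> v"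
  obtains R where "V_unitary R" "R * x * star R = v"
    "\<And>y. y \<in> V \<Longrightarrow> ip y (x - v) = 0 \<Longrightarrow> R * y * star R = y"
proof -
  define d where "d = x - v"
  have d: "d \<in> V" "d \<noteq> 0" using x v ne by (auto simp: d_def V_diff)
  obtain s where s: "s > 0" "Re (ip d d) = s\<^sup>2" "ip d d = complex_of_real (s\<^sup>2)"
    "unit (complex_of_real (1/s) *\<^sub>C d)" using normalize[OF d] by metis
  define e where "e = complex_of_real (1/s) *\<^sub>C d"
  have e: "unit e" using s by (simp add: e_def)
  define c where "c = ip x d"
  have "ip d d = c - (ip v x - ip v v)" unfolding c_def
    by (simp add: d_def ip_diff_left ip_diff_right V_diff x v)
  also have "\<dots> = c + cnj c"
    unfolding c_def by (simp add: d_def ip_diff_right x v ip_commute[OF x v] eq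
       flip: ip_commute[OF x x] ip_commute[OF v v])
  finally have sc: "complex_of_real (s\<^sup>2) = c + cnj c" using s by simp
  have c0: "c \<noteq> 0" using sc s by auto
  \<comment> \<open>The component of \<open>x\<close> along \<open>d\<close> is
    \<open>c / s^2\<close> times \<open>d\<close>, so sending \<open>x\<close> to
    \<open>x - d\<close> requires \<open>cnj z - 1 = - s^2 / c\<close>. Because
    \<open>s^2 = c + cnj c\<close>, this means \<open>cnj z = - cnj c / c\<close>, of modulus
    1.\<close>
  define z where "z = cnj (1 - complex_of_real (s\<^sup>2) / c)"
  have "cnj z = - cnj c / c" using c0 unfolding z_def sc by (simp add: field_simps)
  then have "cmod (cnj z) = 1" using c0 by (simp add: norm_divide)
  then have z: "cmod z = 1" by simp
  have conj: "reflection e z * y * star (reflection e z) = y + ((cnj z - 1) * (ip y d / complex_of_real (s\<^sup>2))) *\<^sub>C d"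
    if "y \<in> V" for y
    unfolding star_reflection reflection_conj[OF e z that] unfolding comp_along_def e_def
    using that d s(1) by (simp add: ip_scale_right scaleC_scaleC power2_eq_square)
  show ?thesis
  proof (rule that[of "reflection e z"])
    show "V_unitary (reflection e z)" by (rule V_unitary_reflection[OF e z])
    have "(cnj z - 1) * (ip x d / complex_of_real (s\<^sup>2)) = - 1"
      using c0 s(1) unfolding c_def[symmetric] z_def by (simp add: field_simps)
    then show "reflection e z * x * star (reflection e z) = v"
      unfolding conj[OF x] by (simp add: d_def)
    show "reflection e z * y * star (reflection e z) = y" if "y \<in> V" "ip y (x - v) = 0" for y
      unfolding conj[OF that(1)] using that(2) by (simp add: d_def)
  qed
qed

text \<open>Induction over \<open>F\<close>: the new target is pulled back to \<open>v\<close> by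
  the unitary found so far. Equality of the Gram matrices makes all earlier \<open>x i\<close>
  orthogonal to \<open>x j - v\<close>, so the reflection that takes \<open>x j\<close> to
  \<open>v\<close> leaves them alone.\<close>

lemma finite_implementer:
  assumes "finite F" "\<And>i. i \<in> F \<Longrightarrow> x i \<in> V \<and> y i \<in> V"
    "\<And>i j. i \<in> F \<Longrightarrow> j \<in> F \<Longrightarrow> ip (x i) (x j) = ip (y i) (y j)"
  shows "\<exists>u. V_unitary u \<and> (\<forall>i\<in>F. u * x i * star u = y i)"
  using assms
proof (induction F rule: finite_induct)
  case empty
  show ?case using V_unitary_one by auto
next
  case (insert j F)
  then obtain u where u: "V_unitary u" "\<And>i. i \<in> F \<Longrightarrow> u * x i * star u = y i" by auto
  have uu: "u * star u = 1" "star u * u = 1" using u by (auto simp: V_unitary_def)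
  define v where "v = star u * y j * u"
  have vV: "v \<in> V" and xj: "x j \<in> V" using u(1) insert.prems(1)[of j] by (auto simp: v_def V_unitary_def)
  have xi: "x i = star u * y i * u" if "i \<in> F" for i
    unfolding u(2)[OF that, symmetric] by (metis uu(2) mult.assoc mult.left_neutral mult.right_neutral)
  have uv: "u * v * star u = y j"
    unfolding v_def by (metis uu(1) mult.assoc mult.left_neutral mult.right_neutral)
  show ?case
  proof (cases "x j = v")
    case True
    then show ?thesis using u uv by (intro exI[of _ u]) auto
  next
    case False
    have "ip (x j) (x j) = ip v v"
      unfolding v_def using V_unitary_ip[OF u(1)] insert.prems by simp
    then obtain R where R: "V_unitary R" "R * x j * star R = v"
      "\<And>y. y \<in> V \<Longrightarrow> ip y (x j - v) = 0 \<Longrightarrow> R * y * star R = y"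
      using reflection_exchange[OF xj vV] False by metis
    have fixed: "R * x i * star R = x i" if i: "i \<in> F" for i
    proof (rule R(3))
      show xV: "x i \<in> V" using i insert.prems by simp
      have "ip (x i) v = ip (y i) (y j)"
        unfolding v_def xi[OF i] using V_unitary_ip[OF u(1)] insert.prems i by simp
      then show "ip (x i) (x j - v) = 0"
        using ip_diff_right[OF xV xj vV] insert.prems(2)[of i j] i by simp
    qed
    have "u * R * x i * star (u * R) = u * (R * x i * star R) * star u" for i
      by (simp add: star_mult mult.assoc)
    then have "\<forall>i\<in>insert j F. u * R * x i * star (u * R) = y i"
      using R(2) uv fixed u(2) by auto
    then show ?thesis using V_unitary_mult[OF u(1) R(1)] by blast
  qed
qed

text \<open>A limit of inner automorphisms need not be onto, so the inverse conjugations are passed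
  to a limit as well. Those converge on the \<open>y i\<close>, which is why the \<open>y i\<close>
  have to generate the algebra too.\<close>

lemma automorphism_exists:
  assumes xy: "\<And>i. i \<in> C \<Longrightarrow> x i \<in> V \<and> y i \<in> V"
    and ip: "\<And>i j. i \<in> C \<Longrightarrow> j \<in> C \<Longrightarrow> ip (x i) (x j) = ip (y i) (y j)"
    and gx: "cstar_generated (x ` C) = UNIV" and gy: "cstar_generated (y ` C) = UNIV"
  obtains \<alpha> where "star_automorphism \<alpha>" "\<And>i. i \<in> C \<Longrightarrow> \<alpha> (x i) = y i"
proof -
  define Q where "Q = (\<lambda>F u. V_unitary u \<and> (F \<subseteq> C \<longrightarrow> finite F \<longrightarrow> (\<forall>i\<in>F. u * x i * star u = y i)))"
  have "\<exists>u. Q F u" for F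
  proof (cases "F \<subseteq> C \<and> finite F")
    case True
    then show ?thesis using finite_implementer[of F x y] xy ip unfolding Q_def by (simp add: subset_iff)
  next
    case False
    then show ?thesis using V_unitary_one unfolding Q_def by blast
  qed
  then obtain u where "Q F (u F)" for F by metis
  then have uU: "V_unitary (u F)"
    and uF: "F \<subseteq> C \<Longrightarrow> finite F \<Longrightarrow> i \<in> F \<Longrightarrow> u F * x i * star (u F) = y i" for F i
    by (auto simp: Q_def)
  have uu: "u F * star (u F) = 1" "star (u F) * u F = 1" for F using uU by (auto simp: V_unitary_def)
  have uF': "star (u F) * y i * u F = x i" if "F \<subseteq> C" "finite F" "i \<in> F" for F i
    unfolding uF[OF that, symmetric] by (metis uu(2) mult.assoc mult.left_neutral mult.right_neutral)
  let ?N = "finite_subsets_at_top C"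
  have N: "?N \<noteq> bot" by simp
  have ev: "\<forall>\<^sub>F F in ?N. F \<subseteq> C \<and> finite F \<and> i \<in> F" if "i \<in> C" for i
    unfolding eventually_finite_subsets_at_top using that by (intro exI[of _ "{i}"]) auto
  have l1: "((\<lambda>F. u F * x i * star (u F)) \<longlongrightarrow> y i) ?N" if "i \<in> C" for i
    by (rule tendsto_eventually) (use ev[OF that] uF in \<open>auto elim!: eventually_mono\<close>)
  have l2: "((\<lambda>F. star (u F) * y i * u F) \<longlongrightarrow> x i) ?N" if "i \<in> C" for i
    by (rule tendsto_eventually) (use ev[OF that] uF' in \<open>auto elim!: eventually_mono\<close>)
  have h1: "star_hom (\<lambda>z. u F * z * star (u F))" for F
    by (intro unitary_conj_star_hom uu)
  have h2: "star_hom (\<lambda>z. star (u F) * z * u F)" for F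
    using unitary_conj_star_hom[of "star (u F)"] uu by simp
  obtain \<alpha> where \<alpha>: "star_hom \<alpha>" "\<And>z. ((\<lambda>F. u F * z * star (u F)) \<longlongrightarrow> \<alpha> z) ?N"
    by (rule star_hom_limit[of "\<lambda>F z. u F * z * star (u F)", OF h1 N gx]) (use l1 in auto)
  obtain \<beta> where \<beta>: "star_hom \<beta>" "\<And>z. ((\<lambda>F. star (u F) * z * u F) \<longlongrightarrow> \<beta> z) ?N"
    by (rule star_hom_limit[of "\<lambda>F z. star (u F) * z * u F", OF h2 N gy]) (use l2 in auto)
  have ax: "\<alpha> (x i) = y i" and by_: "\<beta> (y i) = x i" if "i \<in> C" for i
    using tendsto_unique[OF N \<alpha>(2) l1[OF that]] tendsto_unique[OF N \<beta>(2) l2[OF that]] by auto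
  have comp: "star_hom (\<lambda>z. f (g z))" if "star_hom f" "star_hom g" for f g :: "'b \<Rightarrow> 'b"
    using that by (auto simp: star_hom_def intro: positive_unital_compose)
  have id: "star_hom (\<lambda>z::'b. z)"
    by (simp add: star_hom_def positive_unital_def clinear_map_def)
  have "(\<lambda>z. \<beta> (\<alpha> z)) = (\<lambda>z. z)"
    by (rule star_hom_eq[OF comp[OF \<beta>(1) \<alpha>(1)] id gx]) (auto simp: ax by_)
  moreover have "(\<lambda>z. \<alpha> (\<beta> z)) = (\<lambda>z. z)"
    by (rule star_hom_eq[OF comp[OF \<alpha>(1) \<beta>(1)] id gy]) (auto simp: ax by_)
  ultimately have "star_automorphism \<alpha>"
    using star_hom_star_automorphism[OF \<alpha>(1) \<beta>(1)] by (simp add: fun_eq_iff)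
  then show ?thesis using that ax by blast
qed

lemma parity_exists:
  obtains \<gamma> where "star_automorphism \<gamma>" "\<And>v. v \<in> V \<Longrightarrow> \<gamma> v = - v"
proof -
  have "uminus ` V = V"
    using V_minus by (auto simp: image_iff) (metis V_minus add.inverse_inverse)
  then show ?thesis
    using automorphism_exists[of V "\<lambda>v. v" "uminus"] that gen V_minus
    by (simp add: ip_minus_left) (metis V_minus ip_commute ip_minus_left complex_cnj_minus
        add.inverse_inverse)
qed

subsection \<open>Normally ordered elements are dense\<close>

text \<open>Creators enter only on the left, annihilators only on the right. On these sides the
  expectation obeys a simple rule for all vectors, so that inductions over this set can follow that
  rule.\<close>

inductive_set normal_ordered :: "'b set" where
  one: "1 \<in> normal_ordered"
| add: "x \<in> normal_ordered \<Longrightarrow> y \<in> normal_ordered \<Longrightarrow> x + y \<in> normal_ordered"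
| scale: "x \<in> normal_ordered \<Longrightarrow> z *\<^sub>C x \<in> normal_ordered"
| right: "x \<in> normal_ordered \<Longrightarrow> u \<in> V \<Longrightarrow> x * u \<in> normal_ordered"
| left: "x \<in> normal_ordered \<Longrightarrow> u \<in> V \<Longrightarrow> star u * x \<in> normal_ordered"

text \<open>Behind a trailing annihilator \<open>v\<close>, the relation
  \<open>v * star u = ip v u - star u * v\<close> moves \<open>star u\<close> inwards to where the
  induction hypothesis applies.\<close>

lemma normal_ordered_mult_star:
  "x \<in> normal_ordered \<Longrightarrow> u \<in> V \<Longrightarrow> x * star u \<in> normal_ordered"
proof (induction rule: normal_ordered.induct)
  case one
  then show ?case using normal_ordered.left[OF normal_ordered.one] by simp
next
  case (right x v)
  have "v * star u = ip v u *\<^sub>C 1 - star u * v"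
    using car[OF right(2) right.prems] by (simp add: algebra_simps)
  then have eq: "x * v * star u = ip v u *\<^sub>C x + (- 1) *\<^sub>C ((x * star u) * v)"
    by (simp add: mult.assoc right_diff_distrib mult_scaleC_right)
  show ?case unfolding eq
    by (intro normal_ordered.add normal_ordered.scale normal_ordered.right right)
next
  case (left x v)
  then show ?case by (simp add: mult.assoc normal_ordered.left)
qed (auto simp: distrib_right mult_scaleC_left intro: normal_ordered.intros)

lemma normal_ordered_star: "x \<in> normal_ordered \<Longrightarrow> star x \<in> normal_ordered"
  by (induction rule: normal_ordered.induct)
     (auto simp: star_add star_scaleC star_mult intro: normal_ordered.intros)

lemma normal_ordered_mult:
  "y \<in> normal_ordered \<Longrightarrow> x \<in> normal_ordered \<Longrightarrow> x * y \<in> normal_ordered"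
proof (induction arbitrary: x rule: normal_ordered.induct)
  case (left y u)
  then show ?case using normal_ordered_mult_star by (simp flip: mult.assoc)
qed (auto simp: distrib_left mult_scaleC_right intro: normal_ordered.intros simp flip: mult.assoc)

lemma closure_normal_ordered: "closure normal_ordered = UNIV"
proof (rule cstar_generated_UNIV_D[OF gen])
  have lim: "x \<in> closure normal_ordered \<longleftrightarrow> (\<exists>f. (\<forall>n. f n \<in> normal_ordered) \<and> f \<longlonglongrightarrow> x)" for x
    by (rule closure_sequential)
  show "unital_cstar_subalgebra (closure normal_ordered)"
    unfolding unital_cstar_subalgebra_def
  proof (intro conjI ballI allI)
    show "1 \<in> closure normal_ordered" using normal_ordered.one closure_subset by blast
    fix x assume "x \<in> closure normal_ordered"
    then obtain f where f: "\<And>n. f n \<in> normal_ordered" "f \<longlonglongrightarrow> x" using lim by blast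
    show "star x \<in> closure normal_ordered"
      unfolding lim by (rule exI[of _ "\<lambda>n. star (f n)"]) (auto intro: normal_ordered_star f tendsto_star)
    show "z *\<^sub>C x \<in> closure normal_ordered" for z
      unfolding lim by (rule exI[of _ "\<lambda>n. z *\<^sub>C f n"]) (auto intro: normal_ordered.scale f tendsto_scaleC)
    fix y assume "y \<in> closure normal_ordered"
    then obtain g where g: "\<And>n. g n \<in> normal_ordered" "g \<longlonglongrightarrow> y" using lim by blast
    show "x + y \<in> closure normal_ordered"
      unfolding lim by (rule exI[of _ "\<lambda>n. f n + g n"]) (auto intro: normal_ordered.add f g tendsto_add)
    show "x * y \<in> closure normal_ordered"
      unfolding lim by (rule exI[of _ "\<lambda>n. f n * g n"]) (auto intro: normal_ordered_mult f g tendsto_mult)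
  qed auto
  show "V \<subseteq> closure normal_ordered"
    using normal_ordered.right[OF normal_ordered.one] closure_subset by fastforce
qed

lemma normal_ordered_dense:
  assumes "closed {x. P x}" "\<And>x. x \<in> normal_ordered \<Longrightarrow> P x"
  shows "P x"
proof -
  have "closure normal_ordered \<subseteq> {x. P x}" using assms by (intro closure_minimal) auto
  then show ?thesis by (auto simp: closure_normal_ordered)
qed

subsection \<open>Tracing out one mode\<close>

text \<open>For a unit vector \<open>e\<close> this is the identity on the algebra of the orthogonal complement of \<open>e\<close>
  tensored with the vacuum state of the mode \<open>e\<close>; \<open>\<gamma>\<close> is the parity automorphism.\<close>

definition mode_expectation :: "('b \<Rightarrow> 'b) \<Rightarrow> 'b \<Rightarrow> 'b \<Rightarrow> 'b" where
  "mode_expectation \<gamma> e x = e * star e * x * (e * star e) + star e * \<gamma> x * e"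

text \<open>Both summands are conjugations, the second after \<open>\<gamma>\<close>, hence
  positive. In the second one, moving a vector orthogonal to \<open>e\<close> past the outer
  \<open>e\<close> costs a sign, which \<open>\<gamma>\<close> compensates; otherwise odd elements
  would violate the module rules.\<close>

lemma mode_expectation:
  assumes \<gamma>: "star_hom \<gamma>" "\<And>v. v \<in> V \<Longrightarrow> \<gamma> v = - v" and e: "unit e"
  shows "positive_unital (mode_expectation \<gamma> e)"
    and "u \<in> V \<Longrightarrow> mode_expectation \<gamma> e (x * u) = mode_expectation \<gamma> e x * (u - comp_along e u)"
    and "u \<in> V \<Longrightarrow> ip u e = 0 \<Longrightarrow> mode_expectation \<gamma> e (x * star u) = mode_expectation \<gamma> e x * star u"
proof -
  note p = unit_projections[OF e]
  have eV: "e \<in> V" using e by (simp add: unit_def)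
  have \<gamma>p: "positive_unital \<gamma>" and \<gamma>m: "\<gamma> (x * y) = \<gamma> x * \<gamma> y" for x y
    using \<gamma> by (auto simp: star_hom_def)
  note \<gamma>c = positive_unital_clinear[OF \<gamma>p]
  have PP: "e * star e * (e * star e) = e * star e" using p by (metis mult.assoc)
  show "positive_unital (mode_expectation \<gamma> e)"
    unfolding positive_unital_def
  proof (intro conjI allI impI)
    show "clinear_map (mode_expectation \<gamma> e)"
      unfolding clinear_map_def mode_expectation_def
      by (simp add: clinear_map_add[OF \<gamma>c] clinear_map_scaleC[OF \<gamma>c] algebra_simps
          mult_scaleC_left mult_scaleC_right scaleC_add_right)
    show "mode_expectation \<gamma> e 1 = 1"
      by (simp add: mode_expectation_def positive_unital_one[OF \<gamma>p] PP p(3))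
    fix x :: 'b assume x: "pos x"
    then have "pos (\<gamma> x)" using \<gamma>p by (simp add: positive_unital_def)
    then show "pos (mode_expectation \<gamma> e x)"
      unfolding mode_expectation_def
      using pos_conj[OF x, of "e * star e"] pos_conj[of "\<gamma> x" e]
      by (intro pos_add) (simp_all add: star_mult)
  qed
  show "mode_expectation \<gamma> e (x * u) = mode_expectation \<gamma> e x * (u - comp_along e u)" if u: "u \<in> V"
  proof -
    define w where "w = u - comp_along e u"
    have w: "w \<in> V" "ip w e = 0" unfolding w_def using orthogonal_part[OF e u] by auto
    note a = orthogonal_anticommute[OF w(1) eV w(2)] and c = orthogonal_commute[OF w(1) eV w(2)]
    have uw: "u = w + ip u e *\<^sub>C e" by (simp add: w_def comp_along_def)
    \<comment> \<open>The \<open>e\<close>-component of \<open>u\<close> disappears in both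
      summands, because \<open>e * e = 0\<close>.\<close>
    have "e * (e * star e) = 0" using p by (simp flip: mult.assoc)
    then have 1: "u * (e * star e) = e * star e * w"
      by (subst uw) (simp add: distrib_right mult_scaleC_left c mult.assoc)
    have 2: "\<gamma> u * e = e * w"
      unfolding \<gamma>(2)[OF u] by (subst uw) (simp add: algebra_simps mult_scaleC_left p a)
    have "mode_expectation \<gamma> e (x * u) = e * star e * x * (u * (e * star e)) + star e * \<gamma> x * (\<gamma> u * e)"
      by (simp add: mode_expectation_def \<gamma>m mult.assoc)
    also have "\<dots> = mode_expectation \<gamma> e x * w"
      unfolding 1 2 by (simp add: mode_expectation_def algebra_simps)
    finally show ?thesis by (simp add: w_def)
  qed
  show "mode_expectation \<gamma> e (x * star u) = mode_expectation \<gamma> e x * star u"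
    if u: "u \<in> V" "ip u e = 0"
  proof -
    note a = orthogonal_anticommute[OF u(1) eV u(2)] and c = orthogonal_commute[OF u(1) eV u(2)]
    have 2: "\<gamma> (star u) * e = e * star u"
      using a by (simp add: positive_unital_star[OF \<gamma>p] \<gamma>(2)[OF u(1)])
    have "mode_expectation \<gamma> e (x * star u) =
        e * star e * x * (star u * (e * star e)) + star e * \<gamma> x * (\<gamma> (star u) * e)"
      by (simp add: mode_expectation_def \<gamma>m mult.assoc)
    also have "\<dots> = mode_expectation \<gamma> e x * star u"
      unfolding c(3) 2 by (simp add: mode_expectation_def algebra_simps)
    finally show ?thesis .
  qed
qed

text \<open>Gram-Schmidt in disguise: the induction carries along the residue \<open>r u\<close> of
  \<open>u\<close> after the modes traced out so far. The next mode is the normalized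
  \<open>r f\<close>, or none if \<open>r f = 0\<close>. All modes lie in \<open>W'\<close>, so
  multiplication by \<open>W\<close> is never affected.\<close>

lemma finite_expectation:
  assumes W: "W \<subseteq> V" and W': "W' \<subseteq> V" "\<And>x y. x \<in> W' \<Longrightarrow> y \<in> W' \<Longrightarrow> x - y \<in> W'"
      "\<And>z x. x \<in> W' \<Longrightarrow> z *\<^sub>C x \<in> W'"
    and orth: "\<And>w w'. w \<in> W \<Longrightarrow> w' \<in> W' \<Longrightarrow> ip w w' = 0"
    and F: "finite F" "F \<subseteq> W'"
  obtains T where "positive_unital T" "\<And>x w. w \<in> W \<Longrightarrow> T (x * w) = T x * w"
    "\<And>x w. w \<in> W \<Longrightarrow> T (x * star w) = T x * star w" "\<And>x f. f \<in> F \<Longrightarrow> T (x * f) = 0"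
proof -
  obtain \<gamma> where \<gamma>: "star_hom \<gamma>" "\<And>v. v \<in> V \<Longrightarrow> \<gamma> v = - v"
    using parity_exists star_automorphism_star_hom by metis
  have "\<exists>T r. positive_unital T \<and> (\<forall>x. \<forall>w\<in>W. T (x * w) = T x * w \<and> T (x * star w) = T x * star w) \<and>
     (\<forall>u\<in>W'. r u \<in> W' \<and> (\<forall>x. T (x * u) = T x * r u)) \<and> (\<forall>f\<in>F. r f = 0)"
    using F
  proof (induction F rule: finite_induct)
    case empty
    have "positive_unital (\<lambda>z::'b. z)" by (simp add: positive_unital_def clinear_map_def)
    then show ?case by (intro exI[of _ "\<lambda>z. z"]) auto
  next
    case (insert f F)
    then obtain T r where "positive_unital T \<and> (\<forall>x. \<forall>w\<in>W. T (x * w) = T x * w \<and> T (x * star w) = T x * star w) \<and>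
     (\<forall>u\<in>W'. r u \<in> W' \<and> (\<forall>x. T (x * u) = T x * r u)) \<and> (\<forall>f\<in>F. r f = 0)" by auto
    then have T: "positive_unital T" "\<And>x w. w \<in> W \<Longrightarrow> T (x * w) = T x * w"
      "\<And>x w. w \<in> W \<Longrightarrow> T (x * star w) = T x * star w"
      "\<And>u. u \<in> W' \<Longrightarrow> r u \<in> W'" "\<And>x u. u \<in> W' \<Longrightarrow> T (x * u) = T x * r u" "\<And>f. f \<in> F \<Longrightarrow> r f = 0"
      by blast+
    show ?case
    proof (cases "r f = 0")
      case True
      then show ?thesis using T by (intro exI[of _ T] exI[of _ r]) auto
    next
      case False
      have rf: "r f \<in> W'" "r f \<in> V" using T(4) insert.prems W' by auto
      obtain s where s: "s > 0" "ip (r f) (r f) = complex_of_real (s\<^sup>2)" "unit (complex_of_real (1/s) *\<^sub>C r f)"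
        using normalize[OF rf(2) False] by metis
      define e where "e = complex_of_real (1/s) *\<^sub>C r f"
      have e: "unit e" "e \<in> W'" "e \<in> V" using s rf W' V_scale by (auto simp: e_def)
      note m = mode_expectation[OF \<gamma> e(1)]
      have ce: "comp_along e w = 0" "ip w e = 0" if "w \<in> W" for w
        using orth[OF that e(2)] by (auto simp: comp_along_def)
      have c0: "comp_along e (r f) = r f"
        using s(1) by (simp add: comp_along_def e_def ip_scale_right rf s(2) scaleC_scaleC power2_eq_square
           flip: of_real_mult)
      have cz: "comp_along e 0 = 0"
        using ip_scale_left[OF V_zero e(3), of 0] by (simp add: comp_along_def)
      show ?thesis
      proof (rule exI[of _ "\<lambda>x. mode_expectation \<gamma> e (T x)"],
          rule exI[of _ "\<lambda>u. r u - comp_along e (r u)"], intro conjI ballI allI)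
        show "positive_unital (\<lambda>x. mode_expectation \<gamma> e (T x))"
          by (rule positive_unital_compose[OF m(1) T(1)])
        show "mode_expectation \<gamma> e (T (x * w)) = mode_expectation \<gamma> e (T x) * w"
          "mode_expectation \<gamma> e (T (x * star w)) = mode_expectation \<gamma> e (T x) * star w" if "w \<in> W" for x w
          using that T(2,3) m(2,3) ce W by (auto simp: subset_iff)
        show "r u - comp_along e (r u) \<in> W'" if "u \<in> W'" for u
          unfolding comp_along_def by (intro W' T that e)
        show "mode_expectation \<gamma> e (T (x * u)) = mode_expectation \<gamma> e (T x) * (r u - comp_along e (r u))"
          if "u \<in> W'" for x u
          using T(4,5)[OF that] m(2) W' by auto
        show "r u - comp_along e (r u) = 0" if "u \<in> insert f F" for u
          using that T(6) c0 cz by auto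
      qed
    qed
  qed
  then show ?thesis using that F(2) by (metis mult_zero_right subsetD)
qed

text \<open>By \<open>step\<close>, the limit for \<open>x * u\<close> is determined by the limit
  for \<open>x\<close> as soon as \<open>F\<close> contains the \<open>W'\<close>-component of
  \<open>u\<close>; adjoints give the same on the left. The resulting rules compute
  \<open>\<nu>\<close> on all normally ordered elements, and an automorphism that fixes
  \<open>W\<close> and preserves \<open>W'\<close> does not change what they compute.\<close>

theorem expectation_exists:
  assumes W: "W \<subseteq> V" and W': "W' \<subseteq> V" "\<And>x y. x \<in> W' \<Longrightarrow> y \<in> W' \<Longrightarrow> x - y \<in> W'"
      "\<And>z x. x \<in> W' \<Longrightarrow> z *\<^sub>C x \<in> W'"
    and orth: "\<And>w w'. w \<in> W \<Longrightarrow> w' \<in> W' \<Longrightarrow> ip w w' = 0"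
    and split: "\<And>v. v \<in> V \<Longrightarrow> \<exists>w\<in>W. \<exists>w'\<in>W'. v = w + w'"
  obtains \<nu> where "conditional_expectation \<nu>" "range \<nu> \<subseteq> cstar_generated W"
    "\<And>x w w'. w \<in> W \<Longrightarrow> w' \<in> W' \<Longrightarrow> \<nu> (x * (w + w')) = \<nu> x * w"
    "\<And>x w w'. w \<in> W \<Longrightarrow> w' \<in> W' \<Longrightarrow> \<nu> (star (w + w') * x) = star w * \<nu> x"
    "\<And>\<alpha> x. star_automorphism \<alpha> \<Longrightarrow> (\<And>w. w \<in> W \<Longrightarrow> \<alpha> w = w) \<Longrightarrow> (\<And>w'. w' \<in> W' \<Longrightarrow> \<alpha> w' \<in> W')
       \<Longrightarrow> \<nu> (\<alpha> x) = \<nu> x"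
proof -
  define Q where "Q = (\<lambda>F T. positive_unital T \<and> (\<forall>x. \<forall>w\<in>W. T (x * w) = T x * w \<and> T (x * star w) = T x * star w) \<and>
      (\<forall>x. finite F \<longrightarrow> F \<subseteq> W' \<longrightarrow> (\<forall>f\<in>F. T (x * f) = 0)))"
  have "\<exists>T. Q F T" for F
  proof -
    \<comment> \<open>Sets outside the net are replaced by the empty set, so that the choice of
      \<open>T\<close> is total.\<close>
    define F' where "F' = (if finite F \<and> F \<subseteq> W' then F else {})"
    have F': "finite F'" "F' \<subseteq> W'" by (auto simp: F'_def)
    obtain T where "positive_unital T" "\<And>x w. w \<in> W \<Longrightarrow> T (x * w) = T x * w"
    "\<And>x w. w \<in> W \<Longrightarrow> T (x * star w) = T x * star w" "\<And>x f. f \<in> F' \<Longrightarrow> T (x * f) = 0"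
      using finite_expectation[OF W W' orth F'] by blast
    then show ?thesis unfolding Q_def by (intro exI[of _ T]) (auto simp: F'_def)
  qed
  then obtain T where "Q F (T F)" for F by metis
  then have Tp: "positive_unital (T F)"
    and Tw: "w \<in> W \<Longrightarrow> T F (x * w) = T F x * w" "w \<in> W \<Longrightarrow> T F (x * star w) = T F x * star w"
    and Tf: "finite F \<Longrightarrow> F \<subseteq> W' \<Longrightarrow> f \<in> F \<Longrightarrow> T F (x * f) = 0" for F x w f
    by (auto simp: Q_def)
  note Tc = positive_unital_clinear[OF Tp]
  let ?N = "finite_subsets_at_top W'"
  have N: "?N \<noteq> bot" by simp
  have step: "((\<lambda>F. T F (x * u)) \<longlongrightarrow> l * w) ?N"
    if l: "((\<lambda>F. T F x) \<longlongrightarrow> l) ?N" and w: "w \<in> W" "w' \<in> W'" "u = w + w'" for x u l w w'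
  proof (rule Lim_transform_eventually[OF tendsto_mult_right[OF l]])
    have "\<forall>\<^sub>F F in ?N. finite F \<and> F \<subseteq> W' \<and> w' \<in> F"
      unfolding eventually_finite_subsets_at_top using w by (intro exI[of _ "{w'}"]) auto
    then show "\<forall>\<^sub>F F in ?N. T F x * w = T F (x * u)"
      by eventually_elim (simp add: w(3) distrib_left clinear_map_add[OF Tc] Tw(1)[OF w(1)] Tf)
  qed
  \<comment> \<open>Adjoints turn the rule for right factors into one for left factors.\<close>
  have star_lim: "((\<lambda>F. T F (star x)) \<longlongrightarrow> star l) ?N" if "((\<lambda>F. T F x) \<longlongrightarrow> l) ?N" for x l
    using tendsto_star[OF that] by (simp add: positive_unital_star[OF Tp])
  have "\<exists>l. ((\<lambda>F. T F x) \<longlongrightarrow> l) ?N" for x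
  proof (rule normal_ordered_dense)
    show "closed {x. \<exists>l. ((\<lambda>F. T F x) \<longlongrightarrow> l) ?N}"
      by (intro pointwise_limit_closed clinear_map_linear Tc positive_unital_norm Tp N)
    show "\<exists>l. ((\<lambda>F. T F x) \<longlongrightarrow> l) ?N" if "x \<in> normal_ordered" for x
      using that
    proof (induction rule: normal_ordered.induct)
      case one
      show ?case by (auto simp: positive_unital_one[OF Tp])
    next
      case (add x y)
      then show ?case by (auto simp: clinear_map_add[OF Tc] intro: tendsto_add)
    next
      case (scale x z)
      then show ?case by (auto simp: clinear_map_scaleC[OF Tc] intro: tendsto_scaleC)
    next
      case (right x u)
      then show ?case using split[OF right(2)] step by blast
    next
      case (left x u)
      then obtain l w w' where l: "((\<lambda>F. T F x) \<longlongrightarrow> l) ?N" and w: "w \<in> W" "w' \<in> W'" "u = w + w'"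
        using split[OF left(2)] by blast
      show ?case using star_lim[OF step[OF star_lim[OF l] w]] by (auto simp: star_mult)
    qed
  qed
  then obtain \<nu> where lim: "((\<lambda>F. T F x) \<longlongrightarrow> \<nu> x) ?N" for x by metis
  have p: "positive_unital \<nu>" by (rule positive_unital_limit[OF Tp N lim])
  note c = positive_unital_clinear[OF p] and st = positive_unital_star[OF p]
    and cont = positive_unital_continuous[OF p]
  have nu_right: "\<nu> (x * (w + w')) = \<nu> x * w" if "w \<in> W" "w' \<in> W'" for x w w'
    by (rule tendsto_unique[OF N lim step[OF lim that refl]])
  have nu_left: "\<nu> (star (w + w') * x) = star w * \<nu> x" if "w \<in> W" "w' \<in> W'" for x w w'
    using nu_right[OF that, of "star x"] st[of "star x * (w + w')"] by (simp add: star_mult st)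
  have right_star: "\<nu> (x * star w) = \<nu> x * star w" if "w \<in> W" for x w
    by (rule tendsto_unique[OF N lim]) (simp add: Tw(2)[OF that] tendsto_mult_right lim)
  have right_W: "\<nu> (x * w) = \<nu> x * w" if "w \<in> W" for x w
    by (rule tendsto_unique[OF N lim]) (simp add: Tw(1)[OF that] tendsto_mult_right lim)
  have left_W: "\<nu> (w * x) = w * \<nu> x" "\<nu> (star w * x) = star w * \<nu> x" if "w \<in> W" for x w
    using right_star[OF that, of "star x"] st[of "star x * star w"]
      right_W[OF that, of "star x"] st[of "star x * w"] by (simp_all add: star_mult st)
  let ?A = "cstar_generated W"
  have A: "unital_cstar_subalgebra ?A" by (rule unital_cstar_subalgebra_generated)
  have "W \<subseteq> ?A" by (rule cstar_generated_superset)
  have inA: "\<nu> x \<in> ?A" for x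
  proof (rule normal_ordered_dense[where P = "\<lambda>x. \<nu> x \<in> ?A"])
    show "closed {x. \<nu> x \<in> ?A}"
      using continuous_closed_vimage[of ?A \<nu>] A cont
      by (simp add: unital_cstar_subalgebra_def vimage_def continuous_on_eq_continuous_at)
    show "\<nu> x \<in> ?A" if "x \<in> normal_ordered" for x
      using that
    proof (induction rule: normal_ordered.induct)
      case one
      show ?case using A by (simp add: positive_unital_one[OF p] unital_cstar_subalgebra_def)
    next
      case (add x y)
      then show ?case using A by (simp add: clinear_map_add[OF c] unital_cstar_subalgebra_def)
    next
      case (scale x z)
      then show ?case using A by (simp add: clinear_map_scaleC[OF c] unital_cstar_subalgebra_def)
    next
      case (right x u)
      obtain w w' where w: "w \<in> W" "w' \<in> W'" "u = w + w'" using split[OF right(2)] by blast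
      then have "w \<in> ?A" using \<open>W \<subseteq> ?A\<close> by auto
      then show ?case using A right(3) nu_right w
        by (simp add: unital_cstar_subalgebra_def)
    next
      case (left x u)
      obtain w w' where w: "w \<in> W" "w' \<in> W'" "u = w + w'" using split[OF left(2)] by blast
      then have "w \<in> ?A" using \<open>W \<subseteq> ?A\<close> by auto
      then show ?case using A left(3) nu_left w
        by (simp add: unital_cstar_subalgebra_def)
    qed
  qed
  then have range: "range \<nu> \<subseteq> ?A" by auto
  \<comment> \<open>The elements that \<open>\<nu>\<close> lets pass on both sides form a unital
    C*-subalgebra. It contains \<open>W\<close>, hence all of \<open>?A\<close>, into which
    \<open>\<nu>\<close> maps; this gives the defining identities of a conditional
    expectation.\<close>
  have "unital_cstar_subalgebra {y. \<forall>x. \<nu> (x * y) = \<nu> x * y \<and> \<nu> (y * x) = y * \<nu> x}" (is "unital_cstar_subalgebra ?B")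
    unfolding unital_cstar_subalgebra_def
  proof (intro conjI ballI allI)
    have *: "continuous_on UNIV (\<lambda>y. \<nu> (f y))" if "continuous_on UNIV f" for f :: "'b \<Rightarrow> 'b"
      using continuous_on_compose2[OF cont that] by simp
    show "closed ?B"
      by (intro closed_Collect_all closed_Collect_conj closed_Collect_eq continuous_intros *)
    show "1 \<in> ?B" by simp
    fix y assume y: "y \<in> ?B"
    show "z *\<^sub>C y \<in> ?B" for z
      using y by (simp add: mult_scaleC_left mult_scaleC_right clinear_map_scaleC[OF c])
    have "\<nu> (x * star y) = star (\<nu> (y * star x))" "\<nu> (star y * x) = star (\<nu> (star x * y))" for x
      by (simp_all add: star_mult flip: st)
    then show "star y \<in> ?B" using y by (simp add: star_mult st)
    fix x assume x: "x \<in> ?B"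
    show "x + y \<in> ?B" using x y by (simp add: distrib_left distrib_right clinear_map_add[OF c])
    show "x * y \<in> ?B" using x y by (simp add: mult.assoc) (simp flip: mult.assoc)
  qed
  then have "?A \<subseteq> ?B" by (rule cstar_generated_least) (auto simp: right_W left_W)
  then have bimod: "\<nu> (x * y) = \<nu> x * y" "\<nu> (y * x) = y * \<nu> x" if "y \<in> ?A" for x y
    using that by auto
  have idem: "\<nu> y = y" if "y \<in> ?A" for y using bimod(1)[OF that, of 1] positive_unital_one[OF p] by simp
  have "conditional_expectation \<nu>"
    unfolding conditional_expectation_def positive_element_iff_pos
    using p by (simp add: positive_unital_def bimod inA)
  moreover have "\<nu> (\<alpha> x) = \<nu> x"
    if \<alpha>: "star_automorphism \<alpha>" and fW: "\<And>w. w \<in> W \<Longrightarrow> \<alpha> w = w" and fW': "\<And>w'. w' \<in> W' \<Longrightarrow> \<alpha> w' \<in> W'"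
    for \<alpha> x
  proof (rule normal_ordered_dense[where P = "\<lambda>x. \<nu> (\<alpha> x) = \<nu> x"])
    have ap: "positive_unital \<alpha>" and am: "\<alpha> (x * y) = \<alpha> x * \<alpha> y" for x y
      using star_automorphism_star_hom[OF \<alpha>] by (auto simp: star_hom_def)
    note ac = positive_unital_clinear[OF ap]
    show "closed {x. \<nu> (\<alpha> x) = \<nu> x}"
      by (rule closed_Collect_eq[OF positive_unital_continuous[OF positive_unital_compose[OF p ap]] cont])
    show "\<nu> (\<alpha> x) = \<nu> x" if "x \<in> normal_ordered" for x
      using that
    proof (induction rule: normal_ordered.induct)
      case one
      show ?case by (simp add: positive_unital_one[OF ap])
    next
      case (add x y)
      then show ?case by (simp add: clinear_map_add[OF ac] clinear_map_add[OF c])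
    next
      case (scale x z)
      then show ?case by (simp add: clinear_map_scaleC[OF ac] clinear_map_scaleC[OF c])
    next
      case (right x u)
      obtain w w' where w: "w \<in> W" "w' \<in> W'" "u = w + w'" using split[OF right(2)] by blast
      have "\<alpha> (x * u) = \<alpha> x * (w + \<alpha> w')" by (simp add: am w(3) clinear_map_add[OF ac] fW w(1))
      then show ?case using right(3) nu_right w fW'
        by simp
    next
      case (left x u)
      obtain w w' where w: "w \<in> W" "w' \<in> W'" "u = w + w'" using split[OF left(2)] by blast
      have "\<alpha> (star u * x) = star (w + \<alpha> w') * \<alpha> x"
        by (simp add: am w(3) clinear_map_add[OF ac] fW w(1) positive_unital_star[OF ap])
      then show ?case
        using left(3) nu_left w fW'
        by simp
    qed
  qed
  ultimately show ?thesis using that range nu_right nu_left by blast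
qed

end

section \<open>Smooth maps\<close>

text \<open>Openness of \<open>X\<close> matters, as \<open>frechet_derivative\<close> at a point
  depends on the values in a neighbourhood.\<close>

lemma Ck_on_cong:
  assumes "open X" "\<And>x. x \<in> X \<Longrightarrow> f x = g x"
  shows "Ck_on k X f \<longleftrightarrow> Ck_on k X g"
proof -
  have *: "Ck_on k X f \<Longrightarrow> (\<And>x. x \<in> X \<Longrightarrow> f x = g x) \<Longrightarrow> Ck_on k X g" for f g :: "'a \<Rightarrow> 'b"
  proof (induction k arbitrary: f g)
    case 0
    have "continuous_on X g"
      by (rule continuous_on_eq[OF "0.prems"(1)[unfolded Ck_on.simps(1)] "0.prems"(2)])
    then show ?case by (simp only: Ck_on.simps)
  next
    case (Suc k)
    have d: "(g has_derivative frechet_derivative f (at x)) (at x)" if "x \<in> X" for x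
      by (rule has_derivative_transform_within_open[OF _ assms(1) that Suc.prems(2)])
         (use Suc.prems(1) that in \<open>auto simp: frechet_derivative_works\<close>)
    have eq: "frechet_derivative f (at x) = frechet_derivative g (at x)" if "x \<in> X" for x
      by (rule frechet_derivative_at[OF d[OF that]])
    have df: "Ck_on k X (\<lambda>x. frechet_derivative f (at x) v)" for v
      using Suc.prems(1) unfolding Ck_on.simps by blast
    have "Ck_on k X (\<lambda>x. frechet_derivative g (at x) v)" for v
      by (rule Suc.IH[OF df[of v]]) (simp only: eq)
    moreover have "g differentiable (at x)" if "x \<in> X" for x
      using d[OF that] differentiable_def by blast
    ultimately show ?case unfolding Ck_on.simps by blast
  qed
  show ?thesis using *[of f g, OF _ assms(2)] *[of g f, OF _ assms(2)[symmetric]] by blast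
qed

text \<open>Allows a derivative obtained from the usual rules in place of the choice operator behind
  \<open>frechet_derivative\<close>.\<close>

lemma Ck_on_SucI:
  assumes X: "open X" and D: "\<And>x. x \<in> X \<Longrightarrow> (f has_derivative D x) (at x)"
    and k: "\<And>v. Ck_on k X (\<lambda>x. D x v)"
  shows "Ck_on (Suc k) X f"
proof -
  have "frechet_derivative f (at x) = D x" if "x \<in> X" for x
    using frechet_derivative_at[OF D[OF that]] by simp
  then have "Ck_on k X (\<lambda>x. frechet_derivative f (at x) v)" for v
    by (intro iffD1[OF Ck_on_cong[OF X] k[of v]]) simp
  then show ?thesis using D by (auto simp: differentiable_def)
qed

lemma Ck_on_SucD:
  assumes "Ck_on (Suc k) X f"
  shows "\<And>x. x \<in> X \<Longrightarrow> (f has_derivative frechet_derivative f (at x)) (at x)"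
    and "\<And>v. Ck_on k X (\<lambda>x. frechet_derivative f (at x) v)"
  using assms by (auto simp: frechet_derivative_works)

lemma Ck_on_Suc_imp: "Ck_on (Suc k) X f \<Longrightarrow> Ck_on k X f"
proof (induction k arbitrary: f)
  case 0
  then show ?case
    by (auto intro!: continuous_at_imp_continuous_on differentiable_imp_continuous_within)
next
  case (Suc k)
  then show ?case by (metis Ck_on.simps(2))
qed

lemma Ck_on_subset: "Ck_on k X f \<Longrightarrow> Y \<subseteq> X \<Longrightarrow> Ck_on k Y f"
  by (induction k arbitrary: f) (auto intro: continuous_on_subset)

text \<open>For functions given by different formulas near different points, such as bump functions
  extended by zero.\<close>

lemma Ck_on_local:
  assumes "open X" "\<And>x. x \<in> X \<Longrightarrow> \<exists>U. open U \<and> x \<in> U \<and> Ck_on k (X \<inter> U) f"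
  shows "Ck_on k X f"
  using assms(2)
proof (induction k arbitrary: f)
  case 0
  have "isCont f x" if x: "x \<in> X" for x
  proof -
    obtain U where "open U" "x \<in> U" "continuous_on (X \<inter> U) f" using "0.prems"[OF x] by auto
    then show ?thesis using assms(1) x by (simp add: continuous_on_eq_continuous_at open_Int)
  qed
  then show ?case by (simp add: continuous_at_imp_continuous_on)
next
  case (Suc k)
  have "f differentiable (at x)" if "x \<in> X" for x
    using Suc.prems[OF that] that by auto
  moreover have "Ck_on k X (\<lambda>x. frechet_derivative f (at x) v)" for v
  proof (rule Suc.IH)
    fix x assume "x \<in> X"
    then obtain U where "open U" "x \<in> U" "Ck_on (Suc k) (X \<inter> U) f" using Suc.prems by blast
    then show "\<exists>U. open U \<and> x \<in> U \<and> Ck_on k (X \<inter> U) (\<lambda>x. frechet_derivative f (at x) v)"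
      by auto
  qed
  ultimately show ?case by auto
qed

lemma Ck_on_const: "open X \<Longrightarrow> Ck_on k X (\<lambda>x. c)"
proof (induction k arbitrary: c)
  case (Suc k)
  then show ?case by (intro Ck_on_SucI[where D = "\<lambda>x v. 0"]) auto
qed simp

lemma Ck_on_add:
  assumes "open X" shows "Ck_on k X f \<Longrightarrow> Ck_on k X g \<Longrightarrow> Ck_on k X (\<lambda>x. f x + g x)"
proof (induction k arbitrary: f g)
  case (Suc k)
  show ?case
    by (rule Ck_on_SucI[OF assms has_derivative_add[OF Ck_on_SucD(1)[OF Suc.prems(1)] Ck_on_SucD(1)[OF Suc.prems(2)]]])
       (auto intro: Suc.IH Ck_on_SucD(2)[OF Suc.prems(1)] Ck_on_SucD(2)[OF Suc.prems(2)])
qed (auto intro: continuous_on_add)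

lemma Ck_on_bounded_linear:
  assumes "open X" and L: "bounded_linear L" shows "Ck_on k X f \<Longrightarrow> Ck_on k X (\<lambda>x. L (f x))"
proof (induction k arbitrary: f)
  case (Suc k)
  show ?case
    by (rule Ck_on_SucI[OF assms(1) bounded_linear.has_derivative[OF L Ck_on_SucD(1)[OF Suc.prems]]])
       (auto intro: Suc.IH Ck_on_SucD(2)[OF Suc.prems])
qed (simp add: bounded_linear.continuous_on[OF L])

lemma Ck_on_bilinear:
  assumes "open X" and B: "bounded_bilinear B"
  shows "Ck_on k X f \<Longrightarrow> Ck_on k X g \<Longrightarrow> Ck_on k X (\<lambda>x. B (f x) (g x))"
proof (induction k arbitrary: f g)
  case (Suc k)
  note f = Suc.prems(1) and g = Suc.prems(2)
  show ?case
    by (rule Ck_on_SucI[OF assms(1) bounded_bilinear.FDERIV[OF B Ck_on_SucD(1)[OF f] Ck_on_SucD(1)[OF g]]])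
       (auto intro!: Ck_on_add assms(1) Suc.IH Ck_on_SucD(2)[OF f] Ck_on_SucD(2)[OF g] Ck_on_Suc_imp[OF f] Ck_on_Suc_imp[OF g])
qed (simp add: bounded_bilinear.continuous_on[OF B])

text \<open>The outer function comes with the sequence of all its derivatives. With \<open>n\<close>
  generalized, the induction step differentiates once and applies the product rule.\<close>

lemma Ck_on_compose_real:
  fixes G :: "nat \<Rightarrow> real \<Rightarrow> real"
  assumes X: "open X" and G: "\<And>n t. (G n has_real_derivative G (Suc n) t) (at t)"
  shows "Ck_on k X g \<Longrightarrow> Ck_on k X (\<lambda>x. G n (g x))"
proof (induction k arbitrary: n)
  case 0
  have "continuous_on UNIV (G n)"
    using G DERIV_isCont continuous_at_imp_continuous_on by blast
  then show ?case using 0 by (auto intro: continuous_on_compose2)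
next
  case (Suc k)
  note g = Suc.prems
  show ?case
  proof (rule Ck_on_SucI[OF X])
    show "((\<lambda>x. G n (g x)) has_derivative (\<lambda>v. G (Suc n) (g x) * frechet_derivative g (at x) v)) (at x)"
      if "x \<in> X" for x
      using has_derivative_compose[OF Ck_on_SucD(1)[OF g that], of "G n"] G[of n "g x"]
      by (simp add: has_field_derivative_def)
    show "Ck_on k X (\<lambda>x. G (Suc n) (g x) * frechet_derivative g (at x) v)" for v
      by (rule Ck_on_bilinear[OF X bounded_bilinear_mult Suc.IH[OF Ck_on_Suc_imp[OF g]] Ck_on_SucD(2)[OF g]])
  qed
qed

text \<open>A family closed under differentiation which contains \<open>exp (- (1 / t))\<close>
  extended by zero.\<close>

definition flat_exp :: "real poly \<Rightarrow> real \<Rightarrow> real" where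
  "flat_exp p t = (if t > 0 then poly p (1 / t) * exp (- (1 / t)) else 0)"

lemma poly_times_exp_neg_tendsto_0: "((\<lambda>x::real. poly p x * exp (- x)) \<longlongrightarrow> 0) at_top"
proof -
  have "((\<lambda>x::real. \<Sum>i\<le>degree p. coeff p i * (x ^ i / exp x)) \<longlongrightarrow> (\<Sum>i\<le>degree p. coeff p i * 0)) at_top"
    by (intro tendsto_sum tendsto_mult tendsto_const tendsto_power_div_exp_0)
  then show ?thesis by (simp add: poly_altdef sum_divide_distrib exp_minus field_simps)
qed

text \<open>For \<open>t > 0\<close> the derivative of \<open>1 / t\<close> contributes
  \<open>monom 1 2\<close> up to sign, and \<open>p - pderiv p\<close> comes from the product rule.
  At 0 the right difference quotient is again a polynomial in \<open>1 / h\<close> times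
  \<open>exp (- (1 / h))\<close>, which tends to 0.\<close>

lemma flat_exp_deriv:
  "(flat_exp p has_real_derivative flat_exp (monom 1 2 * (p - pderiv p)) t) (at t)"
proof -
  consider "t < 0" | "t > 0" | "t = 0" by linarith
  then show ?thesis
  proof cases
    case 1
    have "((\<lambda>t. 0) has_real_derivative 0) (at t)" by simp
    then have "(flat_exp p has_real_derivative 0) (at t)"
      by (rule has_field_derivative_transform_within_open[where S = "{..<0}"])
         (use 1 in \<open>auto simp: flat_exp_def\<close>)
    then show ?thesis using 1 by (simp add: flat_exp_def)
  next
    case 2
    have "((\<lambda>t. poly p (1 / t) * exp (- (1 / t))) has_real_derivative
        poly (monom 1 2 * (p - pderiv p)) (1 / t) * exp (- (1 / t))) (at t)"
      using 2 by (auto intro!: derivative_eq_intros poly_DERIV[THEN DERIV_chain2]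
          simp: poly_monom power2_eq_square field_simps)
    then have "(flat_exp p has_real_derivative
        poly (monom 1 2 * (p - pderiv p)) (1 / t) * exp (- (1 / t))) (at t)"
      by (rule has_field_derivative_transform_within_open[where S = "{0<..}"])
         (use 2 in \<open>auto simp: flat_exp_def\<close>)
    then show ?thesis using 2 by (simp add: flat_exp_def)
  next
    case 3
    have "((\<lambda>h. poly ([:0, 1:] * p) (inverse h) * exp (- inverse h)) \<longlongrightarrow> 0) (at_right (0::real))"
      by (rule filterlim_compose[OF poly_times_exp_neg_tendsto_0 filterlim_inverse_at_top_right])
    then have "((\<lambda>h. flat_exp p h / h) \<longlongrightarrow> 0) (at_right (0::real))"
      by (rule Lim_transform_eventually)
         (auto simp: eventually_at_right_less flat_exp_def divide_inverse mult.commute mult.left_commute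
           eventually_at_filter)
    moreover have "((\<lambda>h. flat_exp p h / h) \<longlongrightarrow> 0) (at_left (0::real))"
      by (rule tendsto_eventually) (auto simp: eventually_at_filter flat_exp_def)
    ultimately have "((\<lambda>h. flat_exp p h / h) \<longlongrightarrow> 0) (at 0)"
      using filterlim_at_split by blast
    then show ?thesis using 3 by (simp add: DERIV_def flat_exp_def)
  qed
qed

definition flat :: "real \<Rightarrow> real" where "flat = flat_exp 1"

lemma Ck_on_flat: "open X \<Longrightarrow> Ck_on k X g \<Longrightarrow> Ck_on k X (\<lambda>x. flat (g x))"
  using Ck_on_compose_real[where G = "\<lambda>n. flat_exp (((\<lambda>p. monom 1 2 * (p - pderiv p)) ^^ n) 1)" and n = 0 and X = X and k = k and g = g]
  by (simp add: flat_exp_deriv flat_def)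

lemma flat_bounds: "0 \<le> flat t" "flat t \<le> 1" "t \<le> 0 \<Longrightarrow> flat t = 0"
  by (auto simp: flat_def flat_exp_def)

text \<open>Dilation turns \<open>flat\<close> into a smooth approximation of the indicator of a
  half-line, hence of every set on which a smooth function is positive.\<close>

lemma flat_limit: "(\<lambda>n. flat (real n * t)) \<longlonglongrightarrow> (if t > 0 then 1 else 0)"
proof (cases "t > 0")
  case True
  have "(\<lambda>n. exp (- ((1 / t) * inverse (real n)))) \<longlonglongrightarrow> exp (- ((1 / t) * 0))"
    by (intro tendsto_intros lim_inverse_n)
  then have "(\<lambda>n. exp (- ((1 / t) * inverse (real n)))) \<longlonglongrightarrow> 1" by simp
  then have "(\<lambda>n. flat (real n * t)) \<longlonglongrightarrow> 1"
    by (rule Lim_transform_eventually)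
       (use True in \<open>auto intro!: eventually_sequentiallyI[of 1] simp: flat_def flat_exp_def field_simps\<close>)
  then show ?thesis using True by simp
next
  case False
  then have "flat (real n * t) = 0" for n by (intro flat_bounds) (simp add: mult_nonneg_nonpos)
  then show ?thesis using False by simp
qed

section \<open>Smooth functions on a manifold\<close>

lemma smooth_on_cong:
  assumes "open X" "\<And>x. x \<in> X \<Longrightarrow> f x = g x"
  shows "smooth_on X f \<longleftrightarrow> smooth_on X g"
  unfolding smooth_on_def using Ck_on_cong[OF assms(1), of f g] assms(2) by blast

lemma smooth_on_local:
  assumes "open X" "\<And>x. x \<in> X \<Longrightarrow> \<exists>U. open U \<and> x \<in> U \<and> smooth_on (X \<inter> U) f"
  shows "smooth_on X f"
  unfolding smooth_on_def using Ck_on_local[OF assms(1)] assms(2) smooth_on_def by metis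

lemma smooth_on_subset: "smooth_on X f \<Longrightarrow> Y \<subseteq> X \<Longrightarrow> smooth_on Y f"
  unfolding smooth_on_def using Ck_on_subset by blast

lemma smooth_on_continuous: "smooth_on X f \<Longrightarrow> continuous_on X f"
  unfolding smooth_on_def by (metis Ck_on.simps(1))

context
  fixes X :: "'a::real_normed_vector set"
  assumes X: "open X"
begin

lemma smooth_on_const: "smooth_on X (\<lambda>x. c)"
  unfolding smooth_on_def using Ck_on_const[OF X] by blast

lemma smooth_on_add: "smooth_on X f \<Longrightarrow> smooth_on X g \<Longrightarrow> smooth_on X (\<lambda>x. f x + g x)"
  unfolding smooth_on_def using Ck_on_add[OF X] by blast

lemma smooth_on_bounded_linear: "bounded_linear L \<Longrightarrow> smooth_on X f \<Longrightarrow> smooth_on X (\<lambda>x. L (f x))"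
  unfolding smooth_on_def using Ck_on_bounded_linear[OF X] by blast

lemma smooth_on_bilinear:
  "bounded_bilinear B \<Longrightarrow> smooth_on X f \<Longrightarrow> smooth_on X g \<Longrightarrow> smooth_on X (\<lambda>x. B (f x) (g x))"
  unfolding smooth_on_def using Ck_on_bilinear[OF X] by blast

lemma smooth_on_flat: "smooth_on X g \<Longrightarrow> smooth_on X (\<lambda>x. flat (g x))"
  unfolding smooth_on_def using Ck_on_flat[OF X] by blast

end

lemma chart_image_open:
  assumes "is_chart U \<phi>" "open W"
  shows "open (\<phi> ` (U \<inter> W))"
proof -
  have "openin (top_of_set (\<phi> ` U)) (\<phi> ` (U \<inter> W))"
    using assms by (intro homeomorphism_imp_open_map[of U _ \<phi> "inv_into U \<phi>"])
      (auto simp: is_chart_def openin_open_Int)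
  then show ?thesis using assms by (metis is_chart_def openin_open_eq openin_open_trans)
qed

lemma chart_inv: "is_chart U \<phi> \<Longrightarrow> m \<in> U \<Longrightarrow> inv_into U \<phi> (\<phi> m) = m"
  by (simp add: is_chart_def homeomorphism_def)

lemma smooth_map_onI:
  assumes "\<And>U \<phi>. (U, \<phi>) \<in> \<A> \<Longrightarrow> smooth_on (\<phi> ` (U \<inter> W)) (f \<circ> inv_into U \<phi>)"
  shows "smooth_map_on \<A> W f"
  using assms by (auto simp: smooth_map_on_def)

lemma smooth_map_onD: "smooth_map_on \<A> W f \<Longrightarrow> (U, \<phi>) \<in> \<A> \<Longrightarrow> smooth_on (\<phi> ` (U \<inter> W)) (f \<circ> inv_into U \<phi>)"
  by (auto simp: smooth_map_on_def)

lemma smooth_atlas_cover: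
  assumes "smooth_atlas \<A>"
  obtains U \<phi> where "(U, \<phi>) \<in> \<A>" "m \<in> U"
proof -
  have "m \<in> (\<Union>(U, \<phi>)\<in>\<A>. U)" using assms by (simp only: smooth_atlas_def) simp
  then show ?thesis using that by auto
qed

lemma smooth_atlas_transition:
  assumes "smooth_atlas \<A>" "(U, \<phi>) \<in> \<A>" "(V, \<eta>) \<in> \<A>"
  shows "smooth_on (\<phi> ` (U \<inter> V)) (\<eta> \<circ> inv_into U \<phi>)"
  using assms(1)[unfolded smooth_atlas_def] assms(2,3) by blast

lemma smooth_atlas_chart: "smooth_atlas \<A> \<Longrightarrow> (U, \<phi>) \<in> \<A> \<Longrightarrow> is_chart U \<phi>"
  by (auto simp: smooth_atlas_def)

context
  fixes \<A> :: "('m::t2_space, 'k::finite) chart set" and W :: "'m set"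
  assumes \<A>: "smooth_atlas \<A>" and W: "open W"
begin

lemma smooth_map_on_cong:
  assumes "smooth_map_on \<A> W f" "\<And>x. x \<in> W \<Longrightarrow> f x = g x"
  shows "smooth_map_on \<A> W g"
proof (rule smooth_map_onI)
  fix U \<phi> assume U: "(U, \<phi>) \<in> \<A>"
  then have ch: "is_chart U \<phi>" using smooth_atlas_chart \<A> by blast
  have "(f \<circ> inv_into U \<phi>) y = (g \<circ> inv_into U \<phi>) y" if "y \<in> \<phi> ` (U \<inter> W)" for y
    using that assms(2) chart_inv[OF ch] by auto
  then show "smooth_on (\<phi> ` (U \<inter> W)) (g \<circ> inv_into U \<phi>)"
    using smooth_on_cong[OF chart_image_open[OF ch W]] smooth_map_onD[OF assms(1) U] by blast
qed

lemma atlas_image_open: "(U, \<phi>) \<in> \<A> \<Longrightarrow> open (\<phi> ` (U \<inter> W))"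
  by (rule chart_image_open[OF smooth_atlas_chart[OF \<A>] W])

lemma smooth_map_on_const: "smooth_map_on \<A> W (\<lambda>x. c)"
  by (rule smooth_map_onI) (simp add: o_def smooth_on_const atlas_image_open)

lemma smooth_map_on_add:
  assumes "smooth_map_on \<A> W f" "smooth_map_on \<A> W g"
  shows "smooth_map_on \<A> W (\<lambda>x. f x + g x)"
  using smooth_on_add[OF atlas_image_open smooth_map_onD[OF assms(1)] smooth_map_onD[OF assms(2)]]
  by (intro smooth_map_onI) (simp add: o_def)

lemma smooth_map_on_bounded_linear:
  assumes "bounded_linear L" "smooth_map_on \<A> W f"
  shows "smooth_map_on \<A> W (\<lambda>x. L (f x))"
  using smooth_on_bounded_linear[OF atlas_image_open assms(1) smooth_map_onD[OF assms(2)]]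
  by (intro smooth_map_onI) (simp add: o_def)

lemma smooth_map_on_bilinear:
  assumes "bounded_bilinear B" "smooth_map_on \<A> W f" "smooth_map_on \<A> W g"
  shows "smooth_map_on \<A> W (\<lambda>x. B (f x) (g x))"
  using smooth_on_bilinear[OF atlas_image_open assms(1) smooth_map_onD[OF assms(2)] smooth_map_onD[OF assms(3)]]
  by (intro smooth_map_onI) (simp add: o_def)

lemma smooth_map_on_subset:
  assumes "smooth_map_on \<A> UNIV f" shows "smooth_map_on \<A> W f"
  using smooth_map_onD[OF assms] by (intro smooth_map_onI) (rule smooth_on_subset, auto)

lemma smooth_map_on_continuous:
  assumes "smooth_map_on \<A> W f"
  shows "continuous_on W f"
  unfolding continuous_on_eq_continuous_at[OF W]
proof
  fix m assume m: "m \<in> W"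
  obtain U \<phi> where U: "(U, \<phi>) \<in> \<A>" "m \<in> U" using smooth_atlas_cover[OF \<A>] .
  have ch: "is_chart U \<phi>" using smooth_atlas_chart \<A> U by blast
  have "continuous_on (U \<inter> W) ((f \<circ> inv_into U \<phi>) \<circ> \<phi>)"
  proof (rule continuous_on_compose)
    have "continuous_on U \<phi>" using ch by (simp add: is_chart_def homeomorphism_def)
    then show "continuous_on (U \<inter> W) \<phi>" by (rule continuous_on_subset) simp
    show "continuous_on (\<phi> ` (U \<inter> W)) (f \<circ> inv_into U \<phi>)"
      by (rule smooth_on_continuous[OF smooth_map_onD[OF assms U(1)]])
  qed
  then have "continuous_on (U \<inter> W) f"
    by (rule continuous_on_eq) (simp add: chart_inv[OF ch])
  moreover have "open (U \<inter> W)" using ch W by (auto simp: is_chart_def)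
  ultimately show "isCont f m" using U m by (simp add: continuous_on_eq_continuous_at)
qed

end

section \<open>Bump functions and generation of the Borel sets\<close>

definition chart_ball :: "'m set \<Rightarrow> ('m \<Rightarrow> real ^ 'k::finite) \<Rightarrow> real ^ 'k \<Rightarrow> real \<Rightarrow> 'm set" where
  "chart_ball U \<phi> x r = {m \<in> U. \<phi> m \<in> ball x r}"

text \<open>The bounds 0 and 1 serve dominated convergence; smoothness on the whole manifold makes
  each \<open>f n\<close> a multiplier of smooth sections.\<close>

definition smooth_limit_set :: "('m::t2_space, 'k::finite) chart set \<Rightarrow> 'm set \<Rightarrow> bool" where
  "smooth_limit_set \<A> T \<longleftrightarrow> (\<exists>f :: nat \<Rightarrow> 'm \<Rightarrow> real. \<forall>n. smooth_map_on \<A> UNIV (f n) \<and>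
     (\<forall>m. 0 \<le> f n m \<and> f n m \<le> 1 \<and> (\<lambda>n. f n m) \<longlonglongrightarrow> indicator T m))"

lemma smooth_limit_set_Int:
  assumes \<A>: "smooth_atlas \<A>" and "smooth_limit_set \<A> S" "smooth_limit_set \<A> T"
  shows "smooth_limit_set \<A> (S \<inter> T)"
proof -
  obtain f g where f: "\<And>n. smooth_map_on \<A> UNIV (f n)" "\<And>n m. 0 \<le> f n m" "\<And>n m. f n m \<le> (1::real)"
      "\<And>m. (\<lambda>n. f n m) \<longlonglongrightarrow> indicator S m"
    and g: "\<And>n. smooth_map_on \<A> UNIV (g n)" "\<And>n m. 0 \<le> g n m" "\<And>n m. g n m \<le> (1::real)"
      "\<And>m. (\<lambda>n. g n m) \<longlonglongrightarrow> indicator T m"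
    using assms(2,3) unfolding smooth_limit_set_def by metis
  show ?thesis unfolding smooth_limit_set_def
  proof (intro exI[of _ "\<lambda>n m. f n m * g n m"] allI conjI)
    show "smooth_map_on \<A> UNIV (\<lambda>m. f n m * g n m)" for n
      by (rule smooth_map_on_bilinear[OF \<A> open_UNIV bounded_bilinear_mult f(1) g(1)])
    show "(\<lambda>n. f n m * g n m) \<longlonglongrightarrow> indicator (S \<inter> T) m" for m
      using tendsto_mult[OF f(4) g(4), of m m] by (simp add: indicator_inter_arith)
  qed (auto simp: f g mult_le_one)
qed

text \<open>\<open>q\<close> is positive exactly on the ball, so dilates of \<open>flat\<close> work
  inside the chart. The extension by zero is smooth, because the preimage \<open>K\<close> of the
  closed ball is compact, hence closed in the Hausdorff space, and contained in \<open>U\<close>: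
  its complement is a neighbourhood of every point outside \<open>U\<close>, and the function
  vanishes there.\<close>

lemma smooth_limit_set_chart_ball:
  assumes \<A>: "smooth_atlas \<A>" and U: "(U, \<phi>) \<in> \<A>" and r: "0 < r" and sub: "cball x r \<subseteq> \<phi> ` U"
  shows "smooth_limit_set \<A> (chart_ball U \<phi> x r)"
proof -
  have chU: "is_chart U \<phi>" using smooth_atlas_chart \<A> U by blast
  define q where "q = (\<lambda>y. r\<^sup>2 - (y - x) \<bullet> (y - x))"
  have q: "q y > 0 \<longleftrightarrow> y \<in> ball x r" "q y \<ge> 0 \<longleftrightarrow> y \<in> cball x r" for y
    using r by (auto simp: q_def dist_norm norm_minus_commute power2_norm_eq_inner[symmetric] power_mono_iff
        power_strict_mono intro: power_less_imp_less_base power2_le_imp_le)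
  define f where "f = (\<lambda>n m. if m \<in> U then flat (real n * q (\<phi> m)) else 0)"
  define K where "K = inv_into U \<phi> ` cball x r"
  have "continuous_on (cball x r) (inv_into U \<phi>)"
    using chU sub by (auto simp: is_chart_def homeomorphism_def intro: continuous_on_subset)
  then have K: "closed K" unfolding K_def by (intro compact_imp_closed compact_continuous_image) auto
  have KU: "m \<in> K" if "m \<in> U" "\<phi> m \<in> cball x r" for m
    using that chart_inv[OF chU that(1)] unfolding K_def by force
  have KU': "K \<subseteq> U"
    unfolding K_def using sub by (auto intro: inv_into_into)
  have "smooth_map_on \<A> UNIV (f n)" for n
  proof (rule smooth_map_onI)
    fix V \<eta> assume V: "(V, \<eta>) \<in> \<A>"
    then have chV: "is_chart V \<eta>" using smooth_atlas_chart \<A> by blast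
    show "smooth_on (\<eta> ` (V \<inter> UNIV)) (f n \<circ> inv_into V \<eta>)"
    proof (rule smooth_on_local)
      show "open (\<eta> ` (V \<inter> UNIV))" using chart_image_open[OF chV open_UNIV] .
      fix y assume "y \<in> \<eta> ` (V \<inter> UNIV)"
      then obtain m where m: "m \<in> V" "y = \<eta> m" by auto
      show "\<exists>Y. open Y \<and> y \<in> Y \<and> smooth_on (\<eta> ` (V \<inter> UNIV) \<inter> Y) (f n \<circ> inv_into V \<eta>)"
      proof (cases "m \<in> U")
        case True
        let ?Y = "\<eta> ` (V \<inter> U)"
        have oY: "open ?Y" using chart_image_open[OF chV] chU by (auto simp: is_chart_def)
        have t: "smooth_on ?Y (\<phi> \<circ> inv_into V \<eta>)" by (rule smooth_atlas_transition[OF \<A> V U])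
        have t': "smooth_on ?Y (\<lambda>y. (\<phi> \<circ> inv_into V \<eta>) y + (- x))"
          by (rule smooth_on_add[OF oY t smooth_on_const[OF oY]])
        have "smooth_on ?Y (\<lambda>y. flat (real n * (r\<^sup>2 + (- 1) *
           (((\<phi> \<circ> inv_into V \<eta>) y + (- x)) \<bullet> ((\<phi> \<circ> inv_into V \<eta>) y + (- x))))))"
          by (intro smooth_on_flat[OF oY] smooth_on_bilinear[OF oY bounded_bilinear_mult]
              smooth_on_add[OF oY] smooth_on_const[OF oY]
              smooth_on_bilinear[OF oY bounded_bilinear_inner] t')
        then have "smooth_on ?Y (f n \<circ> inv_into V \<eta>)"
          by (rule iffD1[OF smooth_on_cong[OF oY], rotated])
             (auto simp: f_def q_def chart_inv[OF chV])
        moreover have "\<eta> ` (V \<inter> UNIV) \<inter> ?Y = ?Y" by auto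
        ultimately show ?thesis using oY m True by (intro exI[of _ ?Y]) auto
      next
        case False
        let ?Y = "\<eta> ` (V \<inter> - K)"
        have oY: "open ?Y" using chart_image_open[OF chV] K by auto
        have "f n m' = 0" if "m' \<notin> K" for m'
        proof (cases "m' \<in> U")
          case True
          then have "q (\<phi> m') \<le> 0" using that KU q(2)[of "\<phi> m'"] by (meson linorder_linear)
          then show ?thesis using True by (simp add: f_def flat_bounds(3) mult_nonneg_nonpos)
        qed (simp add: f_def)
        then have "smooth_on ?Y (f n \<circ> inv_into V \<eta>)"
          by (intro iffD1[OF smooth_on_cong[OF oY] smooth_on_const[OF oY, of 0]])
             (auto simp: chart_inv[OF chV])
        moreover have "\<eta> ` (V \<inter> UNIV) \<inter> ?Y = ?Y" by auto
        ultimately show ?thesis using oY m False KU' by (intro exI[of _ ?Y]) auto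
      qed
    qed
  qed
  moreover have "(\<lambda>n. f n m) \<longlonglongrightarrow> indicator (chart_ball U \<phi> x r) m" for m
    using flat_limit[of "q (\<phi> m)"] q(1)[of "\<phi> m"]
    by (cases "m \<in> U") (auto simp: f_def chart_ball_def indicator_def split: if_splits)
  ultimately show ?thesis
    unfolding smooth_limit_set_def by (intro exI[of _ f]) (auto simp: f_def flat_bounds)
qed

text \<open>Each of the countably many compact pieces needs only finitely many sets of the
  cover.\<close>

lemma sigma_compact_countable_subcover:
  assumes "sigma_compact_space TYPE('m::topological_space)"
    and "\<And>C. C \<in> \<C> \<Longrightarrow> open (c C)" "(\<Union>C\<in>\<C>. c C) = (UNIV :: 'm set)"
  obtains \<D> where "countable \<D>" "\<D> \<subseteq> \<C>" "(\<Union>C\<in>\<D>. c C) = UNIV"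
proof -
  obtain K :: "nat \<Rightarrow> 'm set" where K: "\<And>i. compact (K i)" "(\<Union>i. K i) = UNIV"
    using assms(1) by (auto simp: sigma_compact_space_def)
  have "\<exists>D\<subseteq>\<C>. finite D \<and> K i \<subseteq> (\<Union>C\<in>D. c C)" for i
    using compactE_image[OF K(1)[of i], of \<C> c] assms(2,3) by (metis subset_UNIV)
  then obtain D where D: "\<And>i. D i \<subseteq> \<C>" "\<And>i. finite (D i)" "\<And>i. K i \<subseteq> (\<Union>C\<in>D i. c C)" by metis
  show ?thesis
  proof (rule that[of "\<Union>i. D i"])
    show "countable (\<Union>i. D i)" using D(2) by (auto intro: countable_finite)
    show "(\<Union>i. D i) \<subseteq> \<C>" using D by auto
    have "(\<Union>i. K i) \<subseteq> (\<Union>C\<in>(\<Union>i. D i). c C)" using D(3) by blast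
    then show "(\<Union>C\<in>(\<Union>i. D i). c C) = UNIV" using K by auto
  qed
qed

text \<open>The type only knows that the manifold is Hausdorff. A countable basis is assembled from
  countably many charts and from balls with radii \<open>1 / Suc n\<close> and centres in a
  countable dense set of the model space.\<close>

lemma borel_smooth_limit_sets:
  fixes \<A> :: "('m::t2_space, 'k::finite) chart set"
  assumes \<A>: "smooth_atlas \<A>" and sc: "sigma_compact_space TYPE('m)"
    and T: "T \<in> sets (borel :: 'm measure)"
  shows "T \<in> sigma_sets UNIV {T. smooth_limit_set \<A> T}"
proof -
  have cov: "(\<Union>C\<in>\<A>. fst C) = UNIV" "\<And>C. C \<in> \<A> \<Longrightarrow> open (fst C)"
    using smooth_atlas_cover[OF \<A>] smooth_atlas_chart[OF \<A>] unfolding is_chart_def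
    by (auto, metis fst_conv)
  obtain \<A>0 where A0: "countable \<A>0" "\<A>0 \<subseteq> \<A>" "(\<Union>C\<in>\<A>0. fst C) = UNIV"
    using sigma_compact_countable_subcover[OF sc, of \<A> fst] cov by metis
  obtain D :: "(real ^ 'k) set" where D: "countable D" "\<And>X. open X \<Longrightarrow> X \<noteq> {} \<Longrightarrow> \<exists>d\<in>D. d \<in> X"
    using countable_dense_setE by metis
  define I where "I = {(C, x, n :: nat). C \<in> \<A>0 \<and> x \<in> D \<and> cball x (1 / Suc n) \<subseteq> snd C ` fst C}"
  define B :: "('m, 'k) chart \<times> (real ^ 'k) \<times> nat \<Rightarrow> 'm set" where "B = (\<lambda>(C, x, n :: nat). chart_ball (fst C) (snd C) x (1 / Suc n))"
  have "I \<subseteq> \<A>0 \<times> D \<times> UNIV" by (auto simp: I_def)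
  then have cI: "countable I" using A0(1) D(1) by (meson countable_SIGMA countable_subset countableI_type)
  have BI: "B i \<in> {T. smooth_limit_set \<A> T}" if "i \<in> I" for i
    using that A0(2) smooth_limit_set_chart_ball[OF \<A>] unfolding I_def B_def
    by (auto simp: subset_iff)
  have "S \<in> sigma_sets UNIV {T. smooth_limit_set \<A> T}" if S: "open S" for S
  proof -
    have "\<exists>i\<in>I. m \<in> B i \<and> B i \<subseteq> S" if "m \<in> S" for m
    proof -
      have "m \<in> (\<Union>C\<in>\<A>0. fst C)" unfolding A0(3) by simp
      then obtain U \<phi> where U: "(U, \<phi>) \<in> \<A>0" "m \<in> U" by auto
      have ch: "is_chart U \<phi>" using smooth_atlas_chart \<A> A0 U by blast
      have "open (\<phi> ` (U \<inter> S))" "\<phi> m \<in> \<phi> ` (U \<inter> S)" using chart_image_open[OF ch S] U that by auto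
      then obtain e where e: "e > 0" "ball (\<phi> m) e \<subseteq> \<phi> ` (U \<inter> S)" using open_contains_ball by metis
      \<comment> \<open>The centre will be within \<open>1 / Suc n\<close> of
        \<open>\<phi> m\<close>, so the closed ball stays within \<open>2 / Suc n < e\<close> of
        it.\<close>
      obtain n where n: "1 / Suc n < e / 2" using nat_approx_posE[of "e/2"] e by auto
      obtain x where x: "x \<in> D" "x \<in> ball (\<phi> m) (1 / Suc n)" using D(2)[of "ball (\<phi> m) (1 / Suc n)"] by auto
      have cb: "cball x (1 / Suc n) \<subseteq> \<phi> ` (U \<inter> S)"
      proof
        fix y assume "y \<in> cball x (1 / Suc n)"
        then have "dist (\<phi> m) y < e" using x n dist_triangle[of "\<phi> m" y x] by (simp add: dist_commute)
        then show "y \<in> \<phi> ` (U \<inter> S)" using e by auto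
      qed
      have "((U, \<phi>), x, n) \<in> I" using U x cb by (auto simp: I_def)
      moreover have "m \<in> B ((U, \<phi>), x, n)" using U x by (simp add: B_def chart_ball_def dist_commute)
      moreover have "B ((U, \<phi>), x, n) \<subseteq> S"
      proof
        fix m' assume "m' \<in> B ((U, \<phi>), x, n)"
        then have m': "m' \<in> U" "\<phi> m' \<in> cball x (1 / Suc n)" by (auto simp: B_def chart_ball_def)
        then obtain m'' where "m'' \<in> U" "m'' \<in> S" "\<phi> m' = \<phi> m''" using cb by blast
        then show "m' \<in> S" using chart_inv[OF ch] m'(1) by metis
      qed
      ultimately show ?thesis by blast
    qed
    then have "S = \<Union> (B ` {i \<in> I. B i \<subseteq> S})" by blast
    moreover have "\<Union> (B ` {i \<in> I. B i \<subseteq> S}) \<in> sigma_sets UNIV {T. smooth_limit_set \<A> T}"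
      using cI BI by (intro sigma_sets_UNION) (auto intro: countable_subset[OF _ cI])
    ultimately show ?thesis by simp
  qed
  then have "sigma_sets UNIV {S. open S} \<subseteq> sigma_sets UNIV {T. smooth_limit_set \<A> T}"
    by (intro sigma_sets_mono) auto
  then show ?thesis using T by (auto simp: sets_borel)
qed

section \<open>Square integrable functions approximable from a subspace\<close>

lemma norm_vector_scale: "norm (z *s (v :: complex ^ 'n)) = cmod z * norm v"
  unfolding norm_vec_def by (simp add: norm_mult L2_set_right_distrib)

lemma vector_scale_of_real: "complex_of_real r *s (v :: complex ^ 'n) = r *\<^sub>R v"
  by (simp add: vec_eq_iff scaleR_conv_of_real[where 'a = complex])

lemma bounded_linear_vector_scale: "bounded_linear (\<lambda>v :: complex ^ 'n. z *s v)"
  by (rule bounded_linear_intro[where K = "cmod z"])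
     (simp_all add: norm_vector_scale vector_add_ldistrib vec_eq_iff algebra_simps)

lemma borel_measurable_vector_scale [measurable]:
  assumes "u \<in> borel_measurable M" "v \<in> borel_measurable M"
  shows "(\<lambda>x. u x *s (v x :: complex ^ 'n)) \<in> borel_measurable M"
  using assms by (rule borel_measurable_continuous_Pair)
    (unfold vector_scalar_mult_def, intro continuous_intros)

definition sq_norm :: "'m measure \<Rightarrow> ('m \<Rightarrow> complex ^ 'n) \<Rightarrow> ennreal" where
  "sq_norm \<mu> v = (\<integral>\<^sup>+ x. ennreal ((norm (v x))\<^sup>2) \<partial>\<mu>)"

lemma sq_norm_mono: "(\<And>x. norm (v x) \<le> norm (w x)) \<Longrightarrow> sq_norm M v \<le> sq_norm M w"
  unfolding sq_norm_def by (intro nn_integral_mono ennreal_leI power_mono) auto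

lemma sq_norm_scale_eq:
  assumes [measurable]: "v \<in> borel_measurable M"
  shows "sq_norm M (\<lambda>x. z *s v x) = ennreal ((cmod z)\<^sup>2) * sq_norm M v"
  unfolding sq_norm_def norm_vector_scale power_mult_distrib
  by (simp add: ennreal_mult nn_integral_cmult)

text \<open>The factors 2 are the price of working with squared norms, by
  \<open>(a + b)^2 \<le> 2 a^2 + 2 b^2\<close>.\<close>

lemma sq_norm_add_le:
  fixes v w :: "'m \<Rightarrow> complex ^ 'n::finite"
  assumes [measurable]: "v \<in> borel_measurable M" "w \<in> borel_measurable M"
  shows "sq_norm M (\<lambda>x. v x + w x) \<le> 2 * sq_norm M v + 2 * sq_norm M w"
proof -
  have "ennreal ((norm (a + b))\<^sup>2) \<le> 2 * ennreal ((norm a)\<^sup>2) + 2 * ennreal ((norm b)\<^sup>2)"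
    for a b :: "complex ^ 'n"
  proof -
    have "(norm (a + b))\<^sup>2 \<le> (norm a + norm b)\<^sup>2" by (intro power_mono norm_triangle_ineq) auto
    also have "\<dots> \<le> 2 * (norm a)\<^sup>2 + 2 * (norm b)\<^sup>2"
      using zero_le_power2[of "norm a - norm b"] by (simp add: power2_sum power2_diff)
    finally show ?thesis
      by (simp add: ennreal_leI flip: ennreal_numeral ennreal_mult ennreal_plus)
  qed
  then have "sq_norm M (\<lambda>x. v x + w x) \<le> (\<integral>\<^sup>+ x. 2 * ennreal ((norm (v x))\<^sup>2) + 2 * ennreal ((norm (w x))\<^sup>2) \<partial>M)"
    unfolding sq_norm_def
    by (intro nn_integral_mono)
  also have "\<dots> = 2 * sq_norm M v + 2 * sq_norm M w"
    unfolding sq_norm_def by (simp add: nn_integral_add nn_integral_cmult)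
  finally show ?thesis .
qed

text \<open>\<open>P\<close> is the \<open>\<pi>\<close>-system of sets whose indicators are limits of multipliers of \<open>S\<^sub>0\<close>.\<close>

locale l2_closure =
  fixes \<mu> :: "'m::topological_space measure" and P :: "'m set set"
    and S0 :: "('m \<Rightarrow> complex ^ 'n::finite) set"
  assumes sets_\<mu>: "sets \<mu> = sets borel"
    and S0_meas: "\<And>s. s \<in> S0 \<Longrightarrow> s \<in> borel_measurable borel"
    and S0_fin: "\<And>s. s \<in> S0 \<Longrightarrow> sq_norm \<mu> s < \<infinity>"
    and S0_zero: "(\<lambda>x. 0) \<in> S0"
    and S0_add: "\<And>s t. s \<in> S0 \<Longrightarrow> t \<in> S0 \<Longrightarrow> (\<lambda>x. s x + t x) \<in> S0"
    and S0_scale: "\<And>z s. s \<in> S0 \<Longrightarrow> (\<lambda>x. z *s s x) \<in> S0"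
    and P_limit: "\<And>T s. T \<in> P \<Longrightarrow> s \<in> S0 \<Longrightarrow> \<exists>f :: nat \<Rightarrow> 'm \<Rightarrow> real. \<forall>n. (\<lambda>x. f n x *\<^sub>R s x) \<in> S0 \<and>
       (\<forall>x. 0 \<le> f n x \<and> f n x \<le> 1 \<and> (\<lambda>n. f n x) \<longlonglongrightarrow> indicator T x)"
    and P_Int: "\<And>S T. S \<in> P \<Longrightarrow> T \<in> P \<Longrightarrow> S \<inter> T \<in> P"
    and P_gen: "\<And>T. T \<in> sets borel \<Longrightarrow> T \<in> sigma_sets UNIV P"
begin

lemma meas_\<mu>: "borel_measurable \<mu> = borel_measurable borel"
  using measurable_cong_sets[OF sets_\<mu> refl] .

lemma sq_norm_scale:
  "v \<in> borel_measurable borel \<Longrightarrow> sq_norm \<mu> (\<lambda>x. z *s v x) = ennreal ((cmod z)\<^sup>2) * sq_norm \<mu> v"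
  by (rule sq_norm_scale_eq) (simp only: meas_\<mu>)

lemma sq_norm_add:
  fixes v w :: "'m \<Rightarrow> complex ^ 'n"
  shows "v \<in> borel_measurable borel \<Longrightarrow> w \<in> borel_measurable borel \<Longrightarrow>
    sq_norm \<mu> (\<lambda>x. v x + w x) \<le> 2 * sq_norm \<mu> v + 2 * sq_norm \<mu> w"
  by (rule sq_norm_add_le) (simp_all only: meas_\<mu>)

text \<open>The closure of \<open>S0\<close> on the level of functions rather than classes; the
  tolerance \<open>c\<close> bounds the squared distance.\<close>

definition L2D :: "('m \<Rightarrow> complex ^ 'n) set" where
  "L2D = {v \<in> borel_measurable borel. sq_norm \<mu> v < \<infinity> \<and>
     (\<forall>c::real>0. \<exists>s\<in>S0. sq_norm \<mu> (\<lambda>x. v x - s x) < ennreal c)}"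

lemma L2D_meas: "v \<in> L2D \<Longrightarrow> v \<in> borel_measurable borel"
  and L2D_fin: "v \<in> L2D \<Longrightarrow> sq_norm \<mu> v < \<infinity>"
  by (auto simp: L2D_def)

lemma S0_L2D: "s \<in> S0 \<Longrightarrow> s \<in> L2D"
  using S0_meas S0_fin by (auto simp: L2D_def sq_norm_def intro!: bexI[of _ s])

text \<open>Quarters, because \<open>sq_norm_add\<close> doubles each of the two terms.\<close>

lemma sq_norm_add_lt:
  fixes v w :: "'m \<Rightarrow> complex ^ 'n"
  assumes "v \<in> borel_measurable borel" "w \<in> borel_measurable borel"
    "sq_norm \<mu> v < ennreal (c / 4)" "sq_norm \<mu> w < ennreal (c / 4)"
  shows "sq_norm \<mu> (\<lambda>x. v x + w x) < ennreal c"
proof -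
  have c: "c > 0"
  proof (rule ccontr)
    assume "\<not> c > 0"
    then have "ennreal (c / 4) = 0" by (intro ennreal_neg) simp
    then show False using assms(3) by simp
  qed
  define Z where "Z = max (sq_norm \<mu> v) (sq_norm \<mu> w)"
  have "sq_norm \<mu> (\<lambda>x. v x + w x) \<le> 2 * sq_norm \<mu> v + 2 * sq_norm \<mu> w" by (rule sq_norm_add[OF assms(1,2)])
  also have "\<dots> \<le> 2 * Z + 2 * Z" by (intro add_mono mult_left_mono) (auto simp: Z_def)
  also have "\<dots> = 4 * Z" by (simp flip: distrib_right)
  also have "\<dots> < 4 * ennreal (c / 4)"
    using assms(3,4) by (intro ennreal_mult_strict_left_mono) (auto simp: Z_def)
  also have "\<dots> = ennreal c"
    using c by (simp flip: ennreal_numeral ennreal_mult)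
  finally show ?thesis .
qed

lemma L2D_closed:
  assumes "v \<in> borel_measurable borel" "\<And>c::real. c > 0 \<Longrightarrow> \<exists>w\<in>L2D. sq_norm \<mu> (\<lambda>x. v x - w x) < ennreal c"
  shows "v \<in> L2D"
proof -
  have approx: "\<exists>s\<in>S0. sq_norm \<mu> (\<lambda>x. v x - s x) < ennreal c" if c: "c > 0" for c :: real
  proof -
    obtain w where w: "w \<in> L2D" "sq_norm \<mu> (\<lambda>x. v x - w x) < ennreal (c / 4)"
      using assms(2)[of "c / 4"] c by auto
    then obtain s where s: "s \<in> S0" "sq_norm \<mu> (\<lambda>x. w x - s x) < ennreal (c / 4)"
      using c unfolding L2D_def by (auto dest: spec[of _ "c / 4"])
    have "sq_norm \<mu> (\<lambda>x. (v x - w x) + (w x - s x)) < ennreal c"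
      by (rule sq_norm_add_lt[OF _ _ w(2) s(2)]) (use assms(1) L2D_meas[OF w(1)] S0_meas[OF s(1)] in auto)
    then show ?thesis using s(1) by auto
  qed
  obtain w where w: "w \<in> L2D" "sq_norm \<mu> (\<lambda>x. v x - w x) < ennreal 1"
    using assms(2)[of 1] by auto
  have "sq_norm \<mu> (\<lambda>x. (v x - w x) + w x) \<le> 2 * sq_norm \<mu> (\<lambda>x. v x - w x) + 2 * sq_norm \<mu> w"
    using assms(1) L2D_meas[OF w(1)] by (intro sq_norm_add) auto
  also have "\<dots> < \<infinity>"
    using w(2) L2D_fin[OF w(1)] by (auto simp: ennreal_mult_eq_top_iff less_top[symmetric])
  finally have "sq_norm \<mu> v < \<infinity>" by simp
  then show ?thesis using assms(1) approx by (simp add: L2D_def)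
qed

lemma L2D_add:
  assumes "v \<in> L2D" "w \<in> L2D" shows "(\<lambda>x. v x + w x) \<in> L2D"
proof (rule L2D_closed)
  show "(\<lambda>x. v x + w x) \<in> borel_measurable borel" using assms[THEN L2D_meas] by auto
  fix c :: real assume c: "c > 0"
  obtain s t where s: "s \<in> S0" "sq_norm \<mu> (\<lambda>x. v x - s x) < ennreal (c / 4)"
    and t: "t \<in> S0" "sq_norm \<mu> (\<lambda>x. w x - t x) < ennreal (c / 4)"
    using assms c unfolding L2D_def by (auto dest!: spec[of _ "c / 4"])
  have "sq_norm \<mu> (\<lambda>x. (v x - s x) + (w x - t x)) < ennreal c"
    by (rule sq_norm_add_lt[OF _ _ s(2) t(2)])
       (use assms[THEN L2D_meas] S0_meas[OF s(1)] S0_meas[OF t(1)] in auto)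
  then show "\<exists>u\<in>L2D. sq_norm \<mu> (\<lambda>x. v x + w x - u x) < ennreal c"
    using S0_L2D[OF S0_add[OF s(1) t(1)]]
    by (intro bexI[of _ "\<lambda>x. s x + t x"]) (auto simp: algebra_simps)
qed

lemma L2D_dominated:
  assumes v: "\<And>n :: nat. v n \<in> L2D" and l: "\<And>x. (\<lambda>n. v n x) \<longlonglongrightarrow> l x"
    and w: "w \<in> borel_measurable borel" "sq_norm \<mu> w < \<infinity>" and bd: "\<And>n x. norm (v n x) \<le> norm (w x)"
  shows "l \<in> L2D"
proof (rule L2D_closed)
  have vm: "v n \<in> borel_measurable borel" for n using L2D_meas v by blast
  show lm: "l \<in> borel_measurable borel" by (rule borel_measurable_LIMSEQ_metric[OF vm l])
  have bl: "norm (l x) \<le> norm (w x)" for x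
    by (rule LIMSEQ_le_const2[OF tendsto_norm[OF l]]) (use bd in auto)
  have "(\<lambda>n. \<integral>\<^sup>+ x. ennreal ((norm (l x - v n x))\<^sup>2) \<partial>\<mu>) \<longlonglongrightarrow> (\<integral>\<^sup>+ x. 0 \<partial>\<mu>)"
  \<comment> \<open>Both \<open>l\<close> and \<open>v n\<close> are bounded by \<open>w\<close>, so
    the difference is bounded by twice \<open>w\<close>, and its square by four times the
    square.\<close>
  proof (rule nn_integral_dominated_convergence[where w = "\<lambda>x. 4 * ennreal ((norm (w x))\<^sup>2)"])
    show "(\<lambda>x. ennreal ((norm (l x - v n x))\<^sup>2)) \<in> borel_measurable \<mu>" for n
      unfolding meas_\<mu> using vm lm by auto
    show "(\<lambda>x. 4 * ennreal ((norm (w x))\<^sup>2)) \<in> borel_measurable \<mu>"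
      unfolding meas_\<mu> using w by auto
    show "(\<integral>\<^sup>+ x. 4 * ennreal ((norm (w x))\<^sup>2) \<partial>\<mu>) < \<infinity>"
    proof -
      have [measurable]: "w \<in> borel_measurable \<mu>" using w by (simp only: meas_\<mu>)
      show ?thesis using w(2) unfolding sq_norm_def
        by (simp add: nn_integral_cmult ennreal_mult_less_top)
    qed
    have "(norm (l x - v n x))\<^sup>2 \<le> 4 * (norm (w x))\<^sup>2" for n x
    proof -
      have "norm (l x - v n x) \<le> 2 * norm (w x)"
        using norm_triangle_ineq4[of "l x" "v n x"] bd[of n x] bl[of x] by linarith
      then have "(norm (l x - v n x))\<^sup>2 \<le> (2 * norm (w x))\<^sup>2" by (intro power_mono) auto
      then show ?thesis by (simp add: power_mult_distrib)
    qed
    then show "AE x in \<mu>. ennreal ((norm (l x - v n x))\<^sup>2) \<le> 4 * ennreal ((norm (w x))\<^sup>2)" for n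
      by (simp add: ennreal_leI flip: ennreal_numeral ennreal_mult)
    have "(\<lambda>n. ennreal ((norm (l x - v n x))\<^sup>2)) \<longlonglongrightarrow> ennreal ((norm (l x - l x))\<^sup>2)" for x
      by (intro tendsto_ennrealI tendsto_intros l)
    then show "AE x in \<mu>. (\<lambda>n. ennreal ((norm (l x - v n x))\<^sup>2)) \<longlonglongrightarrow> 0" by simp
  qed simp
  then have lim: "(\<lambda>n. sq_norm \<mu> (\<lambda>x. l x - v n x)) \<longlonglongrightarrow> 0" by (simp add: sq_norm_def)
  fix c :: real assume "c > 0"
  then have "\<forall>\<^sub>F n in sequentially. sq_norm \<mu> (\<lambda>x. l x - v n x) < ennreal c"
    using order_tendstoD(2)[OF lim, of "ennreal c"] by simp
  then show "\<exists>u\<in>L2D. sq_norm \<mu> (\<lambda>x. l x - u x) < ennreal c"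
    using v eventually_happens trivial_limit_sequentially by blast
qed

text \<open>Multiplication by a bounded function is continuous for the squared norm, which reduces
  the claim to the dense part \<open>S0\<close>.\<close>

lemma L2D_multI:
  fixes u :: "'m \<Rightarrow> complex"
  assumes v: "v \<in> L2D" and u: "u \<in> borel_measurable borel" "\<And>x. cmod (u x) \<le> B"
    and S0: "\<And>s. s \<in> S0 \<Longrightarrow> (\<lambda>x. u x *s s x) \<in> L2D"
  shows "(\<lambda>x. u x *s v x) \<in> L2D"
proof (rule L2D_closed)
  show "(\<lambda>x. u x *s v x) \<in> borel_measurable borel" using L2D_meas[OF v] u by auto
  fix c :: real assume c: "c > 0"
  \<comment> \<open>The summand 1 keeps the divisor positive when \<open>B = 0\<close>.\<close>
  define k where "k = B\<^sup>2 + 1"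
  have k: "k > 0" by (auto simp: k_def intro: add_nonneg_pos)
  have B: "B \<ge> 0" using u(2) norm_ge_zero order_trans by blast
  obtain s where s: "s \<in> S0" "sq_norm \<mu> (\<lambda>x. v x - s x) < ennreal (c / k)"
    using v c k unfolding L2D_def by (auto dest!: spec[of _ "c / k"])
  have "sq_norm \<mu> (\<lambda>x. u x *s v x - u x *s s x) \<le> sq_norm \<mu> (\<lambda>x. complex_of_real B *s (v x - s x))"
  proof (rule sq_norm_mono)
    fix x
    have "u x *s v x - u x *s s x = u x *s (v x - s x)" by (simp add: vec_eq_iff algebra_simps)
    then show "norm (u x *s v x - u x *s s x) \<le> norm (complex_of_real B *s (v x - s x))"
      using u(2)[of x] B by (simp only: norm_vector_scale) (simp add: mult_right_mono)
  qed
  also have "\<dots> = ennreal (B\<^sup>2) * sq_norm \<mu> (\<lambda>x. v x - s x)"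
    using L2D_meas[OF v] S0_meas[OF s(1)] by (subst sq_norm_scale) auto
  also have "\<dots> \<le> ennreal k * sq_norm \<mu> (\<lambda>x. v x - s x)"
    by (intro mult_right_mono ennreal_leI) (auto simp: k_def)
  also have "\<dots> < ennreal k * ennreal (c / k)"
    using s(2) k by (intro ennreal_mult_strict_left_mono) auto
  also have "\<dots> = ennreal c" using k c by (simp flip: ennreal_mult)
  finally show "\<exists>w\<in>L2D. sq_norm \<mu> (\<lambda>x. u x *s v x - w x) < ennreal c"
    by (intro bexI[OF _ S0[OF s(1)]])
qed

lemma L2D_scale: "v \<in> L2D \<Longrightarrow> (\<lambda>x. z *s v x) \<in> L2D"
  by (rule L2D_multI[where u = "\<lambda>_. z" and B = "cmod z"]) (auto intro: S0_L2D S0_scale)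

lemma L2D_sum: "finite I \<Longrightarrow> (\<And>i. i \<in> I \<Longrightarrow> v i \<in> L2D) \<Longrightarrow> (\<lambda>x. \<Sum>i\<in>I. v i x) \<in> L2D"
  by (induction I rule: finite_induct) (auto intro: L2D_add S0_L2D[OF S0_zero])

text \<open>Dynkin's argument: the sets whose indicators multiply \<open>s\<close> into
  \<open>L2D\<close> include the pi-system \<open>P\<close>, are stable under complements by
  linearity, and under countable disjoint unions by convergence dominated by
  \<open>s\<close>.\<close>

lemma indicator_S0:
  assumes s: "s \<in> S0" and T: "T \<in> sets borel"
  shows "(\<lambda>x. indicator T x *\<^sub>R s x) \<in> L2D"
proof -
  note sm = S0_meas[OF s] S0_fin[OF s]
  have "Int_stable P" using P_Int by (auto simp: Int_stable_def)
  moreover have "P \<subseteq> Pow UNIV" by simp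
  moreover have "T \<in> sigma_sets UNIV P" by (rule P_gen[OF T])
  ultimately show ?thesis
  proof (induction T rule: sigma_sets_induct_disjoint)
    case (basic T)
    obtain f :: "nat \<Rightarrow> 'm \<Rightarrow> real" where f: "\<And>n. (\<lambda>x. f n x *\<^sub>R s x) \<in> S0" "\<And>n x. 0 \<le> f n x" "\<And>n x. f n x \<le> 1"
      "\<And>x. (\<lambda>n. f n x) \<longlonglongrightarrow> indicator T x"
      using P_limit[OF basic s] by metis
    show ?case
      by (rule L2D_dominated[OF S0_L2D[OF f(1)] tendsto_scaleR[OF f(4) tendsto_const] sm])
         (use f(2,3) in \<open>simp add: mult_left_le_one_le\<close>)
  next
    case empty
    show ?case using S0_L2D[OF S0_zero] by simp
  next
    case (compl T)
    have "(\<lambda>x. s x + (- 1) *s (indicator T x *\<^sub>R s x)) \<in> L2D"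
      by (intro L2D_add L2D_scale S0_L2D s compl)
    moreover have "s x + (- 1) *s (indicator T x *\<^sub>R s x) = indicator (UNIV - T) x *\<^sub>R s x" for x
      by (auto simp: indicator_def vec_eq_iff)
    ultimately show ?case by simp
  next
    case (union A)
    show ?case
    proof (rule L2D_dominated[OF _ _ sm])
      show "(\<lambda>x. \<Sum>i<n. indicator (A i) x *\<^sub>R s x) \<in> L2D" for n :: nat
        by (intro L2D_sum union) auto
      have "(\<lambda>i. indicator (A i) x) sums (indicator (\<Union>i. A i) x :: real)" for x
        using union(1) indicator_sums[of A x] by (simp add: disjoint_family_on_def)
      then show "(\<lambda>n. \<Sum>i<n. indicator (A i) x *\<^sub>R s x) \<longlonglongrightarrow> indicator (\<Union>i. A i) x *\<^sub>R s x" for x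
        unfolding sums_def scaleR_sum_left[symmetric] by (intro tendsto_scaleR tendsto_const)
      have "(\<Sum>i<n. indicator (A i) x) \<le> (1::real)" for n x
      proof -
        have eq: "indicator (\<Union>i<n. A i) x = (\<Sum>i<n. indicator (A i) x :: real)"
          using union(1) by (intro indicator_UN_disjoint) (auto simp: disjoint_family_on_def)
        then show ?thesis by (simp only: flip: eq) (simp add: indicator_def)
      qed
      then show "norm (\<Sum>i<n. indicator (A i) x *\<^sub>R s x) \<le> norm (s x)" for n x
        unfolding scaleR_sum_left[symmetric] norm_scaleR
        by (intro mult_left_le_one_le) (auto simp: abs_of_nonneg sum_nonneg)
    qed
  qed
qed

text \<open>Passage from indicators to bounded Borel functions. The approximating simple functions,
  taken with reference point 0, are bounded by \<open>2 * B\<close>, which yields the dominating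
  function.\<close>

lemma multiplier_S0:
  fixes u :: "'m \<Rightarrow> complex"
  assumes s: "s \<in> S0" and u: "u \<in> borel_measurable borel" "\<And>x. cmod (u x) \<le> B"
  shows "(\<lambda>x. u x *s s x) \<in> L2D"
proof -
  obtain F where F: "\<And>i. simple_function borel (F i)" "\<And>x. (\<lambda>i. F i x) \<longlonglongrightarrow> u x"
    "\<And>i x. dist (F i x) 0 \<le> 2 * dist (u x) 0"
    using borel_measurable_implies_sequence_metric[OF u(1), of 0] by auto
  have "(\<lambda>x. F i x *s s x) \<in> L2D" for i
  proof -
    have fin: "finite (range (F i))" using F(1)[of i] by (simp add: simple_function_def)
    have sets: "F i -` {y} \<in> sets borel" for y
    proof (cases "y \<in> range (F i)")
      case True
      then show ?thesis using F(1)[of i] by (auto simp: simple_function_def)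
    next
      case False
      then have "F i -` {y} = {}" by auto
      then show ?thesis by simp
    qed
    have "F i x *s s x = (\<Sum>y\<in>range (F i). y *s (indicator (F i -` {y}) x *\<^sub>R s x))" for x
    proof -
      have "(\<Sum>y\<in>range (F i). y *s (indicator (F i -` {y}) x *\<^sub>R s x)) =
          (\<Sum>y\<in>range (F i). if y = F i x then y *s s x else 0)"
        by (rule sum.cong) (auto simp: indicator_def)
      then show ?thesis using fin by simp
    qed
    moreover have "(\<lambda>x. \<Sum>y\<in>range (F i). y *s (indicator (F i -` {y}) x *\<^sub>R s x)) \<in> L2D"
      by (intro L2D_sum fin L2D_scale indicator_S0 s sets)
    ultimately show ?thesis by simp
  qed
  then show ?thesis
  proof (rule L2D_dominated)
    show "(\<lambda>i. F i x *s s x) \<longlonglongrightarrow> u x *s s x" for x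
      unfolding vector_scalar_mult_def by (intro tendsto_vec_lambda tendsto_mult F tendsto_const)
    show "(\<lambda>x. complex_of_real (2 * B) *s s x) \<in> borel_measurable borel" using S0_meas[OF s] by auto
    show "sq_norm \<mu> (\<lambda>x. complex_of_real (2 * B) *s s x) < \<infinity>"
      by (rule S0_fin[OF S0_scale[OF s]])
    have "cmod (F i x) \<le> 2 * B" for i x using F(3)[of i x] u(2)[of x] by simp
    then show "norm (F i x *s s x) \<le> norm (complex_of_real (2 * B) *s s x)" for i x
      unfolding norm_vector_scale by (intro mult_right_mono) (simp_all, smt (verit))
  qed
qed

lemma L2D_mult:
  fixes u :: "'m \<Rightarrow> complex"
  assumes "v \<in> L2D" and u: "u \<in> borel_measurable borel" "\<And>x. cmod (u x) \<le> B"
  shows "(\<lambda>x. u x *s v x) \<in> L2D"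
  using assms multiplier_S0[OF _ u] by (rule L2D_multI)

end

section \<open>Measurable trivialization of a \<open>G\<close>-bundle\<close>

definition cdot :: "complex ^ 'n::finite \<Rightarrow> complex ^ 'n \<Rightarrow> complex" where
  "cdot u v = (\<Sum>i\<in>UNIV. cnj (u $ i) * v $ i)"

lemma cdot_self: "cdot v v = complex_of_real ((norm v)\<^sup>2)"
  unfolding cdot_def norm_vec_def L2_set_def
  by (simp add: sum_nonneg mult.commute) (simp add: complex_norm_square flip: of_real_power)

lemma cdot_simps:
  "cdot (u + u') v = cdot u v + cdot u' v" "cdot u (v + v') = cdot u v + cdot u v'"
  "cdot (z *s u) v = cnj z * cdot u v" "cdot u (z *s v) = z * cdot u v"
  by (simp_all add: cdot_def algebra_simps sum.distrib sum_distrib_left)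

lemma borel_measurable_cdot [measurable]:
  fixes u v :: "'x \<Rightarrow> complex ^ 'a::finite"
  assumes "u \<in> borel_measurable M" "v \<in> borel_measurable M"
  shows "(\<lambda>x. cdot (u x) (v x)) \<in> borel_measurable M"
  using assms by (rule borel_measurable_continuous_Pair)
    (unfold cdot_def, intro continuous_intros)

text \<open>The columns of \<open>g\<close> are orthonormal, which collapses the sum over
  \<open>i\<close> once it has been moved innermost.\<close>

lemma cdot_unitary:
  assumes "cadjoint g ** g = mat 1"
  shows "cdot (g *v u) (g *v v) = cdot u v"
proof -
  have g: "(\<Sum>i\<in>UNIV. cnj (g $ i $ j) * g $ i $ k) = (if j = k then 1 else 0)" for j k
    using assms unfolding matrix_matrix_mult_def cadjoint_def mat_def vec_eq_iff by simp
  have "cdot (g *v u) (g *v v) =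
      (\<Sum>i\<in>UNIV. \<Sum>j\<in>UNIV. \<Sum>k\<in>UNIV. cnj (u $ j) * v $ k * (cnj (g $ i $ j) * g $ i $ k))"
    unfolding cdot_def matrix_vector_mult_def vec_lambda_beta cnj_sum sum_product
    by (simp add: mult_ac)
  also have "\<dots> = (\<Sum>j\<in>UNIV. \<Sum>i\<in>UNIV. \<Sum>k\<in>UNIV. cnj (u $ j) * v $ k * (cnj (g $ i $ j) * g $ i $ k))"
    by (rule sum.swap)
  also have "\<dots> = (\<Sum>j\<in>UNIV. \<Sum>k\<in>UNIV. \<Sum>i\<in>UNIV. cnj (u $ j) * v $ k * (cnj (g $ i $ j) * g $ i $ k))"
    by (intro sum.cong refl sum.swap)
  also have "\<dots> = (\<Sum>j\<in>UNIV. \<Sum>k\<in>UNIV. cnj (u $ j) * v $ k * (if j = k then 1 else 0))"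
    by (simp only: sum_distrib_left[symmetric] g)
  also have "\<dots> = cdot u v"
    by (simp add: cdot_def if_distrib[of "(*) c" for c] cong: if_cong)
  finally show ?thesis .
qed

text \<open>The first factor need not be second countable, so that the library lemmas on product
  \<open>\<sigma>\<close>-algebras do not apply.\<close>

lemma graph_measurable:
  fixes v :: "'m::topological_space \<Rightarrow> 'v::second_countable_topology"
  assumes Q: "open Q" and v: "v \<in> borel_measurable borel"
  shows "{x. (x, v x) \<in> Q} \<in> sets borel"
proof -
  obtain B :: "'v set set" where B: "countable B" "topological_basis B"
    using ex_countable_basis by blast
  define A where "A = (\<lambda>b. \<Union>{A. open A \<and> A \<times> b \<subseteq> Q})"
  have "{x. (x, v x) \<in> Q} = (\<Union>b\<in>B. A b \<inter> v -` b)"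
  proof (intro subset_antisym subsetI)
    fix x assume "x \<in> {x. (x, v x) \<in> Q}"
    then have "(x, v x) \<in> Q" by simp
    with Q obtain S T where "open S" "open T" "(x, v x) \<in> S \<times> T" "S \<times> T \<subseteq> Q"
      by (rule open_prod_elim)
    then have ST: "open S" "open T" "x \<in> S" "v x \<in> T" "S \<times> T \<subseteq> Q" by auto
    obtain b where "b \<in> B" "v x \<in> b" "b \<subseteq> T" using topological_basisE[OF B(2) ST(2,4)] by blast
    then show "x \<in> (\<Union>b\<in>B. A b \<inter> v -` b)" using ST unfolding A_def by blast
  qed (auto simp: A_def)
  moreover have "A b \<inter> v -` b \<in> sets borel" if "b \<in> B" for b
  proof -
    have "open (A b)" by (auto simp: A_def)
    moreover have "open b" using topological_basis_open[OF B(2) that] .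
    ultimately show ?thesis using measurable_sets_borel[OF v] by auto
  qed
  ultimately show ?thesis using B(1) by (auto intro: sets.countable_UN')
qed

locale hermitian_bundle =
  fixes \<A> :: "('m::t2_space, 'k::finite) chart set"
    and \<mu> :: "'m measure"
    and G :: "(complex ^ 'n::finite ^ 'n) set"
    and E :: "('m, 'e::topological_space, 'n) vbundle"
  assumes atlas: "smooth_atlas \<A>"
    and sc: "sigma_compact_space TYPE('m)"
    and sets_\<mu>: "sets \<mu> = sets borel"
    and G: "subgroup G unitary_group"
    and E_bundle: "G_bundle \<A> G E"
begin

lemma local_triv: "(V, \<psi>) \<in> trivs E \<Longrightarrow> is_local_triv E V \<psi>"
  using E_bundle unfolding G_bundle_def by blast

lemma triv:
  assumes "(V, \<psi>) \<in> trivs E"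
  shows "open V" "\<exists>\<theta>. homeomorphism (proj E -` V) (V \<times> UNIV) (\<lambda>e. (proj E e, \<psi> e)) \<theta>"
    "\<And>e e'. proj E e \<in> V \<Longrightarrow> proj E e' = proj E e \<Longrightarrow> proj E (fadd E e e') = proj E e \<and> \<psi> (fadd E e e') = \<psi> e + \<psi> e'"
    "\<And>z e. proj E e \<in> V \<Longrightarrow> proj E (fscale E z e) = proj E e \<and> \<psi> (fscale E z e) = z *s \<psi> e"
  using local_triv[OF assms] unfolding is_local_triv_def by blast+

lemma continuous_proj: "continuous_on UNIV (proj E)"
  using E_bundle by (simp add: G_bundle_def)

lemma transition:
  assumes "(V, \<psi>) \<in> trivs E" "(W, \<eta>) \<in> trivs E"
  obtains g where "\<And>e. proj E e \<in> V \<inter> W \<Longrightarrow> cadjoint (g (proj E e)) ** g (proj E e) = mat 1"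
    "\<And>e. proj E e \<in> V \<inter> W \<Longrightarrow> \<eta> e = g (proj E e) *v \<psi> e"
proof -
  have "\<forall>p\<in>trivs E. \<forall>q\<in>trivs E. \<exists>g. g ` (fst p \<inter> fst q) \<subseteq> G \<and>
        (\<forall>e. proj E e \<in> fst p \<inter> fst q \<longrightarrow> snd q e = g (proj E e) *v snd p e)"
    using E_bundle unfolding G_bundle_def case_prod_unfold by blast
  from bspec[OF bspec[OF this assms(1)] assms(2)]
  obtain g where g: "g ` (V \<inter> W) \<subseteq> G" "\<And>e. proj E e \<in> V \<inter> W \<Longrightarrow> \<eta> e = g (proj E e) *v \<psi> e"
    by auto
  have "G \<subseteq> {A. cadjoint A ** A = mat 1}"
    using subgroup.subset[OF G] by (simp add: unitary_group_def)
  then have "cadjoint (g (proj E e)) ** g (proj E e) = mat 1" if "proj E e \<in> V \<inter> W" for e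
    using g(1) that by auto
  then show ?thesis using that[of g] g(2) by simp
qed

lemma cdot_triv:
  assumes "(V, \<psi>) \<in> trivs E" "(W, \<eta>) \<in> trivs E" "proj E e \<in> V \<inter> W" "proj E e' = proj E e"
  shows "cdot (\<eta> e) (\<eta> e') = cdot (\<psi> e) (\<psi> e')"
  using transition[OF assms(1,2)] assms(3,4) cdot_unitary by metis

lemma norm_triv:
  assumes "(V, \<psi>) \<in> trivs E" "(W, \<eta>) \<in> trivs E" "proj E e \<in> V \<inter> W"
  shows "norm (\<eta> e) = norm (\<psi> e)"
proof -
  have "complex_of_real ((norm (\<eta> e))\<^sup>2) = complex_of_real ((norm (\<psi> e))\<^sup>2)"
    using cdot_triv[OF assms refl] by (simp only: cdot_self)
  then show ?thesis by (simp only: of_real_eq_iff) simp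
qed

section \<open>A global Borel trivialization\<close>

lemma countable_trivs:
  "\<exists>tr :: nat \<Rightarrow> 'm set \<times> ('e \<Rightarrow> complex ^ 'n). (\<forall>i. tr i \<in> trivs E) \<and> (\<Union>i. fst (tr i)) = UNIV"
proof -
  have "(\<Union>(V, \<psi>)\<in>trivs E. V) = UNIV" using E_bundle by (simp add: G_bundle_def)
  then have cov: "(\<Union>C\<in>trivs E. fst C) = UNIV" by (simp add: case_prod_unfold)
  have "open (fst C)" if "C \<in> trivs E" for C using triv(1)[of "fst C" "snd C"] that by simp
  then obtain \<D> where D: "countable \<D>" "\<D> \<subseteq> trivs E" "(\<Union>C\<in>\<D>. fst C) = UNIV"
    using sigma_compact_countable_subcover[OF sc _ cov] by metis
  have ne: "\<D> \<noteq> {}" using D(3) by auto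
  then have r: "range (from_nat_into \<D>) = \<D>" using D(1) by (rule range_from_nat_into)
  have "from_nat_into \<D> i \<in> trivs E" for i using from_nat_into[OF ne] D(2) by (rule rev_subsetD)
  moreover have "(\<Union>i. fst (from_nat_into \<D> i)) = (\<Union>C\<in>range (from_nat_into \<D>). fst C)" by simp
  then have "(\<Union>i. fst (from_nat_into \<D> i)) = UNIV" unfolding r D(3) .
  ultimately show ?thesis by (intro exI[of _ "from_nat_into \<D>"]) simp
qed

definition tr where
  "tr = (SOME tr :: nat \<Rightarrow> 'm set \<times> ('e \<Rightarrow> complex ^ 'n). (\<forall>i. tr i \<in> trivs E) \<and> (\<Union>i. fst (tr i)) = UNIV)"

definition dom where "dom i = fst (tr i)"
definition tpsi where "tpsi i = snd (tr i)"

lemma tr: "(dom i, tpsi i) \<in> trivs E" "(\<Union>i. dom i) = UNIV"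
proof -
  have "(\<forall>i. tr i \<in> trivs E) \<and> (\<Union>i. fst (tr i)) = UNIV"
    unfolding tr_def by (rule someI_ex[OF countable_trivs])
  then show "(dom i, tpsi i) \<in> trivs E" "(\<Union>i. dom i) = UNIV" by (simp_all add: dom_def tpsi_def)
qed

definition theta where
  "theta i = (SOME \<theta>. homeomorphism (proj E -` dom i) (dom i \<times> UNIV) (\<lambda>e. (proj E e, tpsi i e)) \<theta>)"

lemma theta: "homeomorphism (proj E -` dom i) (dom i \<times> UNIV) (\<lambda>e. (proj E e, tpsi i e)) (theta i)"
  unfolding theta_def by (rule someI_ex[OF triv(2)[OF tr(1)]])

text \<open>Taking the least index cuts the countable open cover into a Borel partition, along which
  the local trivializations are glued.\<close>

definition idx where "idx x = (LEAST i. x \<in> dom i)"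

lemma idx: "x \<in> dom (idx x)"
proof -
  have "x \<in> (\<Union>i. dom i)" unfolding tr(2) by simp
  then show ?thesis unfolding idx_def by (auto intro: LeastI)
qed

lemma open_dom: "open (dom i)" by (rule triv(1)[OF tr(1)])

lemma idx_sets: "{x. idx x = i} \<in> sets borel"
proof -
  have "idx x = i \<longleftrightarrow> x \<in> dom i \<and> (\<forall>j<i. x \<notin> dom j)" for x
  proof
    show "idx x = i \<Longrightarrow> x \<in> dom i \<and> (\<forall>j<i. x \<notin> dom j)"
      using idx[of x] not_less_Least[of _ "\<lambda>i. x \<in> dom i"] unfolding idx_def by blast
    show "x \<in> dom i \<and> (\<forall>j<i. x \<notin> dom j) \<Longrightarrow> idx x = i"
      unfolding idx_def by (rule Least_equality) (auto simp flip: not_less)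
  qed
  then have "{x. idx x = i} = dom i - (\<Union>j<i. dom j)" by auto
  then show ?thesis using open_dom by auto
qed

text \<open>On each fibre this map is linear, bijective and isometric, the last because the
  transition functions are unitary; where \<open>idx\<close> jumps it is in general
  discontinuous.\<close>

definition Psi :: "'e \<Rightarrow> complex ^ 'n" where "Psi e = tpsi (idx (proj E e)) e"
definition Sec :: "'m \<Rightarrow> complex ^ 'n \<Rightarrow> 'e" where "Sec x v = theta (idx x) (x, v)"

lemma Sec: "proj E (Sec x v) = x" "Psi (Sec x v) = v"
proof -
  have "(\<lambda>e. (proj E e, tpsi (idx x) e)) (Sec x v) = (x, v)"
    unfolding Sec_def using homeomorphism_apply2[OF theta[of "idx x"], of "(x, v)"] idx by simp
  then show "proj E (Sec x v) = x" "Psi (Sec x v) = v" by (auto simp: Psi_def)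
qed

lemma Sec_Psi: "Sec (proj E e) (Psi e) = e"
  unfolding Sec_def Psi_def using homeomorphism_apply1[OF theta, of e] idx by simp

lemma Psi_eq_iff: "proj E e = proj E e' \<Longrightarrow> Psi e = Psi e' \<longleftrightarrow> e = e'"
  by (metis Sec_Psi)

lemma fadd: "proj E e' = proj E e \<Longrightarrow> proj E (fadd E e e') = proj E e"
    "proj E e' = proj E e \<Longrightarrow> Psi (fadd E e e') = Psi e + Psi e'"
  and fscale: "proj E (fscale E z e) = proj E e" "Psi (fscale E z e) = z *s Psi e"
  using triv(3)[OF tr(1) idx, of e' e] triv(4)[OF tr(1) idx, of z e] by (simp_all add: Psi_def)

lemma fibre_norm_eq: "fibre_norm E e = norm (Psi e)"
  unfolding fibre_norm_def
proof (rule the_equality)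
  have "norm (Psi e) = norm (\<psi> e)" if "(V, \<psi>) \<in> trivs E" "proj E e \<in> V" for V \<psi>
    unfolding Psi_def using norm_triv[OF that(1) tr(1)] that(2) idx by simp
  then show "\<forall>(V, \<psi>)\<in>trivs E. proj E e \<in> V \<longrightarrow> norm (Psi e) = norm (\<psi> e)" by blast
  show "r = norm (Psi e)" if "\<forall>(V, \<psi>)\<in>trivs E. proj E e \<in> V \<longrightarrow> r = norm (\<psi> e)" for r
    using that tr(1)[of "idx (proj E e)"] idx[of "proj E e"] unfolding Psi_def by blast
qed

lemma fibre_inner_eq:
  assumes "proj E e' = proj E e"
  shows "fibre_inner E e e' = cdot (Psi e) (Psi e')"
  unfolding fibre_inner_def cdot_def[symmetric]
proof (rule the_equality)
  have "cdot (Psi e) (Psi e') = cdot (\<psi> e) (\<psi> e')" if "(V, \<psi>) \<in> trivs E" "proj E e \<in> V" for V \<psi>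
    unfolding Psi_def assms using cdot_triv[OF that(1) tr(1) _ assms] that(2) idx by simp
  then show "\<forall>(V, \<psi>)\<in>trivs E. proj E e \<in> V \<longrightarrow> cdot (Psi e) (Psi e') = cdot (\<psi> e) (\<psi> e')" by blast
  show "z = cdot (Psi e) (Psi e')" if "\<forall>(V, \<psi>)\<in>trivs E. proj E e \<in> V \<longrightarrow> z = cdot (\<psi> e) (\<psi> e')" for z
    using that tr(1)[of "idx (proj E e)"] idx[of "proj E e"] unfolding Psi_def assms by blast
qed

lemma borel_measurable_piecewise:
  fixes f :: "'m \<Rightarrow> 'z::topological_space"
  assumes "\<And>i Q. open Q \<Longrightarrow> \<exists>B\<in>sets borel. \<forall>x. idx x = i \<longrightarrow> (x \<in> B \<longleftrightarrow> f x \<in> Q)"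
  shows "f \<in> borel_measurable borel"
proof (rule borel_measurableI)
  fix Q :: "'z set" assume Q: "open Q"
  obtain B where B: "\<And>i. B i \<in> sets borel" "\<And>i x. idx x = i \<Longrightarrow> x \<in> B i \<longleftrightarrow> f x \<in> Q"
    using assms[OF Q] by metis
  have "f -` Q \<inter> space borel = (\<Union>i. {x. idx x = i} \<inter> B i)" using B(2) by auto
  then show "f -` Q \<inter> space borel \<in> sets borel" using B(1) idx_sets by auto
qed

text \<open>Where \<open>idx\<close> is constant, the two directions come down to continuity of a
  local trivialization and of its inverse. The inverse also depends on the base point, so that
  \<open>graph_measurable\<close> is used.\<close>

lemma borel_section_iff:
  assumes c: "\<And>x. proj E (c x) = x"
  shows "c \<in> borel_sections E \<longleftrightarrow> (\<lambda>x. Psi (c x)) \<in> borel_measurable borel"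
proof
  assume "c \<in> borel_sections E"
  then have m: "c \<in> borel_measurable borel" by (simp add: borel_sections_def)
  show "(\<lambda>x. Psi (c x)) \<in> borel_measurable borel"
  proof (rule borel_measurable_piecewise)
    fix i and Q :: "(complex ^ 'n) set" assume Q: "open Q"
    have "continuous_on (proj E -` dom i) (\<lambda>e. snd (proj E e, tpsi i e))"
      using homeomorphism_cont1[OF theta[of i]] by (rule continuous_on_snd)
    moreover have "open (proj E -` dom i)"
      using continuous_proj open_dom by (simp add: continuous_on_open_vimage)
    ultimately have "open (tpsi i -` Q \<inter> proj E -` dom i)"
      using Q by (simp add: continuous_on_open_vimage)
    then have "c -` (tpsi i -` Q \<inter> proj E -` dom i) \<in> sets borel"
      by (intro measurable_sets_borel[OF m]) simp
    then show "\<exists>B\<in>sets borel. \<forall>x. idx x = i \<longrightarrow> (x \<in> B \<longleftrightarrow> Psi (c x) \<in> Q)"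
      by (rule bexI[rotated]) (use idx c in \<open>auto simp: Psi_def\<close>)
  qed
next
  assume m: "(\<lambda>x. Psi (c x)) \<in> borel_measurable borel"
  have "c \<in> borel_measurable borel"
  proof (rule borel_measurable_piecewise)
    fix i and Q :: "'e set" assume Q: "open Q"
    have "open (theta i -` Q \<inter> dom i \<times> UNIV)"
      using homeomorphism_cont2[OF theta[of i]] Q open_dom
      by (simp add: continuous_on_open_vimage open_Times)
    then have "{x. (x, Psi (c x)) \<in> theta i -` Q \<inter> dom i \<times> UNIV} \<in> sets borel"
      using m by (rule graph_measurable)
    moreover have "theta (idx x) (x, Psi (c x)) = c x" for x
      using Sec_Psi[of "c x"] by (simp add: Sec_def c)
    ultimately show "\<exists>B\<in>sets borel. \<forall>x. idx x = i \<longrightarrow> (x \<in> B \<longleftrightarrow> c x \<in> Q)"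
      by (intro bexI[of _ "{x. (x, Psi (c x)) \<in> theta i -` Q \<inter> dom i \<times> UNIV}"]) (use idx in auto)
  qed
  then show "c \<in> borel_sections E" using c by (simp add: borel_sections_def)
qed

lemma borel_section_proj: "c \<in> borel_sections E \<Longrightarrow> proj E (c x) = x"
  by (simp add: borel_sections_def)

subsection \<open>Sections as vector valued functions\<close>

text \<open>The correspondence given by \<open>hat\<close> and \<open>sec\<close> moves the analysis
  from sections to the vector valued functions of \<open>L2D\<close>.\<close>

definition hat :: "('m \<Rightarrow> 'e) \<Rightarrow> 'm \<Rightarrow> complex ^ 'n" where "hat c = (\<lambda>x. Psi (c x))"
definition sec :: "('m \<Rightarrow> complex ^ 'n) \<Rightarrow> 'm \<Rightarrow> 'e" where "sec v = (\<lambda>x. Sec x (v x))"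
definition cls :: "('m \<Rightarrow> complex ^ 'n) \<Rightarrow> ('m \<Rightarrow> 'e) set" where "cls v = ae_class E \<mu> (sec v)"

lemma hat_sec: "hat (sec v) = v" by (simp add: hat_def sec_def Sec)

lemma proj_sec: "proj E (sec v x) = x" by (simp add: sec_def Sec)

lemma mem_cls:
  "d \<in> cls v \<longleftrightarrow> (\<forall>x. proj E (d x) = x) \<and> hat d \<in> borel_measurable borel \<and> (AE x in \<mu>. hat d x = v x)"
proof -
  have "d x = sec v x \<longleftrightarrow> hat d x = v x" if "\<And>x. proj E (d x) = x" for x
    using Psi_eq_iff[of "d x" "sec v x"] that by (simp add: hat_def sec_def Sec)
  then show ?thesis
    unfolding cls_def ae_class_def using borel_section_iff[of d] borel_section_proj[of d]
    by (auto simp: hat_def[symmetric])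
qed

lemma ae_class_cls:
  assumes "\<And>x. proj E (c x) = x" shows "ae_class E \<mu> c = cls (hat c)"
proof -
  have "c = sec (hat c)" using assms Sec_Psi by (metis (no_types, lifting) hat_def sec_def ext)
  then show ?thesis by (simp add: cls_def)
qed

lemma cls_cong: "(AE x in \<mu>. v x = w x) \<Longrightarrow> cls v = cls w"
  by (auto simp: mem_cls elim: eventually_elim2)

lemma sec_cls: "v \<in> borel_measurable borel \<Longrightarrow> sec v \<in> cls v"
  by (simp add: mem_cls hat_sec proj_sec)

lemma norm_sq_integral_eq: "norm_sq_integral E \<mu> c = sq_norm \<mu> (hat c)"
  by (simp add: norm_sq_integral_def sq_norm_def hat_def fibre_norm_eq)

lemma hat_diff:
  assumes "\<And>x. proj E (c x) = x" "\<And>x. proj E (d x) = x"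
  shows "hat (section_diff E c d) = (\<lambda>x. hat c x - hat d x)"
  by (simp add: hat_def section_diff_def fadd(2) fscale assms fun_eq_iff vec_eq_iff)

lemma smooth_sectionD:
  assumes "s \<in> smooth_sections \<A> E"
  shows "\<And>x. proj E (s x) = x" "\<And>V \<psi>. (V, \<psi>) \<in> trivs E \<Longrightarrow> smooth_map_on \<A> V (\<lambda>x. \<psi> (s x))"
  using assms by (auto simp: smooth_sections_def o_def)

lemma smooth_sectionI:
  assumes "\<And>x. proj E (s x) = x" "\<And>V \<psi>. (V, \<psi>) \<in> trivs E \<Longrightarrow> smooth_map_on \<A> V (\<lambda>x. \<psi> (s x))"
  shows "s \<in> smooth_sections \<A> E"
  using assms by (auto simp: smooth_sections_def o_def)

lemma smooth_section_measurable:
  assumes s: "s \<in> smooth_sections \<A> E"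
  shows "hat s \<in> borel_measurable borel"
  unfolding hat_def
proof (rule borel_measurable_piecewise)
  fix i and Q :: "(complex ^ 'n) set" assume Q: "open Q"
  have "continuous_on (dom i) (\<lambda>x. tpsi i (s x))"
    by (rule smooth_map_on_continuous[OF atlas open_dom smooth_sectionD(2)[OF s tr(1)]])
  then have "open ((\<lambda>x. tpsi i (s x)) -` Q \<inter> dom i)"
    using Q open_dom by (simp add: continuous_on_open_vimage)
  then show "\<exists>B\<in>sets borel. \<forall>x. idx x = i \<longrightarrow> (x \<in> B \<longleftrightarrow> Psi (s x) \<in> Q)"
    by (intro bexI[of _ "(\<lambda>x. tpsi i (s x)) -` Q \<inter> dom i"])
       (use idx smooth_sectionD(1)[OF s] in \<open>auto simp: Psi_def\<close>)
qed

definition S0 :: "('m \<Rightarrow> complex ^ 'n) set" where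
  "S0 = {hat s | s. s \<in> smooth_sections \<A> E \<and> sq_norm \<mu> (hat s) < \<infinity>}"

lemma S0I: "s \<in> smooth_sections \<A> E \<Longrightarrow> sq_norm \<mu> (hat s) < \<infinity> \<Longrightarrow> hat s = v \<Longrightarrow> v \<in> S0"
  by (auto simp: S0_def)

text \<open>Although \<open>sec\<close> is built from a discontinuous trivialization, the zero
  section is smooth: vanishing is detected by the norm, which is the same in all
  trivializations.\<close>

lemma smooth_zero: "sec (\<lambda>x. 0) \<in> smooth_sections \<A> E"
proof (rule smooth_sectionI)
  fix V \<psi> assume V: "(V, \<psi>) \<in> trivs E"
  have "\<psi> (sec (\<lambda>x. 0) x) = 0" if x: "x \<in> V" for x
  proof -
    have "norm (\<psi> (sec (\<lambda>x. 0) x)) = norm (Psi (sec (\<lambda>x. 0) x))"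
      unfolding Psi_def using norm_triv[OF tr(1) V] x idx by (simp add: proj_sec)
    then show ?thesis by (simp add: sec_def Sec)
  qed
  then show "smooth_map_on \<A> V (\<lambda>x. \<psi> (sec (\<lambda>x. 0) x))"
    by (intro smooth_map_on_cong[OF atlas triv(1)[OF V] smooth_map_on_const[OF atlas triv(1)[OF V], of 0]]) simp
qed (rule proj_sec)

lemma smooth_add:
  assumes s: "s \<in> smooth_sections \<A> E" and t: "t \<in> smooth_sections \<A> E"
  shows "(\<lambda>x. fadd E (s x) (t x)) \<in> smooth_sections \<A> E"
proof (rule smooth_sectionI)
  fix V \<psi> assume V: "(V, \<psi>) \<in> trivs E"
  show "smooth_map_on \<A> V (\<lambda>x. \<psi> (fadd E (s x) (t x)))"
    by (rule smooth_map_on_cong[OF atlas triv(1)[OF V]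
        smooth_map_on_add[OF atlas triv(1)[OF V] smooth_sectionD(2)[OF s V] smooth_sectionD(2)[OF t V]]])
       (use triv(3)[OF V] smooth_sectionD(1)[OF s] smooth_sectionD(1)[OF t] in simp)
qed (simp add: fadd smooth_sectionD(1)[OF s] smooth_sectionD(1)[OF t])

lemma smooth_scale:
  assumes s: "s \<in> smooth_sections \<A> E"
  shows "(\<lambda>x. fscale E z (s x)) \<in> smooth_sections \<A> E"
proof (rule smooth_sectionI)
  fix V \<psi> assume V: "(V, \<psi>) \<in> trivs E"
  show "smooth_map_on \<A> V (\<lambda>x. \<psi> (fscale E z (s x)))"
    by (rule smooth_map_on_cong[OF atlas triv(1)[OF V]
        smooth_map_on_bounded_linear[OF atlas triv(1)[OF V] bounded_linear_vector_scale[of z] smooth_sectionD(2)[OF s V]]])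
       (use triv(4)[OF V] smooth_sectionD(1)[OF s] in simp)
qed (simp add: fscale smooth_sectionD(1)[OF s])

lemma smooth_mult:
  assumes s: "s \<in> smooth_sections \<A> E" and f: "smooth_map_on \<A> UNIV f"
  shows "(\<lambda>x. fscale E (complex_of_real (f x)) (s x)) \<in> smooth_sections \<A> E"
proof (rule smooth_sectionI)
  fix V \<psi> assume V: "(V, \<psi>) \<in> trivs E"
  show "smooth_map_on \<A> V (\<lambda>x. \<psi> (fscale E (complex_of_real (f x)) (s x)))"
    by (rule smooth_map_on_cong[OF atlas triv(1)[OF V]
        smooth_map_on_bilinear[OF atlas triv(1)[OF V] bounded_bilinear_scaleR
          smooth_map_on_subset[OF atlas triv(1)[OF V] f] smooth_sectionD(2)[OF s V]]])
       (use triv(4)[OF V] smooth_sectionD(1)[OF s] in \<open>simp add: vector_scale_of_real\<close>)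
qed (simp add: fscale smooth_sectionD(1)[OF s])

text \<open>The decisive obligation is \<open>P_limit\<close>: smooth functions with values between
  0 and 1 multiply square integrable smooth sections into such sections.\<close>

sublocale l2_closure \<mu> "{T. smooth_limit_set \<A> T}" S0
proof
  have meas: "borel_measurable \<mu> = borel_measurable borel"
    using measurable_cong_sets[OF sets_\<mu> refl] .
  show "sets \<mu> = sets borel" by (rule sets_\<mu>)
  show "s \<in> borel_measurable borel" "sq_norm \<mu> s < \<infinity>" if "s \<in> S0" for s
    using that smooth_section_measurable by (auto simp: S0_def)
  show "(\<lambda>x. 0) \<in> S0"
    by (rule S0I[OF smooth_zero]) (simp_all add: hat_sec sq_norm_def)
  show "(\<lambda>x. s x + t x) \<in> S0" if st: "s \<in> S0" "t \<in> S0" for s t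
  proof -
    obtain s' t' where s': "s' \<in> smooth_sections \<A> E" "sq_norm \<mu> (hat s') < \<infinity>" "s = hat s'"
      and t': "t' \<in> smooth_sections \<A> E" "sq_norm \<mu> (hat t') < \<infinity>" "t = hat t'"
      using st by (auto simp: S0_def)
    have eq: "hat (\<lambda>x. fadd E (s' x) (t' x)) = (\<lambda>x. s x + t x)"
      by (simp add: hat_def s' t' fadd smooth_sectionD(1)[OF s'(1)] smooth_sectionD(1)[OF t'(1)])
    have "sq_norm \<mu> (\<lambda>x. s x + t x) \<le> 2 * sq_norm \<mu> s + 2 * sq_norm \<mu> t"
      using smooth_section_measurable s' t' by (intro sq_norm_add_le) (simp_all add: meas)
    also have "\<dots> < \<infinity>" using s' t' by (auto simp: ennreal_mult_eq_top_iff less_top[symmetric])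
    finally show ?thesis using eq by (intro S0I[OF smooth_add[OF s'(1) t'(1)]]) simp_all
  qed
  show "(\<lambda>x. z *s s x) \<in> S0" if s: "s \<in> S0" for z s
  proof -
    obtain s' where s': "s' \<in> smooth_sections \<A> E" "sq_norm \<mu> (hat s') < \<infinity>" "s = hat s'"
      using s by (auto simp: S0_def)
    have eq: "hat (\<lambda>x. fscale E z (s' x)) = (\<lambda>x. z *s s x)" by (simp add: hat_def s' fscale)
    have "sq_norm \<mu> (\<lambda>x. z *s s x) = ennreal ((cmod z)\<^sup>2) * sq_norm \<mu> s"
      using smooth_section_measurable s' by (intro sq_norm_scale_eq) (simp add: meas)
    also have "\<dots> < \<infinity>" using s' by (simp add: ennreal_mult_less_top)
    finally show ?thesis using eq by (intro S0I[OF smooth_scale[OF s'(1)]]) simp_all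
  qed
  show "\<exists>f :: nat \<Rightarrow> 'm \<Rightarrow> real. \<forall>n. (\<lambda>x. f n x *\<^sub>R s x) \<in> S0 \<and>
       (\<forall>x. 0 \<le> f n x \<and> f n x \<le> 1 \<and> (\<lambda>n. f n x) \<longlonglongrightarrow> indicator T x)"
    if T: "T \<in> {T. smooth_limit_set \<A> T}" and "s \<in> S0" for T s
  proof -
    obtain s' where s': "s' \<in> smooth_sections \<A> E" "sq_norm \<mu> (hat s') < \<infinity>" "s = hat s'"
      using \<open>s \<in> S0\<close> by (auto simp: S0_def)
    obtain f :: "nat \<Rightarrow> 'm \<Rightarrow> real" where f: "\<And>n. smooth_map_on \<A> UNIV (f n)" "\<And>n x. 0 \<le> f n x"
      "\<And>n x. f n x \<le> 1" "\<And>x. (\<lambda>n. f n x) \<longlonglongrightarrow> indicator T x"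
      using T unfolding smooth_limit_set_def by auto
    have "(\<lambda>x. f n x *\<^sub>R s x) \<in> S0" for n
    proof (rule S0I[OF smooth_mult[OF s'(1) f(1)[of n]]])
      show eq: "hat (\<lambda>x. fscale E (complex_of_real (f n x)) (s' x)) = (\<lambda>x. f n x *\<^sub>R s x)"
        by (simp add: hat_def s' fscale vector_scale_of_real)
      have "sq_norm \<mu> (\<lambda>x. f n x *\<^sub>R s x) \<le> sq_norm \<mu> s"
        using f(2,3) by (intro sq_norm_mono) (simp add: mult_left_le_one_le)
      then show "sq_norm \<mu> (hat (\<lambda>x. fscale E (complex_of_real (f n x)) (s' x))) < \<infinity>"
        unfolding eq using s' by (auto intro: le_less_trans)
    qed
    then show ?thesis using f by blast
  qed
  show "S \<inter> T \<in> {T. smooth_limit_set \<A> T}"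
    if "S \<in> {T. smooth_limit_set \<A> T}" "T \<in> {T. smooth_limit_set \<A> T}" for S T
    using that smooth_limit_set_Int[OF atlas] by auto
  show "T \<in> sigma_sets UNIV {T. smooth_limit_set \<A> T}" if "T \<in> sets borel" for T
    by (rule borel_smooth_limit_sets[OF atlas sc that])
qed

section \<open>\<open>L2\<close> as classes of vector valued functions\<close>

abbreviation H where "H \<equiv> L2 \<A> \<mu> E"

text \<open>\<open>L2\<close> measures the approximation by a distance, \<open>L2D\<close> by its
  square; hence the square roots and squares in the tolerances.\<close>

lemma carrier_H: "carrier H = cls ` L2D"
proof (intro subset_antisym subsetI)
  fix F assume "F \<in> carrier H"
  then obtain c where c: "F = ae_class E \<mu> c" "c \<in> borel_sections E" "norm_sq_integral E \<mu> c < \<infinity>"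
    "\<And>\<epsilon>. \<epsilon> > 0 \<Longrightarrow> \<exists>s\<in>smooth_sections \<A> E. norm_sq_integral E \<mu> s < \<infinity> \<and>
           norm_sq_integral E \<mu> (section_diff E c s) < ennreal (\<epsilon>\<^sup>2)"
    by (auto simp: L2_def)
  have cp: "proj E (c x) = x" for x using borel_section_proj[OF c(2)] .
  have "\<exists>s\<in>S0. sq_norm \<mu> (\<lambda>x. hat c x - s x) < ennreal r" if r: "r > 0" for r :: real
  proof -
    obtain s where s: "s \<in> smooth_sections \<A> E" "norm_sq_integral E \<mu> s < \<infinity>"
      "norm_sq_integral E \<mu> (section_diff E c s) < ennreal ((sqrt r)\<^sup>2)"
      using c(4)[of "sqrt r"] r by auto
    then show ?thesis using r smooth_sectionD(1)[OF s(1)]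
      by (intro bexI[of _ "hat s"]) (auto simp: norm_sq_integral_eq hat_diff cp intro!: S0I)
  qed
  moreover have "hat c \<in> borel_measurable borel" using c(2) borel_section_iff[OF cp] by (simp add: hat_def)
  ultimately have "hat c \<in> L2D" using c(3) by (simp add: L2D_def norm_sq_integral_eq)
  then show "F \<in> cls ` L2D" using c(1) ae_class_cls[OF cp] by blast
next
  fix F assume "F \<in> cls ` L2D"
  then obtain v where v: "v \<in> L2D" "F = cls v" by auto
  have "sec v \<in> borel_sections E"
    using borel_section_iff[of "sec v"] L2D_meas[OF v(1)] by (simp add: proj_sec hat_def[symmetric] hat_sec)
  moreover have "norm_sq_integral E \<mu> (sec v) < \<infinity>"
    using L2D_fin[OF v(1)] by (simp add: norm_sq_integral_eq hat_sec)
  moreover have "\<exists>s\<in>smooth_sections \<A> E. norm_sq_integral E \<mu> s < \<infinity> \<and>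
           norm_sq_integral E \<mu> (section_diff E (sec v) s) < ennreal (\<epsilon>\<^sup>2)" if e: "\<epsilon> > 0" for \<epsilon> :: real
  proof -
    have "\<epsilon>\<^sup>2 > 0" using e by simp
    then obtain t where "t \<in> S0" "sq_norm \<mu> (\<lambda>x. v x - t x) < ennreal (\<epsilon>\<^sup>2)"
      using v(1) unfolding L2D_def by blast
    then obtain s where s: "s \<in> smooth_sections \<A> E" "sq_norm \<mu> (hat s) < \<infinity>"
      "sq_norm \<mu> (\<lambda>x. v x - hat s x) < ennreal (\<epsilon>\<^sup>2)"
      by (auto simp: S0_def)
    then show ?thesis
      using smooth_sectionD(1)[OF s(1)]
      by (intro bexI[of _ s]) (auto simp: norm_sq_integral_eq hat_diff proj_sec hat_sec)
  qed
  ultimately show "F \<in> carrier H" unfolding v(2) cls_def by (auto simp: L2_def)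
qed

text \<open>By \<open>eq\<close> all members of the union over representatives are one and the same
  class, and \<open>sec_cls\<close> supplies representatives, so the union is not empty.\<close>

lemma hadd_cls:
  assumes v: "v \<in> borel_measurable borel" and w: "w \<in> borel_measurable borel"
  shows "hadd H (cls v) (cls w) = cls (\<lambda>x. v x + w x)"
proof -
  have eq: "ae_class E \<mu> (\<lambda>x. fadd E (c x) (d x)) = cls (\<lambda>x. v x + w x)"
    if c: "c \<in> cls v" and d: "d \<in> cls w" for c d
  proof -
    have p: "proj E (c x) = x" "proj E (d x) = x" for x using c d by (auto simp: mem_cls)
    have "ae_class E \<mu> (\<lambda>x. fadd E (c x) (d x)) = cls (\<lambda>x. hat c x + hat d x)"
      using ae_class_cls[of "\<lambda>x. fadd E (c x) (d x)"] by (simp add: fadd p hat_def)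
    also have "\<dots> = cls (\<lambda>x. v x + w x)"
      using c d by (intro cls_cong) (auto simp: mem_cls elim: eventually_elim2)
    finally show ?thesis .
  qed
  have "hadd H (cls v) (cls w) = (\<Union>c\<in>cls v. \<Union>d\<in>cls w. ae_class E \<mu> (\<lambda>x. fadd E (c x) (d x)))"
    by (simp add: L2_def)
  also have "\<dots> = cls (\<lambda>x. v x + w x)"
    using sec_cls[OF v] sec_cls[OF w] by (auto simp: eq)
  finally show ?thesis .
qed

lemma pointwise_mult_cls:
  assumes v: "v \<in> borel_measurable borel"
  shows "pointwise_mult E \<mu> u (cls v) = cls (\<lambda>x. u x *s v x)"
proof -
  have eq: "ae_class E \<mu> (\<lambda>x. fscale E (u x) (c x)) = cls (\<lambda>x. u x *s v x)" if c: "c \<in> cls v" for c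
  proof -
    have p: "proj E (c x) = x" for x using c by (auto simp: mem_cls)
    have "ae_class E \<mu> (\<lambda>x. fscale E (u x) (c x)) = cls (\<lambda>x. u x *s hat c x)"
      using ae_class_cls[of "\<lambda>x. fscale E (u x) (c x)"] by (simp add: fscale p hat_def)
    also have "\<dots> = cls (\<lambda>x. u x *s v x)"
      using c by (intro cls_cong) (auto simp: mem_cls elim: eventually_mono)
    finally show ?thesis .
  qed
  show ?thesis unfolding pointwise_mult_def using sec_cls[OF v] eq by auto
qed

lemma hscale_cls: "v \<in> borel_measurable borel \<Longrightarrow> hscale H z (cls v) = cls (\<lambda>x. z *s v x)"
  using pointwise_mult_cls[of v "\<lambda>_. z"] by (simp add: L2_def)

text \<open>All pairs of representatives yield the same integral and at least one pair exists, so
  the definite description denotes that integral.\<close>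

lemma hinner_cls:
  assumes v: "v \<in> borel_measurable borel" and w: "w \<in> borel_measurable borel"
  shows "hinner H (cls v) (cls w) = (LINT x|\<mu>. cdot (v x) (w x))"
proof -
  have eq: "(LINT x|\<mu>. fibre_inner E (c x) (d x)) = (LINT x|\<mu>. cdot (v x) (w x))"
    if c: "c \<in> cls v" and d: "d \<in> cls w" for c d
  proof -
    have p: "proj E (c x) = x" "proj E (d x) = x" for x using c d by (auto simp: mem_cls)
    have [measurable]: "hat c \<in> borel_measurable \<mu>" "hat d \<in> borel_measurable \<mu>"
      "v \<in> borel_measurable \<mu>" "w \<in> borel_measurable \<mu>"
      using c d v w by (simp_all add: mem_cls meas_\<mu>)
    have "(LINT x|\<mu>. fibre_inner E (c x) (d x)) = (LINT x|\<mu>. cdot (hat c x) (hat d x))"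
      by (simp add: fibre_inner_eq p hat_def)
    also have "\<dots> = (LINT x|\<mu>. cdot (v x) (w x))"
      using c d by (intro integral_cong_AE) (auto simp: mem_cls elim: eventually_elim2)
    finally show ?thesis .
  qed
  have "hinner H (cls v) (cls w) =
      (THE z. \<exists>c\<in>cls v. \<exists>d\<in>cls w. z = (LINT x|\<mu>. fibre_inner E (c x) (d x)))"
    by (simp add: L2_def)
  also have "\<dots> = (LINT x|\<mu>. cdot (v x) (w x))"
    using sec_cls[OF v] sec_cls[OF w] eq by (intro the_equality) (auto intro!: bexI)
  finally show ?thesis .
qed

subsection \<open>Restriction to a Borel set and multiplication operators\<close>

text \<open>Here the closure of smooth sections meets multipliers that are not smooth;
  \<open>L2D_mult\<close> carries the weight.\<close>

lemma mult_carrier: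
  assumes "u \<in> borel_measurable borel" "\<And>x. cmod (u x) \<le> B" "f \<in> carrier H"
  shows "pointwise_mult E \<mu> u f \<in> carrier H"
proof -
  obtain v where v: "v \<in> L2D" "f = cls v" using assms(3) by (auto simp: carrier_H)
  have "pointwise_mult E \<mu> u f = cls (\<lambda>x. u x *s v x)"
    unfolding v(2) by (rule pointwise_mult_cls[OF L2D_meas[OF v(1)]])
  then show ?thesis using L2D_mult[OF v(1) assms(1,2)] by (auto simp: carrier_H)
qed

lemma hadd_carrier: "f \<in> carrier H \<Longrightarrow> g \<in> carrier H \<Longrightarrow> hadd H f g \<in> carrier H"
  using L2D_add L2D_meas by (auto simp: carrier_H hadd_cls)

lemma hscale_carrier: "f \<in> carrier H \<Longrightarrow> hscale H z f \<in> carrier H"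
  using L2D_scale L2D_meas by (auto simp: carrier_H hscale_cls)

lemma carrier_nonempty: "carrier H \<noteq> {}"
  using S0_L2D[OF S0_zero] by (auto simp: carrier_H)

lemma cdot_integrable:
  assumes "v \<in> L2D"
  shows "integrable \<mu> (\<lambda>x. (norm (v x))\<^sup>2)"
proof (rule integrableI_nonneg)
  show "(\<lambda>x. (norm (v x))\<^sup>2) \<in> borel_measurable \<mu>"
    using L2D_meas[OF assms] unfolding meas_\<mu> by auto
  show "(\<integral>\<^sup>+ x. ennreal ((norm (v x))\<^sup>2) \<partial>\<mu>) < \<infinity>"
    using L2D_fin[OF assms] by (simp add: sq_norm_def)
qed simp

lemma hinner_self_zero:
  assumes v: "v \<in> L2D" and z: "hinner H (cls v) (cls v) = 0"
  shows "AE x in \<mu>. v x = 0"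
proof -
  have "hinner H (cls v) (cls v) = complex_of_real (LINT x|\<mu>. (norm (v x))\<^sup>2)"
    using L2D_meas[OF v] by (simp only: hinner_cls cdot_self integral_complex_of_real)
  then have "(LINT x|\<mu>. (norm (v x))\<^sup>2) = 0" using z by simp
  then have "AE x in \<mu>. (norm (v x))\<^sup>2 = 0"
    using integral_nonneg_eq_0_iff_AE[OF cdot_integrable[OF v]] by simp
  then show ?thesis by simp
qed

context
  fixes S :: "'m set"
  assumes S: "S \<in> sets borel"
begin

abbreviation on_S where "on_S \<equiv> pointwise_mult E \<mu> (indicator S)"
abbreviation off_S where "off_S \<equiv> pointwise_mult E \<mu> (indicator (- S))"

lemma indicators:
  "(indicator S :: 'm \<Rightarrow> complex) \<in> borel_measurable borel" "(indicator (- S) :: 'm \<Rightarrow> complex) \<in> borel_measurable borel"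
  "cmod (indicator S x) \<le> 1" "cmod (indicator (- S) x) \<le> 1"
  using S by (auto simp: indicator_def)

lemma on_S_carrier: "f \<in> carrier H \<Longrightarrow> on_S f \<in> carrier H"
  and off_S_carrier: "f \<in> carrier H \<Longrightarrow> off_S f \<in> carrier H"
  using mult_carrier[OF indicators(1,3)] mult_carrier[OF indicators(2,4)] by auto

lemma hadd_on_off: "f \<in> carrier H \<Longrightarrow> hadd H (on_S f) (off_S f) = f"
proof -
  assume "f \<in> carrier H"
  then obtain v where v: "v \<in> L2D" "f = cls v" by (auto simp: carrier_H)
  have [measurable]: "v \<in> borel_measurable borel" using L2D_meas[OF v(1)] .
  note [measurable] = indicators(1,2)
  have "indicator S x *s v x + indicator (- S) x *s v x = v x" for x
    by (simp add: indicator_def)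
  then show ?thesis by (simp add: v(2) pointwise_mult_cls hadd_cls)
qed

lemma on_off_orthogonal:
  assumes "f \<in> carrier H" "g \<in> carrier H" shows "hinner H (on_S f) (off_S g) = 0"
proof -
  obtain v w where v: "v \<in> L2D" "f = cls v" and w: "w \<in> L2D" "g = cls w"
    using assms by (auto simp: carrier_H)
  note [measurable] = L2D_meas[OF v(1)] L2D_meas[OF w(1)] indicators(1,2)
  have "cdot (indicator S x *s v x) (indicator (- S) x *s w x) = 0" for x
    by (simp add: indicator_def cdot_def)
  then show ?thesis by (simp add: v(2) w(2) pointwise_mult_cls hinner_cls)
qed

text \<open>For uniqueness, a competitor \<open>on_S (cls w)\<close> is tested against
  \<open>on_S (cls d)\<close> with \<open>d = v - w\<close>, which lies in the subspace. The inner
  product is then the squared norm of \<open>d\<close> restricted to \<open>S\<close>, so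
  \<open>v\<close> and \<open>w\<close> agree almost everywhere on \<open>S\<close>.\<close>

lemma orth_projection_eq:
  assumes "f \<in> carrier H"
  shows "orth_projection H (L2_restrict \<A> \<mu> E S) f = on_S f"
  unfolding orth_projection_def
proof (rule the_equality)
  obtain v where v: "v \<in> L2D" "f = cls v" using assms by (auto simp: carrier_H)
  note [measurable] = L2D_meas[OF v(1)] indicators(1,2)
  have "hdiff H f (on_S f) = off_S f"
  proof -
    have "v x + (- 1) *s (indicator S x *s v x) = indicator (- S) x *s v x" for x
      by (simp add: indicator_def vec_eq_iff)
    then show ?thesis by (simp add: hdiff_def v(2) pointwise_mult_cls hscale_cls hadd_cls)
  qed
  then show "on_S f \<in> L2_restrict \<A> \<mu> E S \<and> (\<forall>w\<in>L2_restrict \<A> \<mu> E S. hinner H w (hdiff H f (on_S f)) = 0)"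
    using assms on_off_orthogonal by (auto simp: L2_restrict_def)
  fix g assume g: "g \<in> L2_restrict \<A> \<mu> E S \<and> (\<forall>w\<in>L2_restrict \<A> \<mu> E S. hinner H w (hdiff H f g) = 0)"
  then obtain w where w: "w \<in> L2D" "g = on_S (cls w)" by (auto simp: L2_restrict_def carrier_H)
  note [measurable] = L2D_meas[OF w(1)]
  define d where "d = (\<lambda>x. v x + (- 1) *s w x)"
  have d: "d \<in> L2D" unfolding d_def by (intro L2D_add L2D_scale v w)
  note [measurable] = L2D_meas[OF d]
  have Sd: "(\<lambda>x. indicator S x *s d x) \<in> L2D" by (rule L2D_mult[OF d indicators(1,3)])
  have "on_S (cls d) \<in> L2_restrict \<A> \<mu> E S" using d by (auto simp: L2_restrict_def carrier_H)
  then have "hinner H (on_S (cls d)) (hdiff H f g) = 0" using g by blast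
  moreover have "hinner H (on_S (cls d)) (hdiff H f g) =
      hinner H (cls (\<lambda>x. indicator S x *s d x)) (cls (\<lambda>x. indicator S x *s d x))"
  proof -
    have "cdot (indicator S x *s d x) (v x + (- 1) *s (indicator S x *s w x)) =
        cdot (indicator S x *s d x) (indicator S x *s d x)" for x
      by (simp add: indicator_def d_def cdot_def)
    then show ?thesis
      by (simp add: hdiff_def v(2) w(2) pointwise_mult_cls hscale_cls hadd_cls hinner_cls)
  qed
  ultimately have "AE x in \<mu>. indicator S x *s d x = 0" using hinner_self_zero[OF Sd] by simp
  then have "AE x in \<mu>. indicator S x *s w x = indicator S x *s v x"
    by eventually_elim (auto simp: indicator_def d_def vec_eq_iff)
  then show "g = on_S f"
    unfolding v(2) w(2) pointwise_mult_cls[OF L2D_meas[OF v(1)]] pointwise_mult_cls[OF L2D_meas[OF w(1)]]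
    by (rule cls_cong)
qed

end

lemma pointwise_mult_cong:
  assumes "AE x in \<mu>. u x = u' x" "f \<in> carrier H"
  shows "pointwise_mult E \<mu> u f = pointwise_mult E \<mu> u' f"
proof -
  obtain v where v: "v \<in> L2D" "f = cls v" using assms by (auto simp: carrier_H)
  show ?thesis unfolding v(2) pointwise_mult_cls[OF L2D_meas[OF v(1)]]
    using assms(1) by (intro cls_cong) (auto elim: eventually_mono)
qed

lemma pointwise_mult_mult:
  assumes "u \<in> borel_measurable borel" "u' \<in> borel_measurable borel" "f \<in> carrier H"
  shows "pointwise_mult E \<mu> u (pointwise_mult E \<mu> u' f) = pointwise_mult E \<mu> (\<lambda>x. u x * u' x) f"
proof -
  obtain v where v: "v \<in> L2D" "f = cls v" using assms by (auto simp: carrier_H)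
  note [measurable] = L2D_meas[OF v(1)] assms(1,2)
  show ?thesis unfolding v(2) by (simp add: pointwise_mult_cls vector_smult_assoc)
qed

lemma pointwise_mult_one: "f \<in> carrier H \<Longrightarrow> pointwise_mult E \<mu> (\<lambda>_. 1) f = f"
  using L2D_meas by (auto simp: carrier_H pointwise_mult_cls)

text \<open>Members of \<open>unitary_Linf\<close> have modulus 1 only almost everywhere, whereas
  \<open>mult_carrier\<close> asks for a bound at every point; the value 1 on the exceptional set
  repairs this.\<close>

lemma unitary_mult:
  assumes h: "h \<in> unitary_Linf \<mu>"
  obtains u where "u \<in> borel_measurable borel" "\<And>x. cmod (u x) = 1" "AE x in \<mu>. h x = u x"
proof -
  have hm: "h \<in> borel_measurable borel" using h by (simp add: unitary_Linf_def meas_\<mu>)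
  have ae: "AE x in \<mu>. cnj (h x) * h x = 1" using h by (simp add: unitary_Linf_def)
  define u where "u = (\<lambda>x. if cmod (h x) = 1 then h x else 1)"
  have "u \<in> borel_measurable borel" unfolding u_def using hm by measurable
  moreover have "cmod (u x) = 1" for x by (simp add: u_def)
  moreover have "AE x in \<mu>. h x = u x"
    using ae
  proof eventually_elim
    fix x assume "cnj (h x) * h x = 1"
    then have "cmod (cnj (h x) * h x) = 1" by simp
    then have "(cmod (h x))\<^sup>2 = 1" by (simp add: norm_mult power2_eq_square)
    then have "cmod (h x) = 1" by (simp add: power2_eq_1_iff) (smt (verit) norm_ge_zero)
    then show "h x = u x" by (simp add: u_def)
  qed
  ultimately show ?thesis using that by blast
qed

lemma hinner_unitary:
  assumes "u \<in> borel_measurable borel" "\<And>x. cmod (u x) = 1" "f \<in> carrier H" "g \<in> carrier H"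
  shows "hinner H (pointwise_mult E \<mu> u f) (pointwise_mult E \<mu> u g) = hinner H f g"
proof -
  obtain v w where v: "v \<in> L2D" "f = cls v" and w: "w \<in> L2D" "g = cls w"
    using assms by (auto simp: carrier_H)
  note [measurable] = L2D_meas[OF v(1)] L2D_meas[OF w(1)] assms(1)
  have "cdot (u x *s v x) (u x *s w x) = cdot (v x) (w x)" for x
  proof -
    have "cnj (u x) * u x = 1" using assms(2)[of x] complex_norm_square[of "u x"] by (simp add: mult.commute)
    then show ?thesis by (simp add: cdot_simps flip: mult.assoc) (simp add: mult.commute)
  qed
  then show ?thesis by (simp add: v(2) w(2) pointwise_mult_cls hinner_cls)
qed

end

theorem theorem5p1:
  fixes \<A> :: "('m::t2_space, 'k::finite) chart set"
    and \<mu> :: "'m measure"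
    and G :: "(complex ^ 'n::finite ^ 'n) set"
    and E :: "('m, 'e::topological_space, 'n) vbundle"
    and S :: "'m set"
    and a :: "('m \<Rightarrow> 'e) set \<Rightarrow> 'b::cstar_algebra"
  assumes "smooth_atlas \<A>"
    and "sigma_compact_space TYPE('m)"
    and "locally_Lebesgue \<A> \<mu>"
    and "subgroup G unitary_group" and "closed G"
    and "G_bundle \<A> G E"
    and "S \<in> sets borel" and "compact (closure S)"
    and "is_CAR (L2 \<A> \<mu> E) a"
  shows "\<exists>\<nu> :: 'b \<Rightarrow> 'b.
    conditional_expectation \<nu> \<and>
    range \<nu> \<subseteq> cstar_generated (a ` L2_restrict \<A> \<mu> E S) \<and>
    (\<forall>h\<in>unitary_Linf_on \<mu> (- S). \<forall>A.
       \<nu> (CAR_automorphism (L2 \<A> \<mu> E) a (pointwise_mult E \<mu> h) A) = \<nu> A) \<and>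
    (\<forall>fs gs. set fs \<subseteq> carrier (L2 \<A> \<mu> E) \<and> set gs \<subseteq> carrier (L2 \<A> \<mu> E) \<longrightarrow>
       (let p = orth_projection (L2 \<A> \<mu> E) (L2_restrict \<A> \<mu> E S) in
        \<nu> (prod_list (map (\<lambda>f. star (a f)) fs) * prod_list (map a gs)) =
        prod_list (map (\<lambda>f. star (a (p f))) fs) * prod_list (map (\<lambda>g. a (p g)) gs)))"
proof -
  have "sets \<mu> = sets borel" using assms(3) by (simp add: locally_Lebesgue_def)
  then interpret hermitian_bundle \<A> \<mu> G E
    by (rule hermitian_bundle.intro[OF assms(1,2) _ assms(4,6)])
  note S = assms(7)
  let ?on = "pointwise_mult E \<mu> (indicator S)" and ?off = "pointwise_mult E \<mu> (indicator (- S))"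
  have a_add: "a (hadd H f g) = a f + a g" if "f \<in> carrier H" "g \<in> carrier H" for f g
    using assms(9) that unfolding is_CAR_def by blast
  have a_scale: "a (hscale H z f) = cnj z *\<^sub>C a f" if "f \<in> carrier H" for z f
    using assms(9) that unfolding is_CAR_def by blast
  have a_car: "a f * star (a g) + star (a g) * a f = hinner H f g *\<^sub>C 1" "a f * a g + a g * a f = 0"
    if "f \<in> carrier H" "g \<in> carrier H" for f g
    using assms(9) that unfolding is_CAR_def by blast+
  have a_gen: "cstar_generated (a ` carrier H) = UNIV"
    using assms(9) unfolding is_CAR_def by blast
  let ?V = "a ` carrier H"
  \<comment> \<open>Defined from the anticommutator in the algebra rather than through preimages
    under \<open>a\<close>, which would raise the question of injectivity.\<close>
  define ip where "ip x y = (THE c. x * star y + star y * x = c *\<^sub>C (1::'b))" for x y :: 'b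
  have ip: "ip (a f) (a g) = hinner H f g" if "f \<in> carrier H" "g \<in> carrier H" for f g
    unfolding ip_def a_car(1)[OF that] by (rule the_equality) (simp_all add: scaleC_one_eq_iff)
  have scale: "z *\<^sub>C a f = a (hscale H (cnj z) f)" if "f \<in> carrier H" for z f
    using a_scale[OF that, of "cnj z"] by simp
  have minus: "- a f = a (hscale H (- 1) f)" if "f \<in> carrier H" for f
    using a_scale[OF that, of "- 1"] by simp
  interpret car: car_space ?V ip
  proof
    obtain f where f: "f \<in> carrier H" using carrier_nonempty by blast
    have "a (hscale H 0 f) = 0" using a_scale[OF f, of 0] by simp
    then show "0 \<in> ?V" using hscale_carrier[OF f, of 0] by (metis imageI)
    show "x + y \<in> ?V" if "x \<in> ?V" "y \<in> ?V" for x y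
      using that hadd_carrier by (auto simp: a_add[symmetric])
    show "z *\<^sub>C x \<in> ?V" if "x \<in> ?V" for z x
      using that hscale_carrier by (auto simp: scale)
    show "x * star y + star y * x = ip x y *\<^sub>C 1" if "x \<in> ?V" "y \<in> ?V" for x y
      using that by (auto simp: ip a_car(1))
    show "x * y + y * x = 0" if "x \<in> ?V" "y \<in> ?V" for x y
      using that by (auto simp: a_car(2))
  qed (rule a_gen)
  let ?W = "a ` L2_restrict \<A> \<mu> E S" and ?W' = "a ` ?off ` carrier H"
  have W: "?W = a ` ?on ` carrier H" by (simp add: L2_restrict_def)
  have split: "a f = a (?on f) + a (?off f)" if "f \<in> carrier H" for f
    using a_add[OF on_S_carrier[OF S that] off_S_carrier[OF S that]] hadd_on_off[OF S that] by simp
  have off_add: "hadd H (?off f) (?off g) = ?off (hadd H f g)"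
    and off_scale: "hscale H z (?off f) = ?off (hscale H z f)"
    if fg: "f \<in> carrier H" "g \<in> carrier H" for f g z
  proof -
    obtain v w where v: "v \<in> L2D" "f = cls v" and w: "w \<in> L2D" "g = cls w"
      using fg by (auto simp: carrier_H)
    note [measurable] = L2D_meas[OF v(1)] L2D_meas[OF w(1)] indicators(2)[OF S]
    show "hadd H (?off f) (?off g) = ?off (hadd H f g)"
      by (simp add: v(2) w(2) pointwise_mult_cls hadd_cls vector_add_ldistrib)
    show "hscale H z (?off f) = ?off (hscale H z f)"
      by (simp add: v(2) pointwise_mult_cls hscale_cls vector_smult_assoc mult.commute)
  qed
  obtain \<nu> where \<nu>: "conditional_expectation \<nu>" "range \<nu> \<subseteq> cstar_generated ?W"
    "\<And>x w w'. w \<in> ?W \<Longrightarrow> w' \<in> ?W' \<Longrightarrow> \<nu> (x * (w + w')) = \<nu> x * w"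
    "\<And>x w w'. w \<in> ?W \<Longrightarrow> w' \<in> ?W' \<Longrightarrow> \<nu> (star (w + w') * x) = star w * \<nu> x"
    "\<And>\<alpha> x. star_automorphism \<alpha> \<Longrightarrow> (\<And>w. w \<in> ?W \<Longrightarrow> \<alpha> w = w) \<Longrightarrow> (\<And>w'. w' \<in> ?W' \<Longrightarrow> \<alpha> w' \<in> ?W')
       \<Longrightarrow> \<nu> (\<alpha> x) = \<nu> x"
  proof (rule car.expectation_exists[of ?W ?W'])
    show "?W \<subseteq> ?V" unfolding W using on_S_carrier[OF S] by auto
    show "?W' \<subseteq> ?V" using off_S_carrier[OF S] by auto
    show "x - y \<in> ?W'" if xy: "x \<in> ?W'" "y \<in> ?W'" for x y
    proof -
      obtain f g where fg: "f \<in> carrier H" "g \<in> carrier H" "x = a (?off f)" "y = a (?off g)"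
        using xy by auto
      have "x - y = a (?off f) + a (?off (hscale H (- 1) g))"
        using minus[OF off_S_carrier[OF S fg(2)]] off_scale[OF fg(2,2)] fg by simp
      also have "\<dots> = a (?off (hadd H f (hscale H (- 1) g)))"
        using fg off_add[OF fg(1) hscale_carrier[OF fg(2)]]
        by (subst a_add[symmetric]) (auto intro: off_S_carrier[OF S] hscale_carrier)
      finally show ?thesis using fg hadd_carrier hscale_carrier by blast
    qed
    show "z *\<^sub>C x \<in> ?W'" if x: "x \<in> ?W'" for z x
    proof -
      obtain f where f: "f \<in> carrier H" "x = a (?off f)" using x by auto
      then have "z *\<^sub>C x = a (?off (hscale H (cnj z) f))"
        using scale[OF off_S_carrier[OF S f(1)]] off_scale[OF f(1) f(1)] by simp
      then show ?thesis using hscale_carrier[OF f(1)] by blast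
    qed
    show "ip w w' = 0" if "w \<in> ?W" "w' \<in> ?W'" for w w'
      using that unfolding W
      by (auto simp: ip on_S_carrier[OF S] off_S_carrier[OF S] on_off_orthogonal[OF S])
    show "\<exists>w\<in>?W. \<exists>w'\<in>?W'. v = w + w'" if "v \<in> ?V" for v
      using that split unfolding W by blast
  qed (use that in blast)
  have aut: "\<nu> (CAR_automorphism H a (pointwise_mult E \<mu> h) A) = \<nu> A"
    if h: "h \<in> unitary_Linf_on \<mu> (- S)" for h A
  proof -
    obtain u where u: "u \<in> borel_measurable borel" "\<And>x. cmod (u x) = 1" "AE x in \<mu>. h x = u x"
      using h unitary_mult by (auto simp: unitary_Linf_on_def)
    have uS: "AE x in \<mu>. x \<in> S \<longrightarrow> u x = 1"
      using h u(3) by (auto simp: unitary_Linf_on_def elim: eventually_elim2)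
    let ?U = "pointwise_mult E \<mu> u"
    have hU: "pointwise_mult E \<mu> h f = ?U f" if "f \<in> carrier H" for f
      by (rule pointwise_mult_cong[OF u(3) that])
    have ule: "cmod (u x) \<le> 1" "cmod (cnj (u x)) \<le> 1" for x using u(2) by simp_all
    have cu: "(\<lambda>x. cnj (u x)) \<in> borel_measurable borel"
      by (rule measurable_compose[OF u(1) borel_measurable_continuous_onI]) (intro continuous_intros)
    have UC: "?U f \<in> carrier H" if "f \<in> carrier H" for f by (rule mult_carrier[OF u(1) ule(1) that])
    \<comment> \<open>Multiplication by \<open>cnj u\<close> inverts \<open>?U\<close>. Surjectivity
      makes the elements \<open>a (?U f)\<close> generate the algebra, as
      \<open>automorphism_exists\<close> requires.\<close>
    have surj: "\<exists>g\<in>carrier H. f = ?U g" if f: "f \<in> carrier H" for f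
    proof (rule bexI)
      show "pointwise_mult E \<mu> (\<lambda>x. cnj (u x)) f \<in> carrier H" by (rule mult_carrier[OF cu ule(2) f])
      have "u x * cnj (u x) = 1" for x using u(2)[of x] complex_norm_square[of "u x"] by simp
      then show "f = ?U (pointwise_mult E \<mu> (\<lambda>x. cnj (u x)) f)"
        using pointwise_mult_mult[OF u(1) cu f] pointwise_mult_one[OF f] by simp
    qed
    have img: "(\<lambda>f. a (?U f)) ` carrier H = ?V" using UC surj by force
    obtain \<alpha> where \<alpha>: "star_automorphism \<alpha>" "\<And>f. f \<in> carrier H \<Longrightarrow> \<alpha> (a f) = a (?U f)"
    proof (rule car.automorphism_exists[of "carrier H" a "\<lambda>f. a (?U f)"])
      show "a f \<in> ?V \<and> a (?U f) \<in> ?V" if "f \<in> carrier H" for f using that UC by blast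
      show "ip (a f) (a g) = ip (a (?U f)) (a (?U g))" if "f \<in> carrier H" "g \<in> carrier H" for f g
        using that by (simp add: ip UC hinner_unitary[OF u(1,2)])
    qed (use that img a_gen in simp_all)
    \<comment> \<open>\<open>h\<close> and \<open>u\<close> act alike on \<open>carrier H\<close>.
      Existence in the definite description comes from \<open>\<alpha>\<close>, uniqueness from
      \<open>star_hom_eq\<close> on the generators.\<close>
    have "CAR_automorphism H a (pointwise_mult E \<mu> h) = \<alpha>"
      unfolding CAR_automorphism_def
    proof (rule the_equality)
      show "star_automorphism \<alpha> \<and> (\<forall>f\<in>carrier H. \<alpha> (a f) = a (pointwise_mult E \<mu> h f))"
        using \<alpha> hU by simp
      show "\<beta> = \<alpha>" if \<beta>: "star_automorphism \<beta> \<and> (\<forall>f\<in>carrier H. \<beta> (a f) = a (pointwise_mult E \<mu> h f))" for \<beta>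
        by (rule star_hom_eq[OF _ _ a_gen]) (use \<alpha> \<beta> hU in \<open>auto intro: star_automorphism_star_hom\<close>)
    qed
    \<comment> \<open>Vectors over \<open>S\<close> are fixed, as \<open>u = 1\<close> almost
      everywhere there; vectors over the complement stay over it, because multiplication operators
      commute.\<close>
    moreover have "\<nu> (\<alpha> A) = \<nu> A"
    proof (rule \<nu>(5)[OF \<alpha>(1)])
      fix w assume "w \<in> ?W"
      then obtain f where f: "f \<in> carrier H" "w = a (?on f)" unfolding W by auto
      have "?U (?on f) = pointwise_mult E \<mu> (\<lambda>x. u x * indicator S x) f"
        by (rule pointwise_mult_mult[OF u(1) indicators(1)[OF S] f(1)])
      also have "\<dots> = ?on f"
        by (rule pointwise_mult_cong[OF _ f(1)]) (use uS in \<open>auto simp: indicator_def elim: eventually_mono\<close>)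
      finally show "\<alpha> w = w" using \<alpha>(2)[OF on_S_carrier[OF S f(1)]] f(2) by simp
    next
      fix w assume "w \<in> ?W'"
      then obtain f where f: "f \<in> carrier H" "w = a (?off f)" by auto
      have "?U (?off f) = ?off (?U f)"
        using pointwise_mult_mult[OF u(1) indicators(2)[OF S] f(1)]
          pointwise_mult_mult[OF indicators(2)[OF S] u(1) f(1)] by (simp add: mult.commute)
      then have "\<alpha> w = a (?off (?U f))" using \<alpha>(2)[OF off_S_carrier[OF S f(1)]] f(2) by simp
      then show "\<alpha> w \<in> ?W'" using UC[OF f(1)] by blast
    qed
    ultimately show ?thesis by simp
  qed
  have right: "\<nu> (x * a f) = \<nu> x * a (?on f)" and left: "\<nu> (star (a f) * x) = star (a (?on f)) * \<nu> x"
    if "f \<in> carrier H" for x f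
    using \<nu>(3,4)[of "a (?on f)" "a (?off f)" x] split[OF that] that unfolding W by auto
  have one: "\<nu> 1 = 1" using \<nu>(1) by (simp add: conditional_expectation_def)
  \<comment> \<open>Annihilators are peeled off at the right end, hence \<open>rev_induct\<close>;
    creators are then peeled off at the left end, with the product of annihilators as the base
    case.\<close>
  have "\<nu> (prod_list (map a gs)) = prod_list (map (\<lambda>g. a (?on g)) gs)" if "set gs \<subseteq> carrier H" for gs
    using that by (induction gs rule: rev_induct) (auto simp: one right)
  then have wick: "\<nu> (prod_list (map (\<lambda>f. star (a f)) fs) * prod_list (map a gs)) =
        prod_list (map (\<lambda>f. star (a (?on f))) fs) * prod_list (map (\<lambda>g. a (?on g)) gs)"
    if "set fs \<subseteq> carrier H" "set gs \<subseteq> carrier H" for fs gs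
    using that by (induction fs) (auto simp: left mult.assoc)
  let ?p = "orth_projection H (L2_restrict \<A> \<mu> E S)"
  have "\<nu> (prod_list (map (\<lambda>f. star (a f)) fs) * prod_list (map a gs)) =
      prod_list (map (\<lambda>f. star (a (?p f))) fs) * prod_list (map (\<lambda>g. a (?p g)) gs)"
    if "set fs \<subseteq> carrier H" "set gs \<subseteq> carrier H" for fs gs
  proof -
    have "map (\<lambda>f. star (a (?p f))) fs = map (\<lambda>f. star (a (?on f))) fs"
      "map (\<lambda>g. a (?p g)) gs = map (\<lambda>g. a (?on g)) gs"
      using that orth_projection_eq[OF S] by auto
    then show ?thesis using wick[OF that] by (simp only:)
  qed
  then show ?thesis unfolding Let_def using \<nu>(1,2) aut by blast
qed

end
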